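(* The trapezoidal fully discrete scheme is stable: its solution $V_{\Delta t}=\{V_k\}_{k=0}^K$ satisfies, for $\ell\in\{1,\dots,K\}$, $$\|\operatorname{tr}\mathfrak dV_\ell\|_{L^2(\Omega)}+\|V_{\ell-1/2}\|_{\mathcal C}\lesssim\|\operatorname{tr}\mathfrak dV_1\|_{L^2(\Omega)}+\|V_{1/2}\|_{\mathcal C}+\sum_{k=1}^{\ell}\Delta t\,\|\mathfrak cf_k\|_{L^2(\Omega)},$$ where the hidden constant is independent of $V_{\Delta t}$ and $\Delta t$. (Here $\mathfrak cf_k$ is defined for $1\le k\le K-1$; in the sum a term with $k=K$ is omitted.)
   Context: $\Omega\subset\mathbb R^n$ ($n\ge1$) is an open, bounded, convex polytope. $A\in C^{0,1}(\Omega,GL(n,\mathbb R))$ is symmetric and uniformly positive definite, $0\le c\in L^\infty(\Omega)$; $(\lambda_k,\varphi_k)_{k\ge1}$ are the Dirichlet eigenpairs of $\mathcal Lw=-\operatorname{div}(A\nabla w)+cw$ with $\{\varphi_k\}$ an orthonormal basis of $L^2(\Omega)$. $\mathbb H^r(\Omega)=\{w=\sum_k w_k\varphi_k:\|w\|^2_{\mathbb H^r(\Omega)}=\sum_k\lambda_k^r|w_k|^2<\infty\}$ for $r\ge0$. $s\in(0,1)$, $\alpha=1-2s$, $d_s=2^\alpha\Gamma(1-s)/\Gamma(s)$, $\mathbf A=\operatorname{diag}\{A,1\}$, $\mathcal Y>0$, $\mathcal C_{\mathcal Y}=\Omega\times(0,\mathcal Y)$; $\mathring H^1_L(y^\alpha,\mathcal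 C_{\mathcal Y})$ is the space of $w\in H^1(y^\alpha,\mathcal C_{\mathcal Y})$ vanishing on $\partial\Omega\times(0,\mathcal Y)$ and $\Omega\times\{\mathcal Y\}$; $a_{\mathcal Y}(w,\phi)=\frac1{d_s}\int_{\mathcal C_{\mathcal Y}}y^\alpha(\mathbf A\nabla w\cdot\nabla\phi+c\,w\phi)\,dx$; $\|w\|_{\mathcal C}^2=a_{\mathcal Y}(w,w)$ for such $w$; $\operatorname{tr}$ is the trace onto $\Omega\times\{0\}$; $\langle\cdot,\cdot\rangle$ is the $\mathbb H^{-s}$–$\mathbb H^s$ pairing ($L^2(\Omega)$ inner product on $L^2$ functions). $\mathcal H_\alpha w$, for $w\in\mathbb H^s(\Omega)$, is the function in $\mathring H^1_L(y^\alpha,\mathcal C_{\mathcal Y})$ with $\operatorname{tr}\mathcal H_\alpha w=w$ and $a_{\mathcal Y}(\mathcal H_\alpha w,\phi)=0$ for all $\phi\in\mathring H^1_L(y^\alpha,\mathcal C_{\mathcal Y})$ with $\operatorname{tr}\phi=0$. $\mathscr T$ is a conforming simplicial mesh of $\overline\Omega$, $S^1_0(\Omega,\mathscr T)$ the continuous piecewise linear functions vanishing on $\partial\Omega$; for $\sigma\in(0,1)$, $M\in\mathbb N$, $[0,\mathcal Y]$ is split into $I_1=[0,\mathcal Y\sigma^{M-1}]$, $I_m=[\mathcal Y\sigma^{M-m+1},\mathcal Y\sigma^{M-m}]$, $2\le m\le M$; $S^{\boldsymbol r}_{\{\mathcal Y\}}$ is the space of $v\in C[0,\mathcal Y]$ with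 $v|_{I_m}\in\mathbb P_{r_m}$, $v(\mathcal Y)=0$, $r_m=\max\{1,\lceil\mathfrak sm\rceil\}$; $\mathbb V(\mathscr T_{\mathcal Y})=S^1_0(\Omega,\mathscr T)\otimes S^{\boldsymbol r}_{\{\mathcal Y\}}$. $G_{\mathscr T_{\mathcal Y}}w\in\mathbb V(\mathscr T_{\mathcal Y})$ is defined by $a_{\mathcal Y}(G_{\mathscr T_{\mathcal Y}}w,W)=a_{\mathcal Y}(w,W)$ for all $W\in\mathbb V(\mathscr T_{\mathcal Y})$. Time grid: $K\in\mathbb N$, $\Delta t=T/K$, $t_k=k\Delta t$; $f_k=f(t_k)\in L^2(\Omega)$ for $f\in C([0,T];L^2(\Omega))$. For a sequence $w_k$: $\mathfrak dw_{k+1}=(w_{k+1}-w_k)/\Delta t$, $w_{k+1/2}=\frac12(w_{k+1}+w_k)$, $\mathfrak cw_k=\frac14(w_{k+1}+2w_k+w_{k-1})$. Trapezoidal scheme: $V_0=G_{\mathscr T_{\mathcal Y}}\mathcal H_\alpha g$, $V_1=G_{\mathscr T_{\mathcal Y}}(\mathcal H_\alpha g+\Delta t\,\mathcal H_\alpha h+\frac12(\Delta t)^2\mathcal H_\alpha w)$, where $g,h\in\mathbb H^s(\Omega)$ and $w\in\mathbb H^s(\Omega)$ (assumed to exist) satisfies $\langle w,\operatorname{tr}\phi\rangle=-a_{\mathcal Y}(\mathcal H_\alpha g,\phi)+\langle f(0),\operatorname{tr}\phi\rangle$ for all $\phi\in\mathring H^1_L(y^\alpha,\mathcal C_{\mathcal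 Y})$; for $k=1,\dots,K-1$, $V_{k+1}\in\mathbb V(\mathscr T_{\mathcal Y})$ solves $$\tfrac1{\Delta t^2}\langle\operatorname{tr}(V_{k+1}-2V_k+V_{k-1}),\operatorname{tr}W\rangle+a_{\mathcal Y}(\mathfrak cV_k,W)=\langle\mathfrak cf_k,\operatorname{tr}W\rangle\quad\forall W\in\mathbb V(\mathscr T_{\mathcal Y}).$$ $a\lesssim b$ means $a\le Cb$ with $C$ having the stated independence. *)

theory Defs
  imports "HOL-Analysis.Analysis" "HOL-Computational_Algebra.Polynomial"
begin

text \<open>
  Elements of Lebesgue and Sobolev spaces are represented by functions on the whole space, of which
  only the values almost everywhere on the domain matter.
\<close>

definition L2 :: "'a measure \<Rightarrow> ('a \<Rightarrow> 'b::euclidean_space) set" where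
  "L2 M = {u. u \<in> borel_measurable M \<and> integrable M (\<lambda>x. (norm (u x))\<^sup>2)}"

definition l2norm :: "'a measure \<Rightarrow> ('a \<Rightarrow> 'b::euclidean_space) \<Rightarrow> real" where
  "l2norm M u = sqrt (\<integral>x. (norm (u x))\<^sup>2 \<partial>M)"

definition l2inner :: "'a measure \<Rightarrow> ('a \<Rightarrow> real) \<Rightarrow> ('a \<Rightarrow> real) \<Rightarrow> real" where
  "l2inner M u v = (\<integral>x. u x * v x \<partial>M)"


subsection \<open>Weak gradients, Sobolev spaces and traces\<close>

text \<open>\<open>D\<close> is the gradient of the compactly supported \<open>C\<^sup>1\<close> function \<open>\<phi>\<close>. For first-order weak
  derivatives, \<open>C\<^sup>1\<close> and smooth test functions are interchangeable.\<close>

definition test_function ::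
    "'a::euclidean_space set \<Rightarrow> ('a \<Rightarrow> real) \<Rightarrow> ('a \<Rightarrow> 'a) \<Rightarrow> bool" where
  "test_function S \<phi> D \<longleftrightarrow>
     (\<forall>x. (\<phi> has_derivative (\<lambda>h. D x \<bullet> h)) (at x)) \<and> continuous_on UNIV D \<and>
     (\<exists>K. compact K \<and> K \<subseteq> S \<and> (\<forall>x. x \<notin> K \<longrightarrow> \<phi> x = 0))"

definition has_weak_grad ::
    "'a::euclidean_space set \<Rightarrow> ('a \<Rightarrow> real) \<Rightarrow> ('a \<Rightarrow> 'a) \<Rightarrow> bool" where
  "has_weak_grad S w G \<longleftrightarrow>
     (\<forall>K. compact K \<and> K \<subseteq> S \<longrightarrow> integrable (lebesgue_on K) w \<and> integrable (lebesgue_on K) G) \<and>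
     (\<forall>\<phi> D. test_function S \<phi> D \<longrightarrow>
        (\<integral>x. w x *\<^sub>R D x \<partial>lebesgue_on S) = - (\<integral>x. \<phi> x *\<^sub>R G x \<partial>lebesgue_on S))"

definition weak_grad :: "'a::euclidean_space set \<Rightarrow> ('a \<Rightarrow> real) \<Rightarrow> 'a \<Rightarrow> 'a" where
  "weak_grad S w = (SOME G. has_weak_grad S w G)"

text \<open>In \<open>H1 M S\<close>, the set \<open>S\<close> is an open domain and \<open>M\<close> is a (weighted) Lebesgue measure on \<open>S\<close>.\<close>

definition H1 :: "'a::euclidean_space measure \<Rightarrow> 'a set \<Rightarrow> ('a \<Rightarrow> real) set" where
  "H1 M S = {w \<in> L2 M. \<exists>G \<in> L2 M. has_weak_grad S w G}"

definition h1norm :: "'a::euclidean_space measure \<Rightarrow> 'a set \<Rightarrow> ('a \<Rightarrow> real) \<Rightarrow> real" where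
  "h1norm M S w = sqrt ((l2norm M w)\<^sup>2 + (l2norm M (weak_grad S w))\<^sup>2)"

text \<open>The functions in \<open>H1 M S\<close> that vanish on \<open>\<Gamma> \<subseteq> frontier S\<close>: the closure of those that are
  continuous up to the boundary and vanish on \<open>\<Gamma>\<close> pointwise.\<close>

definition H1_vanishing ::
    "'a::euclidean_space measure \<Rightarrow> 'a set \<Rightarrow> 'a set \<Rightarrow> ('a \<Rightarrow> real) set" where
  "H1_vanishing M S \<Gamma> = {w \<in> H1 M S. \<exists>v :: nat \<Rightarrow> 'a \<Rightarrow> real.
     (\<forall>j. v j \<in> H1 M S \<and> continuous_on (closure S) (v j) \<and> (\<forall>x\<in>\<Gamma>. v j x = 0)) \<and>
     (\<lambda>j. h1norm M S (\<lambda>x. v j x - w x)) \<longlonglongrightarrow> 0}"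

definition H10 :: "(real^'n) set \<Rightarrow> (real^'n \<Rightarrow> real) set" where
  "H10 \<Omega> = H1_vanishing (lebesgue_on \<Omega>) \<Omega> (frontier \<Omega>)"


subsection \<open>The elliptic operator on the domain\<close>

definition open_convex_polytope :: "(real^'n) set \<Rightarrow> bool" where
  "open_convex_polytope \<Omega> \<longleftrightarrow>
     open \<Omega> \<and> bounded \<Omega> \<and> convex \<Omega> \<and> \<Omega> \<noteq> {} \<and> polytope (closure \<Omega>)"

definition admissible_diffusion :: "(real^'n) set \<Rightarrow> (real^'n \<Rightarrow> real^'n^'n) \<Rightarrow> bool" where
  "admissible_diffusion \<Omega> A \<longleftrightarrow>
     (\<exists>L. L-lipschitz_on \<Omega> A) \<and>
     (\<forall>x\<in>\<Omega>. invertible (A x) \<and> transpose (A x) = A x) \<and>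
     (\<exists>a>0. \<forall>x\<in>\<Omega>. \<forall>\<xi>. a * (norm \<xi>)\<^sup>2 \<le> \<xi> \<bullet> (A x *v \<xi>))"

definition admissible_reaction :: "(real^'n) set \<Rightarrow> (real^'n \<Rightarrow> real) \<Rightarrow> bool" where
  "admissible_reaction \<Omega> c \<longleftrightarrow>
     c \<in> borel_measurable (lebesgue_on \<Omega>) \<and>
     (AE x in lebesgue_on \<Omega>. 0 \<le> c x) \<and> (\<exists>B. AE x in lebesgue_on \<Omega>. \<bar>c x\<bar> \<le> B)"

text \<open>Eigenpairs are indexed from \<open>0\<close>; the eigenvalue problem is understood in the weak sense.\<close>

definition dirichlet_eigenpairs ::
    "(real^'n) set \<Rightarrow> (real^'n \<Rightarrow> real^'n^'n) \<Rightarrow> (real^'n \<Rightarrow> real) \<Rightarrow>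
     (nat \<Rightarrow> real) \<Rightarrow> (nat \<Rightarrow> real^'n \<Rightarrow> real) \<Rightarrow> bool" where
  "dirichlet_eigenpairs \<Omega> A c lam \<phi> \<longleftrightarrow>
     (\<forall>k. \<phi> k \<in> H10 \<Omega> \<and>
       (\<forall>v \<in> H10 \<Omega>.
         (\<integral>x. (A x *v weak_grad \<Omega> (\<phi> k) x) \<bullet> weak_grad \<Omega> v x + c x * \<phi> k x * v x
            \<partial>lebesgue_on \<Omega>)
         = lam k * l2inner (lebesgue_on \<Omega>) (\<phi> k) v)) \<and>
     (\<forall>j k. l2inner (lebesgue_on \<Omega>) (\<phi> j) (\<phi> k) = (if j = k then 1 else 0)) \<and>
     (\<forall>w \<in> L2 (lebesgue_on \<Omega>).
       (\<lambda>N. l2norm (lebesgue_on \<Omega>)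
          (\<lambda>x. w x - (\<Sum>k<N. l2inner (lebesgue_on \<Omega>) w (\<phi> k) * \<phi> k x))) \<longlonglongrightarrow> 0)"

definition HH ::
    "(real^'n) set \<Rightarrow> (nat \<Rightarrow> real) \<Rightarrow> (nat \<Rightarrow> real^'n \<Rightarrow> real) \<Rightarrow> real \<Rightarrow>
     (real^'n \<Rightarrow> real) set" where
  "HH \<Omega> lam \<phi> r = {w \<in> L2 (lebesgue_on \<Omega>). \<exists>a :: nat \<Rightarrow> real.
     (\<lambda>N. l2norm (lebesgue_on \<Omega>) (\<lambda>x. w x - (\<Sum>k<N. a k * \<phi> k x))) \<longlonglongrightarrow> 0 \<and>
     summable (\<lambda>k. lam k powr r * (a k)\<^sup>2)}"


subsection \<open>The truncated cylinder\<close>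

definition cyl :: "(real^'n) set \<Rightarrow> real \<Rightarrow> ((real^'n) \<times> real) set" where
  "cyl \<Omega> Y = \<Omega> \<times> {0<..<Y}"

definition cyl_measure :: "(real^'n) set \<Rightarrow> real \<Rightarrow> real \<Rightarrow> ((real^'n) \<times> real) measure" where
  "cyl_measure \<Omega> s Y =
     density (lebesgue_on (cyl \<Omega> Y)) (\<lambda>p. ennreal (snd p powr (1 - 2 * s)))"

definition HL :: "(real^'n) set \<Rightarrow> real \<Rightarrow> real \<Rightarrow> ((real^'n) \<times> real \<Rightarrow> real) set" where
  "HL \<Omega> s Y = H1_vanishing (cyl_measure \<Omega> s Y) (cyl \<Omega> Y)
     (frontier \<Omega> \<times> {0<..<Y} \<union> \<Omega> \<times> {Y})"

text \<open>The trace on \<open>\<Omega> \<times> {0}\<close> is the continuous extension of pointwise restriction, from functions that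
  are continuous on the closed cylinder. It is unique up to null sets.\<close>

definition has_trace ::
    "(real^'n) set \<Rightarrow> real \<Rightarrow> real \<Rightarrow> ((real^'n) \<times> real \<Rightarrow> real) \<Rightarrow> (real^'n \<Rightarrow> real) \<Rightarrow> bool" where
  "has_trace \<Omega> s Y w u \<longleftrightarrow>
     w \<in> H1 (cyl_measure \<Omega> s Y) (cyl \<Omega> Y) \<and> u \<in> L2 (lebesgue_on \<Omega>) \<and>
     (\<exists>v :: nat \<Rightarrow> (real^'n) \<times> real \<Rightarrow> real.
        (\<forall>j. v j \<in> H1 (cyl_measure \<Omega> s Y) (cyl \<Omega> Y) \<and> continuous_on (closure (cyl \<Omega> Y)) (v j)) \<and>
        (\<lambda>j. h1norm (cyl_measure \<Omega> s Y) (cyl \<Omega> Y) (\<lambda>p. v j p - w p)) \<longlonglongrightarrow> 0 \<and>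
        (\<lambda>j. l2norm (lebesgue_on \<Omega>) (\<lambda>x. v j (x, 0) - u x)) \<longlonglongrightarrow> 0)"

definition tr ::
    "(real^'n) set \<Rightarrow> real \<Rightarrow> real \<Rightarrow> ((real^'n) \<times> real \<Rightarrow> real) \<Rightarrow> real^'n \<Rightarrow> real" where
  "tr \<Omega> s Y w = (SOME u. has_trace \<Omega> s Y w u)"

definition d_const :: "real \<Rightarrow> real" where
  "d_const s = 2 powr (1 - 2 * s) * Gamma (1 - s) / Gamma s"

definition diagA :: "real^'n^'n \<Rightarrow> (real^'n) \<times> real \<Rightarrow> (real^'n) \<times> real" where
  "diagA B \<zeta> = (B *v fst \<zeta>, snd \<zeta>)"

definition aY ::
    "(real^'n) set \<Rightarrow> (real^'n \<Rightarrow> real^'n^'n) \<Rightarrow> (real^'n \<Rightarrow> real) \<Rightarrow> real \<Rightarrow> real \<Rightarrow>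
     ((real^'n) \<times> real \<Rightarrow> real) \<Rightarrow> ((real^'n) \<times> real \<Rightarrow> real) \<Rightarrow> real" where
  "aY \<Omega> A c s Y w \<phi> = 1 / d_const s *
     (\<integral>p. diagA (A (fst p)) (weak_grad (cyl \<Omega> Y) w p) \<bullet> weak_grad (cyl \<Omega> Y) \<phi> p
            + c (fst p) * w p * \<phi> p \<partial>cyl_measure \<Omega> s Y)"

definition energy_norm ::
    "(real^'n) set \<Rightarrow> (real^'n \<Rightarrow> real^'n^'n) \<Rightarrow> (real^'n \<Rightarrow> real) \<Rightarrow> real \<Rightarrow> real \<Rightarrow>
     ((real^'n) \<times> real \<Rightarrow> real) \<Rightarrow> real" where
  "energy_norm \<Omega> A c s Y w = sqrt (aY \<Omega> A c s Y w w)"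

text \<open>\<open>harmonic_ext \<Omega> A c s Y w U\<close> says that \<open>U\<close> is (a representative of) the \<open>\<alpha>\<close>-harmonic extension
  of \<open>w\<close>.\<close>

definition harmonic_ext ::
    "(real^'n) set \<Rightarrow> (real^'n \<Rightarrow> real^'n^'n) \<Rightarrow> (real^'n \<Rightarrow> real) \<Rightarrow> real \<Rightarrow> real \<Rightarrow>
     (real^'n \<Rightarrow> real) \<Rightarrow> ((real^'n) \<times> real \<Rightarrow> real) \<Rightarrow> bool" where
  "harmonic_ext \<Omega> A c s Y w U \<longleftrightarrow>
     U \<in> HL \<Omega> s Y \<and> has_trace \<Omega> s Y U w \<and>
     (\<forall>\<phi> \<in> HL \<Omega> s Y. has_trace \<Omega> s Y \<phi> (\<lambda>x. 0) \<longrightarrow> aY \<Omega> A c s Y U \<phi> = 0)"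


subsection \<open>Discrete spaces\<close>

text \<open>\<open>triangulation\<close> contains conformity: any two cells meet in a common face.\<close>

definition conforming_mesh :: "(real^'n) set \<Rightarrow> (real^'n) set set \<Rightarrow> bool" where
  "conforming_mesh \<Omega> \<T> \<longleftrightarrow>
     triangulation \<T> \<and> (\<forall>T\<in>\<T>. int CARD('n) simplex T) \<and> \<Union>\<T> = closure \<Omega>"

definition S10 :: "(real^'n) set \<Rightarrow> (real^'n) set set \<Rightarrow> (real^'n \<Rightarrow> real) set" where
  "S10 \<Omega> \<T> = {v. continuous_on (closure \<Omega>) v \<and>
     (\<forall>T\<in>\<T>. \<exists>a b. \<forall>x\<in>T. v x = a \<bullet> x + b) \<and> (\<forall>x\<in>frontier \<Omega>. v x = 0)}"

definition geo_interval :: "real \<Rightarrow> real \<Rightarrow> nat \<Rightarrow> nat \<Rightarrow> real set" where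
  "geo_interval Y \<sigma> M m =
     (if m = 1 then {0..Y * \<sigma> ^ (M - 1)} else {Y * \<sigma> ^ (M - m + 1)..Y * \<sigma> ^ (M - m)})"

definition hp_degree :: "real \<Rightarrow> nat \<Rightarrow> nat" where
  "hp_degree slope m = max 1 (nat \<lceil>slope * real m\<rceil>)"

definition Sr :: "real \<Rightarrow> real \<Rightarrow> nat \<Rightarrow> real \<Rightarrow> (real \<Rightarrow> real) set" where
  "Sr Y \<sigma> M slope = {z. continuous_on {0..Y} z \<and>
     (\<forall>m\<in>{1..M}. \<exists>p. degree p \<le> hp_degree slope m \<and> (\<forall>y\<in>geo_interval Y \<sigma> M m. z y = poly p y)) \<and>
     z Y = 0}"

definition tensor_space ::
    "('a \<Rightarrow> real) set \<Rightarrow> ('b \<Rightarrow> real) set \<Rightarrow> ('a \<times> 'b \<Rightarrow> real) set" where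
  "tensor_space X Z = {w. \<exists>(m::nat) v z. (\<forall>i<m. v i \<in> X \<and> z i \<in> Z) \<and>
     w = (\<lambda>p. \<Sum>i<m. v i (fst p) * z i (snd p))}"

definition VV ::
    "(real^'n) set \<Rightarrow> real \<Rightarrow> (real^'n) set set \<Rightarrow> real \<Rightarrow> nat \<Rightarrow> real \<Rightarrow>
     ((real^'n) \<times> real \<Rightarrow> real) set" where
  "VV \<Omega> Y \<T> \<sigma> M slope = tensor_space (S10 \<Omega> \<T>) (Sr Y \<sigma> M slope)"

text \<open>\<open>galerkin_proj \<Omega> A c s Y \<V> w G\<close> says that \<open>G\<close> is the Galerkin projection of \<open>w\<close> onto \<open>\<V>\<close>.\<close>

definition galerkin_proj ::
    "(real^'n) set \<Rightarrow> (real^'n \<Rightarrow> real^'n^'n) \<Rightarrow> (real^'n \<Rightarrow> real) \<Rightarrow> real \<Rightarrow> real \<Rightarrow>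
     ((real^'n) \<times> real \<Rightarrow> real) set \<Rightarrow> ((real^'n) \<times> real \<Rightarrow> real) \<Rightarrow> ((real^'n) \<times> real \<Rightarrow> real) \<Rightarrow>
     bool" where
  "galerkin_proj \<Omega> A c s Y \<V> w G \<longleftrightarrow>
     G \<in> \<V> \<and> (\<forall>W\<in>\<V>. aY \<Omega> A c s Y G W = aY \<Omega> A c s Y w W)"


subsection \<open>The trapezoidal scheme\<close>

definition continuous_L2 :: "(real^'n) set \<Rightarrow> real \<Rightarrow> (real \<Rightarrow> real^'n \<Rightarrow> real) \<Rightarrow> bool" where
  "continuous_L2 \<Omega> T f \<longleftrightarrow>
     (\<forall>t\<in>{0..T}. f t \<in> L2 (lebesgue_on \<Omega>) \<and>
       ((\<lambda>\<tau>. l2norm (lebesgue_on \<Omega>) (\<lambda>x. f \<tau> x - f t x)) \<longlongrightarrow> 0) (at t within {0..T}))"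

text \<open>Difference quotient, midpoint value \<open>w\<close> at \<open>k + 1/2\<close>, and weighted average of a sequence of
  functions. The first and the last one are meant for \<open>k \<ge> 1\<close>.\<close>

definition dquot :: "real \<Rightarrow> (nat \<Rightarrow> 'a \<Rightarrow> real) \<Rightarrow> nat \<Rightarrow> 'a \<Rightarrow> real" where
  "dquot dt w k = (\<lambda>x. (w k x - w (k - 1) x) / dt)"

definition mid :: "(nat \<Rightarrow> 'a \<Rightarrow> real) \<Rightarrow> nat \<Rightarrow> 'a \<Rightarrow> real" where
  "mid w k = (\<lambda>x. (w (k + 1) x + w k x) / 2)"

definition cavg :: "(nat \<Rightarrow> 'a \<Rightarrow> real) \<Rightarrow> nat \<Rightarrow> 'a \<Rightarrow> real" where
  "cavg w k = (\<lambda>x. (w (k + 1) x + 2 * w k x + w (k - 1) x) / 4)"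

text \<open>Here \<open>dt\<close> is the time step, \<open>F k\<close> is the value of the source at the \<open>k\<close>-th time point,
  and \<open>w\<close> is the initial acceleration. All duality pairings in the scheme have square integrable
  arguments, so they are \<open>L\<^sup>2\<close> inner products.\<close>

definition trapezoidal_solution ::
    "(real^'n) set \<Rightarrow> (real^'n \<Rightarrow> real^'n^'n) \<Rightarrow> (real^'n \<Rightarrow> real) \<Rightarrow> real \<Rightarrow> real \<Rightarrow>
     ((real^'n) \<times> real \<Rightarrow> real) set \<Rightarrow> nat \<Rightarrow> real \<Rightarrow> (nat \<Rightarrow> real^'n \<Rightarrow> real) \<Rightarrow>
     (real^'n \<Rightarrow> real) \<Rightarrow> (real^'n \<Rightarrow> real) \<Rightarrow> (real^'n \<Rightarrow> real) \<Rightarrow>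
     (nat \<Rightarrow> (real^'n) \<times> real \<Rightarrow> real) \<Rightarrow> bool" where
  "trapezoidal_solution \<Omega> A c s Y \<V> K dt F g h w V \<longleftrightarrow>
     (\<exists>Ug Uh Uw.
        harmonic_ext \<Omega> A c s Y g Ug \<and> harmonic_ext \<Omega> A c s Y h Uh \<and> harmonic_ext \<Omega> A c s Y w Uw \<and>
        (\<forall>\<phi> \<in> HL \<Omega> s Y.
           l2inner (lebesgue_on \<Omega>) w (tr \<Omega> s Y \<phi>)
           = - aY \<Omega> A c s Y Ug \<phi> + l2inner (lebesgue_on \<Omega>) (F 0) (tr \<Omega> s Y \<phi>)) \<and>
        galerkin_proj \<Omega> A c s Y \<V> Ug (V 0) \<and>
        galerkin_proj \<Omega> A c s Y \<V> (\<lambda>p. Ug p + dt * Uh p + 1 / 2 * dt\<^sup>2 * Uw p) (V 1)) \<and>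
     (\<forall>k\<in>{1..K - 1}. V (k + 1) \<in> \<V> \<and>
        (\<forall>W\<in>\<V>.
           1 / dt\<^sup>2 * l2inner (lebesgue_on \<Omega>)
              (tr \<Omega> s Y (\<lambda>p. V (k + 1) p - 2 * V k p + V (k - 1) p)) (tr \<Omega> s Y W)
           + aY \<Omega> A c s Y (cavg V k) W
           = l2inner (lebesgue_on \<Omega>) (cavg F k) (tr \<Omega> s Y W)))"

end

theory Submission
  imports Defs
begin

text \<open>
  Let \<open>E\<^sub>k\<^sup>2 = \<parallel>tr \<dd>V\<^sub>k\<parallel>\<^sup>2 + \<parallel>V\<^bsub>k-1/2\<^esub>\<parallel>\<^sup>2\<close>. Testing the scheme with \<open>V\<^bsub>k+1\<^esub> - V\<^bsub>k-1\<^esub>\<close> gives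
  \<open>E\<^bsub>k+1\<^esub>\<^sup>2 - E\<^sub>k\<^sup>2 \<le> \<Delta>t \<parallel>\<cc>f\<^sub>k\<parallel> (E\<^bsub>k+1\<^esub> + E\<^sub>k)\<close>, hence \<open>E\<^bsub>k+1\<^esub> \<le> E\<^sub>k + \<Delta>t \<parallel>\<cc>f\<^sub>k\<parallel>\<close>, and \<open>C = 2\<close> suffices.
  This needs that \<open>a\<^sub>Y\<close> is bilinear and that traces add up. Both follow from uniqueness: weak gradients
  are unique almost everywhere by the fundamental lemma of the calculus of variations, and traces are
  unique because their pairing with a test function extends continuously to \<open>H\<^sup>1(y\<^sup>\<alpha>)\<close>. Discrete functions
  are Lipschitz and differentiable almost everywhere, so they have bounded weak gradients.
\<close>

subsection \<open>Test functions\<close>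

text \<open>\<open>weak_grad\<close> and \<open>tr\<close> are values of Hilbert choice. Linearity,
  and even the vanishing of the gradient of the zero function, therefore hold only almost everywhere
  and only once uniqueness is known; most of the work goes into these null sets. The second obstacle
  is the weight: y^\<alpha> degenerates or blows up at y = 0, exactly where the trace is taken, so a
  weighted norm does not directly bound an unweighted integral near the base. Cauchy-Schwarz with
  the reciprocal weight does. All computations with \<open>aY\<close> are confined to
  \<open>regular_fun\<close>, the functions that are continuous up to the boundary and have a
  bounded weak gradient. For them the integrand of \<open>aY\<close> is essentially bounded, the
  weighted measure is finite, and the trace is restriction to y = 0. The constant 2 comes from a + b
  \<le> 2 sqrt (a^2 + b^2) for nonnegative a and b: the sum of norms in the claim is compared with
  the root of the energy, because only squares telescope.\<close>

definition pos_sq :: "real \<Rightarrow> real" where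
  "pos_sq t = (max 0 t)\<^sup>2"

lemma pos_sq_nonneg [simp]: "0 \<le> pos_sq t"
  by (simp add: pos_sq_def)

lemma pos_sq_eq_0 [simp]: "t \<le> 0 \<Longrightarrow> pos_sq t = 0"
  by (simp add: pos_sq_def)

lemma pos_sq_pos: "0 < t \<Longrightarrow> 0 < pos_sq t"
  by (simp add: pos_sq_def)

text \<open>\<open>test_function\<close> asks for a continuous gradient only, so squaring the
  positive part already gives the regularity of a bump. At 0 the difference quotient is bounded by
  the modulus of the increment.\<close>

lemma has_real_derivative_pos_sq: "(pos_sq has_real_derivative 2 * max 0 t) (at t)"
proof (cases t "0::real" rule: linorder_cases)
  case less
  have "((\<lambda>_. 0) has_real_derivative 2 * max 0 t) (at t)"
    using less by simp
  then show ?thesis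
    by (rule has_field_derivative_transform_within_open[where S="{..<0}"])
       (use less in auto)
next
  case greater
  have "((\<lambda>t. t\<^sup>2) has_real_derivative 2 * max 0 t) (at t)"
    using greater by (auto intro!: derivative_eq_intros)
  then show ?thesis
    by (rule has_field_derivative_transform_within_open[where S="{0<..}"])
       (use greater in \<open>auto simp: pos_sq_def\<close>)
next
  case equal
  have "(\<lambda>h. pos_sq h / h) \<midarrow>0\<rightarrow> 0"
  proof (rule Lim_null_comparison[where g="\<lambda>h. \<bar>h\<bar>"])
    show "\<forall>\<^sub>F h in at 0. norm (pos_sq h / h) \<le> \<bar>h\<bar>"
      by (intro always_eventually) (auto simp: pos_sq_def max_def power2_eq_square)
    show "(\<lambda>h::real. \<bar>h\<bar>) \<midarrow>0\<rightarrow> 0"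
      by (intro tendsto_eq_intros) auto
  qed
  then show ?thesis
    using equal by (simp add: DERIV_def)
qed

text \<open>The usual transition function from 0 to 1 on the unit interval, with
  \<open>pos_sq\<close> in place of exp(-1/t). The denominator is positive because t and 1 - t are
  never both nonpositive.\<close>

definition smooth_step :: "real \<Rightarrow> real" where
  "smooth_step t = pos_sq t / (pos_sq t + pos_sq (1 - t))"

definition smooth_step_deriv :: "real \<Rightarrow> real" where
  "smooth_step_deriv t =
     (2 * max 0 t * pos_sq (1 - t) + pos_sq t * (2 * max 0 (1 - t))) / (pos_sq t + pos_sq (1 - t))\<^sup>2"

lemma smooth_step_denominator_pos: "0 < pos_sq t + pos_sq (1 - t)"
  using pos_sq_pos[of t] pos_sq_pos[of "1 - t"] pos_sq_nonneg[of t] pos_sq_nonneg[of "1 - t"]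
  by (cases "0 < t") (auto intro: add_pos_nonneg add_nonneg_pos)

lemma has_real_derivative_smooth_step:
  "(smooth_step has_real_derivative smooth_step_deriv t) (at t)"
proof -
  have 1: "((\<lambda>t. pos_sq (1 - t)) has_real_derivative (2 * max 0 (1 - t)) * (- 1)) (at t)"
    by (rule DERIV_chain2[OF has_real_derivative_pos_sq]) (auto intro!: derivative_eq_intros)
  show ?thesis
    unfolding smooth_step_def
    by (rule derivative_eq_intros has_real_derivative_pos_sq 1 refl)+
       (use smooth_step_denominator_pos[of t] in
         \<open>auto simp: smooth_step_deriv_def power2_eq_square algebra_simps\<close>)
qed

lemma continuous_smooth_step_deriv: "continuous_on UNIV smooth_step_deriv"
  unfolding smooth_step_deriv_def pos_sq_def
  by (intro continuous_intros)
     (metis less_irrefl pos_sq_def smooth_step_denominator_pos power_eq_0_iff)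

lemma smooth_step_bounds: "0 \<le> smooth_step t" "smooth_step t \<le> 1"
  using smooth_step_denominator_pos[of t] by (auto simp: smooth_step_def)

lemma smooth_step_eq_0: "t \<le> 0 \<Longrightarrow> smooth_step t = 0"
  by (simp add: smooth_step_def)

lemma smooth_step_eq_1: "1 \<le> t \<Longrightarrow> smooth_step t = 1"
  using smooth_step_denominator_pos[of t] by (simp add: smooth_step_def)

lemma smooth_step_deriv_nonneg: "0 \<le> smooth_step_deriv t"
  unfolding smooth_step_deriv_def by (intro divide_nonneg_nonneg add_nonneg_nonneg mult_nonneg_nonneg) auto

lemma smooth_step_deriv_eq_0: "t \<le> 0 \<or> 1 \<le> t \<Longrightarrow> smooth_step_deriv t = 0"
  by (auto simp: smooth_step_deriv_def)

text \<open>A bump that is positive exactly on the open ball. The factor -4 is the 2 from the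
  derivative of \<open>pos_sq\<close> times the -2 from the derivative of the squared
  distance.\<close>

lemma test_function_ball:
  assumes "cball c r \<subseteq> S" "0 \<le> r"
  shows "test_function S (\<lambda>x. pos_sq (r\<^sup>2 - (norm (x - c))\<^sup>2))
           (\<lambda>x. (- 4 * max 0 (r\<^sup>2 - (norm (x - c))\<^sup>2)) *\<^sub>R (x - c))"
  unfolding test_function_def
proof (intro conjI allI exI[of _ "cball c r"] impI)
  fix x
  have 1: "((\<lambda>x. r\<^sup>2 - (norm (x - c))\<^sup>2) has_derivative (\<lambda>h. - 2 * ((x - c) \<bullet> h))) (at x)"
    unfolding power2_norm_eq_inner
    by (auto intro!: derivative_eq_intros simp: inner_commute)
  show "((\<lambda>x. pos_sq (r\<^sup>2 - (norm (x - c))\<^sup>2)) has_derivative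
     (\<lambda>h. (- 4 * max 0 (r\<^sup>2 - (norm (x - c))\<^sup>2)) *\<^sub>R (x - c) \<bullet> h)) (at x)"
    using has_derivative_compose[OF 1 has_real_derivative_pos_sq[unfolded has_field_derivative_def]]
    by (simp add: mult.assoc)
  show "pos_sq (r\<^sup>2 - (norm (x - c))\<^sup>2) = 0" if "x \<notin> cball c r"
    using that \<open>0 \<le> r\<close> by (intro pos_sq_eq_0) (auto simp: dist_norm norm_minus_commute intro!: power_mono)
  show "continuous_on UNIV (\<lambda>x. (- 4 * max 0 (r\<^sup>2 - (norm (x - c))\<^sup>2)) *\<^sub>R (x - c))"
    by (intro continuous_intros)
qed (use assms in auto)

lemma test_function_continuous:
  assumes "test_function S \<phi> D"
  shows "continuous_on A \<phi>"
  using assms has_derivative_continuous unfolding test_function_def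
  by (meson continuous_at_imp_continuous_on)

lemma test_function_subset: "test_function S \<phi> D \<Longrightarrow> S \<subseteq> T \<Longrightarrow> test_function T \<phi> D"
  unfolding test_function_def by blast

lemma test_function_sum:
  fixes \<phi> :: "'i \<Rightarrow> 'a::euclidean_space \<Rightarrow> real"
  assumes "finite I" "\<And>i. i \<in> I \<Longrightarrow> test_function S (\<phi> i) (D i)"
  shows "test_function S (\<lambda>x. \<Sum>i\<in>I. \<phi> i x) (\<lambda>x. \<Sum>i\<in>I. D i x)"
proof -
  obtain K where K: "\<And>i. i \<in> I \<Longrightarrow> compact (K i) \<and> K i \<subseteq> S \<and> (\<forall>x. x \<notin> K i \<longrightarrow> \<phi> i x = 0)"
    using assms(2) unfolding test_function_def by metis
  show ?thesis
    unfolding test_function_def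
  proof (intro conjI allI exI[of _ "\<Union>i\<in>I. K i"] impI)
    show "((\<lambda>x. \<Sum>i\<in>I. \<phi> i x) has_derivative (\<lambda>h. (\<Sum>i\<in>I. D i x) \<bullet> h)) (at x)" for x
      using assms(2) unfolding test_function_def inner_sum_left by (intro has_derivative_sum) auto
    show "continuous_on UNIV (\<lambda>x. \<Sum>i\<in>I. D i x)"
      using assms(2) unfolding test_function_def by (intro continuous_on_sum) auto
    show "compact (\<Union>i\<in>I. K i)"
      using assms(1) K by (intro compact_UN) auto
    show "(\<Sum>i\<in>I. \<phi> i x) = 0" if "x \<notin> (\<Union>i\<in>I. K i)" for x
      using that K by (intro sum.neutral) auto
  qed (use K in auto)
qed

text \<open>Since \<open>smooth_step\<close> vanishes at 0, composition keeps the compact support.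
  It caps a large multiple of a test function at 1.\<close>

lemma test_function_smooth_step:
  assumes "test_function S \<phi> D"
  shows "test_function S (\<lambda>x. smooth_step (a * \<phi> x))
           (\<lambda>x. (smooth_step_deriv (a * \<phi> x) * a) *\<^sub>R D x)"
proof -
  obtain K where K: "compact K" "K \<subseteq> S" "\<And>x. x \<notin> K \<Longrightarrow> \<phi> x = 0"
    using assms unfolding test_function_def by metis
  have d: "(\<phi> has_derivative (\<lambda>h. D x \<bullet> h)) (at x)" for x
    using assms unfolding test_function_def by blast
  have c: "continuous_on UNIV \<phi>" "continuous_on UNIV D"
    using test_function_continuous[OF assms] assms by (auto simp: test_function_def)
  show ?thesis
    unfolding test_function_def
  proof (intro conjI allI exI[of _ K] impI)
    fix x
    have "((\<lambda>x. a * \<phi> x) has_derivative (\<lambda>h. a * (D x \<bullet> h))) (at x)"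
      by (intro has_derivative_mult_right d)
    from has_derivative_compose[OF this has_real_derivative_smooth_step[unfolded has_field_derivative_def]]
    show "((\<lambda>x. smooth_step (a * \<phi> x)) has_derivative
       (\<lambda>h. (smooth_step_deriv (a * \<phi> x) * a) *\<^sub>R D x \<bullet> h)) (at x)"
      by (simp add: mult.assoc)
    show "smooth_step (a * \<phi> x) = 0" if "x \<notin> K"
      using K that by (simp add: smooth_step_eq_0)
    show "continuous_on UNIV (\<lambda>x. (smooth_step_deriv (a * \<phi> x) * a) *\<^sub>R D x)"
      by (intro continuous_intros c continuous_on_compose2[OF continuous_smooth_step_deriv]) auto
  qed (use K in auto)
qed

text \<open>Countably many bumps cover U by Lindelof. The step function is applied to n times the
  sum of the first n bumps: at a point of U one bump is positive, so the argument eventually exceeds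
  1; outside U all bumps vanish.\<close>

lemma test_functions_tendsto_indicator:
  fixes U :: "'a::euclidean_space set"
  assumes "open U"
  obtains \<phi> D where "\<And>n::nat. test_function U (\<phi> n) (D n)"
    "\<And>n x. 0 \<le> \<phi> n x" "\<And>n x. \<phi> n x \<le> 1" "\<And>x. (\<lambda>n. \<phi> n x) \<longlonglongrightarrow> indicator U x"
proof -
  have "\<exists>r. \<forall>x\<in>U. 0 < r x \<and> cball x (r x) \<subseteq> U"
    using assms open_contains_cball by (intro bchoice) blast
  then obtain r where r: "\<And>x. x \<in> U \<Longrightarrow> 0 < r x \<and> cball x (r x) \<subseteq> U"
    by blast
  obtain \<F> where F: "\<F> \<subseteq> (\<lambda>x. ball x (r x)) ` U" "countable \<F>" "\<Union>\<F> = \<Union>((\<lambda>x. ball x (r x)) ` U)"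
    using Lindelof[of "(\<lambda>x. ball x (r x)) ` U"] by auto
  have U: "\<Union>((\<lambda>x. ball x (r x)) ` U) = U"
    using r by (force simp: subset_eq)
  obtain C where C: "countable C" "C \<subseteq> U" "\<F> = (\<lambda>x. ball x (r x)) ` C"
    using countable_subset_image[of \<F> "\<lambda>x. ball x (r x)" U] F(1,2) by metis
  define b where "b c x = pos_sq ((r c)\<^sup>2 - (norm (x - c))\<^sup>2)" for c x :: 'a
  define b' where "b' c x = (- 4 * max 0 ((r c)\<^sup>2 - (norm (x - c))\<^sup>2)) *\<^sub>R (x - c)" for c x :: 'a
  \<comment> \<open>The case distinction covers empty U, where \<open>from_nat_into C\<close> has no
    meaningful value.\<close>
  define I where "I n = (if C = {} then {} else from_nat_into C ` {..<n})" for n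
  have I: "finite (I n)" "I n \<subseteq> C" for n
    using from_nat_into[of C] by (auto simp: I_def)
  have tf: "test_function U (\<lambda>x. \<Sum>c\<in>I n. b c x) (\<lambda>x. \<Sum>c\<in>I n. b' c x)" for n
    unfolding b_def b'_def
    by (intro test_function_sum test_function_ball I) (use I C r in \<open>force+\<close>)
  define \<phi> where "\<phi> n x = smooth_step (real n * (\<Sum>c\<in>I n. b c x))" for n x
  have "\<exists>D. test_function U (\<phi> n) D" for n
    unfolding \<phi>_def using test_function_smooth_step[OF tf] by blast
  then obtain D where D: "\<And>n. test_function U (\<phi> n) (D n)"
    by metis
  have "(\<lambda>n. \<phi> n x) \<longlonglongrightarrow> indicator U x" for x
  proof (cases "x \<in> U")
    case False
    have "\<phi> n x = 0" for n
      using D[of n] False unfolding test_function_def by blast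
    then show ?thesis
      using False by simp
  next
    case True
    then obtain c where c: "c \<in> C" "x \<in> ball c (r c)"
      using F(3) C(3) U by auto
    then obtain i where i: "c = from_nat_into C i"
      using C(1) by (metis from_nat_into_surj)
    have pos: "0 < b c x"
      unfolding b_def using c by (intro pos_sq_pos) (auto simp: dist_norm norm_minus_commute intro!: power_strict_mono)
    obtain N :: nat where N: "1 / b c x < real N"
      using reals_Archimedean2 by blast
    \<comment> \<open>\<open>Suc i\<close> ensures that the bump centred at c has entered the sum,
      and N makes n times that bump at least 1.\<close>
    have "\<phi> n x = 1" if "n \<ge> max N (Suc i)" for n
    proof -
      have "c \<in> I n"
        using c i that by (auto simp: I_def)
      then have "b c x \<le> (\<Sum>c\<in>I n. b c x)"
        using I by (intro member_le_sum) (auto simp: b_def)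
      moreover have "1 \<le> real n * b c x"
      proof -
        have "1 / b c x \<le> real n" using N that by simp
        then show ?thesis using pos by (simp add: field_simps)
      qed
      ultimately have "1 \<le> real n * (\<Sum>c\<in>I n. b c x)"
        by (meson mult_left_mono of_nat_0_le_iff order_trans)
      then show ?thesis
        by (simp add: \<phi>_def smooth_step_eq_1)
    qed
    then have "\<forall>\<^sub>F n in sequentially. \<phi> n x = 1"
      unfolding eventually_sequentially by blast
    then show ?thesis
      using True by (simp add: tendsto_eventually)
  qed
  then show thesis
    using D that[of \<phi> D] smooth_step_bounds by (auto simp: \<phi>_def)
qed

subsection \<open>The fundamental lemma of the calculus of variations\<close>

definition locally_integrable_on :: "'a::euclidean_space set \<Rightarrow> ('a \<Rightarrow> 'b::euclidean_space) \<Rightarrow> bool" where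
  "locally_integrable_on S u \<longleftrightarrow> (\<forall>K. compact K \<and> K \<subseteq> S \<longrightarrow> integrable (lebesgue_on K) u)"

lemma integrable_lebesgue_on_iff:
  fixes f :: "'a::euclidean_space \<Rightarrow> 'b::euclidean_space"
  assumes "S \<in> sets lebesgue"
  shows "integrable (lebesgue_on S) f \<longleftrightarrow> integrable lebesgue (\<lambda>x. indicator S x *\<^sub>R f x)"
  using assms by (intro integrable_restrict_space) simp

lemma integral_lebesgue_on_eq:
  fixes f :: "'a::euclidean_space \<Rightarrow> 'b::euclidean_space"
  assumes "S \<in> sets lebesgue"
  shows "(\<integral>x. f x \<partial>lebesgue_on S) = (\<integral>x. indicator S x *\<^sub>R f x \<partial>lebesgue)"
  using assms by (intro integral_restrict_space) simp

text \<open>The complement of K is open and the function is constant there, so uniqueness of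
  derivatives makes the gradient vanish as well.\<close>

lemma test_function_grad_support:
  assumes "test_function S \<phi> D"
  obtains K where "compact K" "K \<subseteq> S" "\<And>x. x \<notin> K \<Longrightarrow> \<phi> x = 0" "\<And>x. x \<notin> K \<Longrightarrow> D x = 0"
proof -
  obtain K where K: "compact K" "K \<subseteq> S" "\<And>x. x \<notin> K \<Longrightarrow> \<phi> x = 0"
    using assms unfolding test_function_def by metis
  have "D x = 0" if "x \<notin> K" for x
  proof -
    have "((\<lambda>_. 0) has_derivative (\<lambda>h. D x \<bullet> h)) (at x)"
      by (rule has_derivative_transform_within_open[where f=\<phi> and s="- K"])
         (use assms K that compact_imp_closed in \<open>auto simp: test_function_def\<close>)
    from has_derivative_unique[OF this has_derivative_const] have "D x \<bullet> D x = 0"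
      by metis
    then show ?thesis by simp
  qed
  then show thesis
    using K that by blast
qed

lemma test_function_bounded:
  assumes "test_function S \<phi> D"
  obtains B where "\<And>x. \<bar>\<phi> x\<bar> \<le> B" "\<And>x. norm (D x) \<le> B" "0 \<le> B"
proof -
  obtain K where K: "compact K" "K \<subseteq> S" "\<And>x. x \<notin> K \<Longrightarrow> \<phi> x = 0"
    and D0: "\<And>x. x \<notin> K \<Longrightarrow> D x = 0"
    using test_function_grad_support[OF assms] by blast
  have "continuous_on K \<phi>" "continuous_on K D"
    using test_function_continuous[OF assms] assms
    by (auto simp: test_function_def intro: continuous_on_subset)
  then have "bounded (\<phi> ` K)" "bounded (D ` K)"
    using K(1) by (auto intro: compact_imp_bounded compact_continuous_image)
  then obtain B1 B2 where B: "\<And>x. x \<in> K \<Longrightarrow> \<bar>\<phi> x\<bar> \<le> B1" "\<And>x. x \<in> K \<Longrightarrow> norm (D x) \<le> B2"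
    unfolding bounded_iff by (metis imageI real_norm_def)
  show thesis
  proof (rule that[of "max 0 (max B1 B2)"])
    show "\<bar>\<phi> x\<bar> \<le> max 0 (max B1 B2)" for x
      using B(1)[of x] K(3)[of x] by (cases "x \<in> K") auto
    show "norm (D x) \<le> max 0 (max B1 B2)" for x
      using B(2)[of x] D0[of x] by (cases "x \<in> K") auto
  qed auto
qed

text \<open>Required by \<open>density_zero\<close>, which is applied to the completed
  measure.\<close>

lemma sigma_finite_lebesgue: "sigma_finite_measure (lebesgue :: 'a::euclidean_space measure)"
proof
  show "\<exists>A. countable A \<and> A \<subseteq> sets (lebesgue :: 'a measure) \<and> \<Union>A = space lebesgue \<and>
          (\<forall>a\<in>A. emeasure lebesgue a \<noteq> \<infinity>)"
  proof (intro exI[of _ "range (\<lambda>n::nat. cball 0 (real n))"] conjI ballI)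
    show "\<Union>(range (\<lambda>n. cball 0 (real n))) = space (lebesgue :: 'a measure)"
      by (auto simp: real_arch_simple)
    fix a :: "'a set" assume "a \<in> range (\<lambda>n. cball 0 (real n))"
    then show "emeasure lebesgue a \<noteq> \<infinity>"
      by (auto simp: less_top[symmetric] emeasure_lborel_cball_finite[unfolded infinity_ennreal_def, THEN less_imp_neq])
  qed auto
qed

lemma integrable_bounded_mult:
  fixes g :: "'a \<Rightarrow> real" and f :: "'a \<Rightarrow> 'b::euclidean_space"
  assumes "integrable M f" "g \<in> borel_measurable M" "AE x in M. \<bar>g x\<bar> \<le> B"
  shows "integrable M (\<lambda>x. g x *\<^sub>R f x)"
proof (rule Bochner_Integration.integrable_bound[where f="\<lambda>x. B *\<^sub>R f x"])
  show "integrable M (\<lambda>x. B *\<^sub>R f x)"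
    using assms(1) by simp
  show "(\<lambda>x. g x *\<^sub>R f x) \<in> borel_measurable M"
    using assms(1,2) by (intro borel_measurable_scaleR) auto
  show "AE x in M. norm (g x *\<^sub>R f x) \<le> norm (B *\<^sub>R f x)"
    using assms(3) by eventually_elim (auto intro!: mult_right_mono)
qed

lemma continuous_imp_lebesgue_on_measurable:
  fixes f :: "'a::euclidean_space \<Rightarrow> 'b::euclidean_space"
  assumes "continuous_on UNIV f"
  shows "f \<in> borel_measurable (lebesgue_on S)"
  using assms by (intro measurable_restrict_space1 measurable_completion) (simp add: borel_measurable_continuous_onI)

text \<open>As g vanishes off K, the product has the same zero extension from K as from S, and on K
  a bounded factor preserves integrability.\<close>

lemma locally_integrable_on_mult_support:
  fixes g :: "'a::euclidean_space \<Rightarrow> real" and u :: "'a \<Rightarrow> 'b::euclidean_space"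
  assumes "open S" "locally_integrable_on S u" "compact K" "K \<subseteq> S" 
    and g: "continuous_on UNIV g" "\<And>x. x \<notin> K \<Longrightarrow> g x = 0" "\<And>x. \<bar>g x\<bar> \<le> B"
  shows "integrable (lebesgue_on S) (\<lambda>x. g x *\<^sub>R u x)"
proof -
  have "integrable (lebesgue_on K) (\<lambda>x. g x *\<^sub>R u x)"
    using assms by (intro integrable_bounded_mult[where B=B] continuous_imp_lebesgue_on_measurable g)
                   (auto simp: locally_integrable_on_def)
  then have "integrable lebesgue (\<lambda>x. indicator K x *\<^sub>R g x *\<^sub>R u x)"
    using assms(3) by (subst (asm) integrable_lebesgue_on_iff) (auto simp: lmeasurable_compact fmeasurableD)
  moreover have "(\<lambda>x. indicator K x *\<^sub>R g x *\<^sub>R u x) = (\<lambda>x. indicator S x *\<^sub>R g x *\<^sub>R u x)"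
    using g(2) assms(4) by (auto simp: indicator_def fun_eq_iff)
  ultimately show ?thesis
    using assms(1) by (subst integrable_lebesgue_on_iff) auto
qed

text \<open>Test functions of U are test functions of S and converge to the indicator of U. The
  compact K supplies the integrable majorant for dominated convergence, as u may fail to be
  integrable on all of S.\<close>

lemma integral_open_zero_if_test_integrals_zero:
  fixes u :: "'a::euclidean_space \<Rightarrow> real"
  assumes "open S" "open U" "compact K" "U \<subseteq> K" "K \<subseteq> S"
    and u: "integrable (lebesgue_on K) u"
    and z: "\<And>\<phi> D. test_function S \<phi> D \<Longrightarrow> (\<integral>x. \<phi> x * u x \<partial>lebesgue_on S) = 0"
  shows "(\<integral>x. indicator U x * u x \<partial>lebesgue) = 0"
proof -
  obtain \<phi> D where \<phi>: "\<And>n::nat. test_function U (\<phi> n) (D n)"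
    "\<And>n x. 0 \<le> \<phi> n x" "\<And>n x. \<phi> n x \<le> 1" "\<And>x. (\<lambda>n. \<phi> n x) \<longlonglongrightarrow> indicator U x"
    by (rule test_functions_tendsto_indicator[OF \<open>open U\<close>]) (rule that)
  have 0: "\<phi> n x = 0" if "x \<notin> U" for n x
    using \<phi>(1)[of n] that unfolding test_function_def by blast
  have K: "K \<in> sets lebesgue"
    using assms(3) by (simp add: lmeasurable_compact fmeasurableD)
  define u0 where "u0 x = indicator K x * u x" for x
  have u0: "integrable lebesgue u0"
    using u K unfolding u0_def by (subst (asm) integrable_lebesgue_on_iff) auto
  have "(\<lambda>n. \<integral>x. \<phi> n x * u0 x \<partial>lebesgue) \<longlonglongrightarrow> (\<integral>x. indicator U x * u0 x \<partial>lebesgue)"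
  proof (rule integral_dominated_convergence[where w="\<lambda>x. norm (u0 x)"])
    show "integrable lebesgue (\<lambda>x. norm (u0 x))"
      using u0 by simp
    show "AE x in lebesgue. (\<lambda>n. \<phi> n x * u0 x) \<longlonglongrightarrow> indicator U x * u0 x"
      using \<phi>(4) by (intro AE_I2 tendsto_mult) auto
    show "AE x in lebesgue. norm (\<phi> n x * u0 x) \<le> norm (u0 x)" for n
      using \<phi>(2,3)[of n] by (auto simp: abs_mult intro!: AE_I2 mult_left_le_one_le)
    show "(\<lambda>x. indicator U x * u0 x) \<in> borel_measurable lebesgue"
      using u0 \<open>open U\<close> by (intro borel_measurable_times borel_measurable_indicator) auto
    show "(\<lambda>x. \<phi> n x * u0 x) \<in> borel_measurable lebesgue" for n
      using u0 continuous_imp_lebesgue_on_measurable[OF test_function_continuous[OF \<phi>(1)[of n]], of UNIV]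
      by (intro borel_measurable_times) (auto simp: lebesgue_on_UNIV_eq)
  qed
  moreover have "(\<integral>x. \<phi> n x * u0 x \<partial>lebesgue) = 0" for n
  proof -
    have "test_function S (\<phi> n) (D n)"
      using \<phi>(1) assms(4,5) by (blast intro: test_function_subset)
    from z[OF this] have "(\<integral>x. indicator S x * (\<phi> n x * u x) \<partial>lebesgue) = 0"
      using assms(1) by (subst (asm) integral_lebesgue_on_eq) auto
    moreover have "indicator S x * (\<phi> n x * u x) = \<phi> n x * u0 x" for x
      using 0[of x n] assms(4,5) by (auto simp: indicator_def u0_def)
    ultimately show ?thesis by simp
  qed
  ultimately have "(\<integral>x. indicator U x * u0 x \<partial>lebesgue) = 0"
    by (auto simp: LIMSEQ_const_iff)
  moreover have "indicator U x * u0 x = indicator U x * u x" for x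
    using assms(4) by (auto simp: indicator_def u0_def)
  ultimately show ?thesis by simp
qed

text \<open>A function whose integral over every measurable set is zero vanishes almost everywhere.
  Open sets are settled by the previous lemma; a Lebesgue set is a G-delta set up to a null set, and
  dominated convergence passes from open sets to G-delta sets.\<close>

lemma AE_zero_on_ball_if_test_integrals_zero:
  fixes u :: "'a::euclidean_space \<Rightarrow> real"
  assumes "open S" "cball a r \<subseteq> S"
    and u: "integrable (lebesgue_on (cball a r)) u"
    and z: "\<And>\<phi> D. test_function S \<phi> D \<Longrightarrow> (\<integral>x. \<phi> x * u x \<partial>lebesgue_on S) = 0"
  shows "AE x in lebesgue. x \<in> ball a r \<longrightarrow> u x = 0"
proof -
  define B where "B = ball a r"
  define v where "v x = indicator B x * u x" for x
  have U0: "(\<integral>x. indicator U x * v x \<partial>lebesgue) = 0" if "open U" for U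
  proof -
    have "(\<integral>x. indicator (U \<inter> B) x * u x \<partial>lebesgue) = 0"
      by (rule integral_open_zero_if_test_integrals_zero[OF \<open>open S\<close> _ _ _ assms(2) u z])
         (use that in \<open>auto simp: B_def\<close>)
    then show ?thesis
      by (simp add: v_def indicator_inter_arith mult.assoc)
  qed
  have v: "integrable lebesgue v"
  proof -
    have "integrable lebesgue (\<lambda>x. indicator B x *\<^sub>R indicator (cball a r) x *\<^sub>R u x)"
    proof (rule integrable_mult_indicator)
      show "integrable lebesgue (\<lambda>x. indicator (cball a r) x *\<^sub>R u x)"
        using u by (subst (asm) integrable_lebesgue_on_iff) auto
    qed (auto simp: B_def)
    moreover have "(\<lambda>x. indicator B x *\<^sub>R indicator (cball a r) x *\<^sub>R u x) = v"
      by (auto simp: v_def B_def indicator_def fun_eq_iff)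
    ultimately show ?thesis by simp
  qed
  have "AE x in lebesgue. v x = 0"
  proof (rule sigma_finite_measure.density_zero[OF _ v])
    show "sigma_finite_measure (lebesgue :: 'a measure)"
      by (rule sigma_finite_lebesgue)
    fix X :: "'a set" assume X: "X \<in> sets lebesgue"
    obtain C N where C: "gdelta C" "N \<in> null_sets lebesgue" "X \<union> N = C" "disjnt X N"
      by (rule lebesgue_set_almost_gdelta[OF X]) (rule that)
    obtain F :: "nat \<Rightarrow> 'a set" where F: "\<And>n. open (F n)" "C = \<Inter>(range F)"
      using C(1) by (auto simp: gdelta.simps)
    have Cs: "C \<in> sets lebesgue"
      unfolding C(3)[symmetric] using null_setsD2[OF C(2)] X by (rule sets.Un[rotated])
    \<comment> \<open>Finite intersections stay open and decrease to C, so their indicators converge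
      pointwise.\<close>
    define G where "G n = (\<Inter>i\<le>n. F i)" for n
    have "(\<lambda>n. \<integral>x. indicator (G n) x * v x \<partial>lebesgue) \<longlonglongrightarrow> (\<integral>x. indicator C x * v x \<partial>lebesgue)"
    proof (rule integral_dominated_convergence[where w="\<lambda>x. norm (v x)"])
      show "integrable lebesgue (\<lambda>x. norm (v x))" using v by simp
      have "open (G n)" for n
        unfolding G_def using F by (intro open_INT) auto
      then show "(\<lambda>x. indicator (G n) x * v x) \<in> borel_measurable lebesgue" for n
        using v Cs by (intro borel_measurable_times borel_measurable_indicator) auto
      show "(\<lambda>x. indicator C x * v x) \<in> borel_measurable lebesgue"
        using v Cs by (intro borel_measurable_times borel_measurable_indicator) auto
      show "AE x in lebesgue. norm (indicator (G n) x * v x) \<le> norm (v x)" for n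
        by (auto simp: indicator_def)
      show "AE x in lebesgue. (\<lambda>n. indicator (G n) x * v x) \<longlonglongrightarrow> indicator C x * v x"
      proof (intro AE_I2 tendsto_mult tendsto_const)
        fix x
        show "(\<lambda>n. indicator (G n) x :: real) \<longlonglongrightarrow> indicator C x"
        proof (cases "x \<in> C")
          case True
          then show ?thesis by (auto simp: G_def F(2))
        next
          case False
          then obtain i where "x \<notin> F i" by (auto simp: F(2))
          then have "\<forall>\<^sub>F n in sequentially. (indicator (G n) x :: real) = 0"
            unfolding eventually_sequentially by (intro exI[of _ i]) (auto simp: G_def indicator_def)
          then show ?thesis using False by (simp add: tendsto_eventually)
        qed
      qed
    qed
    moreover have "(\<integral>x. indicator (G n) x * v x \<partial>lebesgue) = 0" for n
      unfolding G_def using F by (intro U0 open_INT) auto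
    ultimately have "(\<integral>x. indicator C x * v x \<partial>lebesgue) = 0"
      by (auto simp: LIMSEQ_const_iff)
    moreover have "(\<integral>x. indicator C x * v x \<partial>lebesgue) = (\<integral>x. indicator X x * v x \<partial>lebesgue)"
    proof (rule integral_cong_AE)
      show "AE x in lebesgue. indicator C x * v x = indicator X x * v x"
        using C by (intro AE_I'[OF C(2)]) (auto simp: indicator_def)
      show "(\<lambda>x. indicator C x * v x) \<in> borel_measurable lebesgue"
        using v Cs by (intro borel_measurable_times borel_measurable_indicator) auto
      show "(\<lambda>x. indicator X x * v x) \<in> borel_measurable lebesgue"
        using v X by (intro borel_measurable_times borel_measurable_indicator) auto
    qed
    ultimately show "set_lebesgue_integral lebesgue X v = 0"
      by (simp add: set_lebesgue_integral_def)
  qed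
  then show ?thesis
    by eventually_elim (auto simp: v_def B_def)
qed

text \<open>Lindelof leaves countably many balls, so their exceptional null sets add up to a null
  set.\<close>

lemma AE_zero_if_test_integrals_zero:
  fixes u :: "'a::euclidean_space \<Rightarrow> real"
  assumes "open S" "locally_integrable_on S u"
    and z: "\<And>\<phi> D. test_function S \<phi> D \<Longrightarrow> (\<integral>x. \<phi> x * u x \<partial>lebesgue_on S) = 0"
  shows "AE x in lebesgue_on S. u x = 0"
proof -
  have "\<exists>r. \<forall>x\<in>S. 0 < r x \<and> cball x (r x) \<subseteq> S"
    using assms(1) open_contains_cball by (intro bchoice) blast
  then obtain r where r: "\<And>x. x \<in> S \<Longrightarrow> 0 < r x \<and> cball x (r x) \<subseteq> S"
    by blast
  obtain \<F> where F: "\<F> \<subseteq> (\<lambda>x. ball x (r x)) ` S" "countable \<F>" "\<Union>\<F> = \<Union>((\<lambda>x. ball x (r x)) ` S)"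
    using Lindelof[of "(\<lambda>x. ball x (r x)) ` S"] by auto
  have "AE x in lebesgue. \<forall>B\<in>\<F>. x \<in> B \<longrightarrow> u x = 0"
  proof (intro AE_ball_countable[THEN iffD2] ballI F(2))
    fix B assume "B \<in> \<F>"
    then obtain a where a: "a \<in> S" "B = ball a (r a)" using F(1) by auto
    show "AE x in lebesgue. x \<in> B \<longrightarrow> u x = 0"
      unfolding a(2)
      by (rule AE_zero_on_ball_if_test_integrals_zero[OF assms(1)])
         (use r a assms z in \<open>auto simp: locally_integrable_on_def\<close>)
  qed
  then have "AE x in lebesgue. x \<in> S \<longrightarrow> u x = 0"
  proof eventually_elim
    case (elim x)
    have "\<exists>B\<in>\<F>. x \<in> B" if "x \<in> S"
      using that r[OF that] F(3) centre_in_ball by blast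
    then show ?case using elim by blast
  qed
  then show ?thesis
    using assms(1) by (subst AE_restrict_space_iff) auto
qed

subsection \<open>Square integrable functions and weak gradients\<close>

lemma L2_inner_integrable:
  fixes u v :: "'a \<Rightarrow> 'b::euclidean_space"
  assumes "u \<in> L2 M" "v \<in> L2 M"
  shows "integrable M (\<lambda>x. u x \<bullet> v x)"
proof (rule Bochner_Integration.integrable_bound[where f="\<lambda>x. (norm (u x))\<^sup>2 + (norm (v x))\<^sup>2"])
  show "integrable M (\<lambda>x. (norm (u x))\<^sup>2 + (norm (v x))\<^sup>2)"
    using assms by (auto simp: L2_def)
  show "(\<lambda>x. u x \<bullet> v x) \<in> borel_measurable M"
    using assms by (intro borel_measurable_inner) (auto simp: L2_def)
  have "\<bar>u x \<bullet> v x\<bar> \<le> (norm (u x))\<^sup>2 + (norm (v x))\<^sup>2" for x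
  proof -
    have "\<bar>u x \<bullet> v x\<bar> \<le> norm (u x) * norm (v x)"
      by (rule Cauchy_Schwarz_ineq2)
    also have "\<dots> \<le> (norm (u x))\<^sup>2 + (norm (v x))\<^sup>2"
      using sum_squares_bound[of "norm (u x)" "norm (v x)"]
      mult_nonneg_nonneg[OF norm_ge_zero[of "u x"] norm_ge_zero[of "v x"]] by linarith
    finally show ?thesis .
  qed
  then show "AE x in M. norm (u x \<bullet> v x) \<le> norm ((norm (u x))\<^sup>2 + (norm (v x))\<^sup>2)"
    by simp
qed

lemma L2_add:
  fixes u v :: "'a \<Rightarrow> 'b::euclidean_space"
  assumes "u \<in> L2 M" "v \<in> L2 M"
  shows "(\<lambda>x. u x + v x) \<in> L2 M"
proof -
  have "integrable M (\<lambda>x. (norm (u x))\<^sup>2 + 2 * (u x \<bullet> v x) + (norm (v x))\<^sup>2)"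
    using assms L2_inner_integrable[OF assms] by (auto simp: L2_def)
  moreover have "(norm (u x))\<^sup>2 + 2 * (u x \<bullet> v x) + (norm (v x))\<^sup>2 = (norm (u x + v x))\<^sup>2" for x
    by (simp add: power2_norm_eq_inner inner_add_left inner_add_right inner_commute)
  ultimately show ?thesis
    using assms by (auto simp: L2_def)
qed

lemma L2_scaleR:
  fixes u :: "'a \<Rightarrow> 'b::euclidean_space"
  assumes "u \<in> L2 M"
  shows "(\<lambda>x. a *\<^sub>R u x) \<in> L2 M"
  using assms by (auto simp: L2_def power_mult_distrib)

lemma L2_mult:
  assumes "u \<in> L2 M"
  shows "(\<lambda>x. a * u x :: real) \<in> L2 M"
  using L2_scaleR[OF assms, of a] by simp

lemma L2_diff:
  fixes u v :: "'a \<Rightarrow> 'b::euclidean_space"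
  assumes "u \<in> L2 M" "v \<in> L2 M"
  shows "(\<lambda>x. u x - v x) \<in> L2 M"
  using L2_add[OF assms(1) L2_scaleR[OF assms(2), of "-1"]] by simp

lemma L2_cong_AE:
  assumes "u \<in> L2 M" "v \<in> borel_measurable M" "AE x in M. u x = v x"
  shows "v \<in> L2 M"
proof -
  have "integrable M (\<lambda>x. (norm (v x))\<^sup>2)"
    by (rule integrable_cong_AE_imp[where f="\<lambda>x. (norm (v x))\<^sup>2" and g="\<lambda>x. (norm (u x))\<^sup>2"])
      (use assms in \<open>auto simp: L2_def\<close>)
  then show ?thesis
    using assms by (simp add: L2_def)
qed

lemma L2_bounded:
  fixes u :: "'a \<Rightarrow> 'b::euclidean_space"
  assumes "finite_measure M" "u \<in> borel_measurable M" "AE x in M. norm (u x) \<le> B"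
  shows "u \<in> L2 M"
proof -
  have "integrable M (\<lambda>x. (norm (u x))\<^sup>2)"
  proof (rule finite_measure.integrable_const_bound[OF assms(1), where B="B\<^sup>2"])
    show "AE x in M. norm ((norm (u x))\<^sup>2) \<le> B\<^sup>2"
      using assms(3) by eventually_elim (simp add: power_mono)
  qed (use assms(2) in auto)
  then show ?thesis
    using assms(2) by (simp add: L2_def)
qed

lemma l2norm_nonneg [simp]: "0 \<le> l2norm M u"
  by (simp add: l2norm_def)

lemma l2norm_sq: "(l2norm M u)\<^sup>2 = (\<integral>x. (norm (u x))\<^sup>2 \<partial>M)"
  by (simp add: l2norm_def)

lemma l2norm_cong_AE:
  assumes "u \<in> borel_measurable M" "v \<in> borel_measurable M" "AE x in M. u x = v x"
  shows "l2norm M u = l2norm M v"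
  unfolding l2norm_def using assms by (intro arg_cong[of _ _ sqrt] integral_cong_AE) auto

lemma quadratic_nonneg_imp_discriminant:
  fixes a b c :: real
  assumes "\<And>t. 0 \<le> a - 2 * t * b + t\<^sup>2 * c" "0 \<le> c" "0 \<le> a"
  shows "\<bar>b\<bar> \<le> sqrt a * sqrt c"
proof -
  have "b\<^sup>2 \<le> a * c"
  proof (cases "c = 0")
    case True
    have "b = 0"
    proof (rule ccontr)
      assume "b \<noteq> 0"
      \<comment> \<open>With c = 0 the quadratic is affine, and at this argument it equals
        -1.\<close>
      with assms(1)[of "(a + 1) / (2 * b)"] True show False by simp
    qed
    then show ?thesis using True by simp
  next
    case False
    with assms(2) have "0 < c" by simp
    have "0 \<le> (a - 2 * (b / c) * b + (b / c)\<^sup>2 * c) * c"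
      using assms(1)[of "b / c"] assms(2) by (rule mult_nonneg_nonneg)
    also have "\<dots> = a * c - b\<^sup>2"
      using \<open>0 < c\<close> by (simp add: field_simps power2_eq_square)
    finally show ?thesis by simp
  qed
  then have "sqrt (b\<^sup>2) \<le> sqrt (a * c)"
    by (rule real_sqrt_le_mono)
  then show ?thesis
    by (simp add: real_sqrt_mult)
qed

lemma l2_Cauchy_Schwarz:
  fixes u v :: "'a \<Rightarrow> 'b::euclidean_space"
  assumes "u \<in> L2 M" "v \<in> L2 M"
  shows "\<bar>\<integral>x. u x \<bullet> v x \<partial>M\<bar> \<le> l2norm M u * l2norm M v"
  unfolding l2norm_def
proof (rule quadratic_nonneg_imp_discriminant)
  fix t :: real
  have "0 \<le> (\<integral>x. (norm (u x - t *\<^sub>R v x))\<^sup>2 \<partial>M)"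
    by simp
  also have "\<dots> = (\<integral>x. (norm (u x))\<^sup>2 - 2 * t * (u x \<bullet> v x) + t\<^sup>2 * (norm (v x))\<^sup>2 \<partial>M)"
    by (rule Bochner_Integration.integral_cong)
       (simp_all add: power2_norm_eq_inner algebra_simps inner_commute power2_eq_square[of t])
  also have "\<dots> = (\<integral>x. (norm (u x))\<^sup>2 \<partial>M) - 2 * t * (\<integral>x. u x \<bullet> v x \<partial>M) + t\<^sup>2 * (\<integral>x. (norm (v x))\<^sup>2 \<partial>M)"
    using assms L2_inner_integrable[OF assms] by (simp add: L2_def)
  finally show "0 \<le> \<dots>" .
qed auto

section \<open>Uniqueness, linearity and measurability of weak gradients\<close>

lemma has_weak_grad_locally_integrable:
  assumes "has_weak_grad S w G"
  shows "locally_integrable_on S w" "locally_integrable_on S G"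
  using assms by (auto simp: has_weak_grad_def locally_integrable_on_def)

lemma test_function_mult_integrable:
  fixes u :: "'a::euclidean_space \<Rightarrow> 'b::euclidean_space"
  assumes "open S" "locally_integrable_on S u" "test_function S \<phi> D"
  shows "integrable (lebesgue_on S) (\<lambda>x. \<phi> x *\<^sub>R u x)"
proof -
  obtain K where K: "compact K" "K \<subseteq> S" "\<And>x. x \<notin> K \<Longrightarrow> \<phi> x = 0"
    using assms(3) unfolding test_function_def by metis
  obtain B where B: "\<And>x. \<bar>\<phi> x\<bar> \<le> B"
    by (rule test_function_bounded[OF assms(3)]) (rule that)
  show ?thesis
    by (rule locally_integrable_on_mult_support[OF assms(1,2) K(1,2)
         test_function_continuous[OF assms(3)] K(3) B])
qed

lemma test_function_grad_integrable:
  fixes u :: "'a::euclidean_space \<Rightarrow> real"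
  assumes "open S" "locally_integrable_on S u" "test_function S \<phi> D"
  shows "integrable (lebesgue_on S) (\<lambda>x. u x *\<^sub>R D x)"
proof -
  obtain K where K: "compact K" "K \<subseteq> S" "\<And>x. x \<notin> K \<Longrightarrow> D x = 0"
    by (rule test_function_grad_support[OF assms(3)]) (rule that)
  obtain B where B: "\<And>x. norm (D x) \<le> B"
    by (rule test_function_bounded[OF assms(3)]) (rule that)
  have D: "continuous_on UNIV D"
    using assms(3) by (simp add: test_function_def)
  \<comment> \<open>The support lemma takes a scalar factor, so it is applied to each coordinate of
    the gradient.\<close>
  have "integrable (lebesgue_on S) (\<lambda>x. (D x \<bullet> b) *\<^sub>R u x)" if "b \<in> Basis" for b
  proof (rule locally_integrable_on_mult_support[OF assms(1,2) K(1,2)])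
    show "continuous_on UNIV (\<lambda>x. D x \<bullet> b)"
      using D by (intro continuous_intros)
    show "\<bar>D x \<bullet> b\<bar> \<le> B" for x
      using Basis_le_norm[OF that, of "D x"] B[of x] by linarith
  qed (use K in auto)
  then have "integrable (lebesgue_on S) (\<lambda>x. \<Sum>b\<in>Basis. ((D x \<bullet> b) *\<^sub>R u x) *\<^sub>R b)"
    by (intro Bochner_Integration.integrable_sum integrable_scaleR_left) auto
  moreover have "(\<Sum>b\<in>Basis. ((D x \<bullet> b) *\<^sub>R u x) *\<^sub>R b) = u x *\<^sub>R D x" for x
    using euclidean_representation[of "u x *\<^sub>R D x"] by (simp add: mult.commute)
  ultimately show ?thesis by simp
qed

text \<open>Two weak gradients have the same integral against every test function. The fundamental
  lemma is scalar, hence the passage to the finitely many coordinates.\<close>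

lemma has_weak_grad_unique:
  fixes w :: "'a::euclidean_space \<Rightarrow> real"
  assumes "open S" "has_weak_grad S w G" "has_weak_grad S w G'"
  shows "AE x in lebesgue_on S. G x = G' x"
proof -
  have "AE x in lebesgue_on S. (G x - G' x) \<bullet> b = 0" for b
  proof (rule AE_zero_if_test_integrals_zero[OF assms(1)])
    show "locally_integrable_on S (\<lambda>x. (G x - G' x) \<bullet> b)"
      using assms(2,3) by (auto simp: has_weak_grad_def locally_integrable_on_def)
    fix \<phi> D assume t: "test_function S \<phi> D"
    note i = test_function_mult_integrable[OF assms(1) has_weak_grad_locally_integrable(2) t]
    have "(\<integral>x. \<phi> x *\<^sub>R G x \<partial>lebesgue_on S) = (\<integral>x. \<phi> x *\<^sub>R G' x \<partial>lebesgue_on S)"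
      using assms(2,3) t by (simp add: has_weak_grad_def) (metis neg_equal_iff_equal)
    then have "0 = (\<integral>x. \<phi> x *\<^sub>R G x - \<phi> x *\<^sub>R G' x \<partial>lebesgue_on S) \<bullet> b"
      using i[OF assms(2)] i[OF assms(3)] by simp
    also have "\<dots> = (\<integral>x. (\<phi> x *\<^sub>R G x - \<phi> x *\<^sub>R G' x) \<bullet> b \<partial>lebesgue_on S)"
      using i[OF assms(2)] i[OF assms(3)] by (intro integral_inner_left[symmetric]) auto
    finally show "(\<integral>x. \<phi> x * ((G x - G' x) \<bullet> b) \<partial>lebesgue_on S) = 0"
      by (simp add: inner_diff_left algebra_simps)
  qed
  then have "AE x in lebesgue_on S. \<forall>b\<in>Basis. (G x - G' x) \<bullet> b = 0"
    by (intro AE_ball_countable[THEN iffD2]) (auto intro: countable_finite)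
  then show ?thesis
    by eventually_elim (metis euclidean_all_zero_iff eq_iff_diff_eq_0)
qed

lemma has_weak_grad_lincomb:
  fixes w :: "'a::euclidean_space \<Rightarrow> real"
  assumes "open S" "has_weak_grad S w G" "has_weak_grad S w' G'"
  shows "has_weak_grad S (\<lambda>x. a * w x + b * w' x) (\<lambda>x. a *\<^sub>R G x + b *\<^sub>R G' x)"
  unfolding has_weak_grad_def
proof (intro conjI allI impI)
  show "integrable (lebesgue_on K) (\<lambda>x. a * w x + b * w' x)"
    "integrable (lebesgue_on K) (\<lambda>x. a *\<^sub>R G x + b *\<^sub>R G' x)" if "compact K \<and> K \<subseteq> S" for K
    using assms(2,3) that by (auto simp: has_weak_grad_def)
  fix \<phi> D assume t: "test_function S \<phi> D"
  note i = test_function_mult_integrable[OF assms(1) has_weak_grad_locally_integrable(2) t]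
  note j = test_function_grad_integrable[OF assms(1) has_weak_grad_locally_integrable(1) t]
  have "(\<integral>x. (a * w x + b * w' x) *\<^sub>R D x \<partial>lebesgue_on S)
      = (\<integral>x. a *\<^sub>R (w x *\<^sub>R D x) + b *\<^sub>R (w' x *\<^sub>R D x) \<partial>lebesgue_on S)"
    by (simp add: algebra_simps)
  also have "\<dots> = a *\<^sub>R (\<integral>x. w x *\<^sub>R D x \<partial>lebesgue_on S) + b *\<^sub>R (\<integral>x. w' x *\<^sub>R D x \<partial>lebesgue_on S)"
    using j[OF assms(2)] j[OF assms(3)] by (simp del: scaleR_scaleR)
  also have "\<dots> = - (a *\<^sub>R (\<integral>x. \<phi> x *\<^sub>R G x \<partial>lebesgue_on S) + b *\<^sub>R (\<integral>x. \<phi> x *\<^sub>R G' x \<partial>lebesgue_on S))"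
    using assms(2,3) t by (simp add: has_weak_grad_def)
  also have "\<dots> = - (\<integral>x. a *\<^sub>R (\<phi> x *\<^sub>R G x) + b *\<^sub>R (\<phi> x *\<^sub>R G' x) \<partial>lebesgue_on S)"
    using i[OF assms(2)] i[OF assms(3)] by (simp del: scaleR_scaleR)
  also have "\<dots> = - (\<integral>x. \<phi> x *\<^sub>R (a *\<^sub>R G x + b *\<^sub>R G' x) \<partial>lebesgue_on S)"
    by (simp add: algebra_simps)
  finally show "(\<integral>x. (a * w x + b * w' x) *\<^sub>R D x \<partial>lebesgue_on S)
      = - (\<integral>x. \<phi> x *\<^sub>R (a *\<^sub>R G x + b *\<^sub>R G' x) \<partial>lebesgue_on S)" .
qed

text \<open>The choice in \<open>weak_grad\<close> is controlled only through the existence of some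
  weak gradient.\<close>

lemma has_weak_grad_weak_grad:
  assumes "has_weak_grad S w G"
  shows "has_weak_grad S w (weak_grad S w)"
  unfolding weak_grad_def using assms by (rule someI[where P="has_weak_grad S w"])

lemma weak_grad_AE_eq:
  assumes "open S" "has_weak_grad S w G"
  shows "AE x in lebesgue_on S. weak_grad S w x = G x"
  using has_weak_grad_unique[OF assms(1) has_weak_grad_weak_grad[OF assms(2)] assms(2)] .

lemma weak_grad_lincomb_AE:
  assumes "open S" "has_weak_grad S w G" "has_weak_grad S w' G'"
  shows "AE x in lebesgue_on S. weak_grad S (\<lambda>x. a * w x + b * w' x) x
           = a *\<^sub>R weak_grad S w x + b *\<^sub>R weak_grad S w' x"
  by (intro weak_grad_AE_eq has_weak_grad_lincomb has_weak_grad_weak_grad[OF assms(2)]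
            has_weak_grad_weak_grad[OF assms(3)] assms(1))

text \<open>The products with test functions tending to 1 on S are integrable, hence measurable, and
  converge pointwise to u. This is how a gradient obtained by choice is seen to be measurable on the
  whole domain.\<close>

lemma locally_integrable_on_imp_measurable:
  fixes u :: "'a::euclidean_space \<Rightarrow> 'b::euclidean_space"
  assumes "open S" "locally_integrable_on S u"
  shows "u \<in> borel_measurable (lebesgue_on S)"
proof -
  obtain \<phi> D where \<phi>: "\<And>n::nat. test_function S (\<phi> n) (D n)"
    "\<And>n x. 0 \<le> \<phi> n x" "\<And>n x. \<phi> n x \<le> 1" "\<And>x. (\<lambda>n. \<phi> n x) \<longlonglongrightarrow> indicator S x"
    by (rule test_functions_tendsto_indicator[OF \<open>open S\<close>]) (rule that)
  show ?thesis
  proof (rule borel_measurable_LIMSEQ_metric)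
    show "(\<lambda>x. \<phi> n x *\<^sub>R u x) \<in> borel_measurable (lebesgue_on S)" for n
      by (rule borel_measurable_integrable[OF test_function_mult_integrable[OF assms \<phi>(1)]])
    fix x assume "x \<in> space (lebesgue_on S)"
    then have "(\<lambda>n. \<phi> n x) \<longlonglongrightarrow> 1"
      using \<phi>(4)[of x] by simp
    from tendsto_scaleR[OF this tendsto_const[of "u x"]]
    show "(\<lambda>n. \<phi> n x *\<^sub>R u x) \<longlonglongrightarrow> u x"
      by simp
  qed
qed

lemma weak_grad_measurable:
  assumes "open S" "has_weak_grad S w G"
  shows "weak_grad S w \<in> borel_measurable (lebesgue_on S)"
  by (rule locally_integrable_on_imp_measurable[OF assms(1)
        has_weak_grad_locally_integrable(2)[OF has_weak_grad_weak_grad[OF assms(2)]]])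

subsection \<open>Weak gradients of Lipschitz functions\<close>

text \<open>Borel measurability allows the passage from \<open>lebesgue\<close> to
  \<open>lborel\<close>, where translation invariance is an identity of image measures.\<close>

lemma lebesgue_integral_shift:
  fixes h :: "'a::euclidean_space \<Rightarrow> real"
  assumes "h \<in> borel_measurable borel" "integrable lebesgue h"
  shows "integrable lebesgue (\<lambda>x. h (x + c))" "(\<integral>x. h (x + c) \<partial>lebesgue) = (\<integral>x. h x \<partial>lebesgue)"
proof -
  have m: "(\<lambda>x. h (x + c)) \<in> borel_measurable borel"
    using assms(1) by measurable
  have d: "distr lborel borel (\<lambda>x. x + c) = (lborel :: 'a measure)"
    using lborel_distr_plus[of c] by (simp add: add.commute[of _ c])
  have i: "integrable lborel h"
    using assms by (subst (asm) integrable_completion) auto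
  have "integrable (distr lborel borel (\<lambda>x. x + c)) h"
    by (simp add: d i)
  then have "integrable lborel (\<lambda>x. h (x + c))"
    using assms(1) by (subst (asm) integrable_distr_eq) auto
  then show "integrable lebesgue (\<lambda>x. h (x + c))"
    using m by (subst integrable_completion) auto
  have "(\<integral>x. h (x + c) \<partial>lborel) = (\<integral>x. h x \<partial>distr lborel borel (\<lambda>x. x + c))"
    using assms(1) by (subst integral_distr) auto
  then show "(\<integral>x. h (x + c) \<partial>lebesgue) = (\<integral>x. h x \<partial>lebesgue)"
    using m assms(1) by (simp add: integral_completion d)
qed

text \<open>By translation invariance each difference quotient has integral zero. The linear bound
  in t and the bounded support give a common majorant, so the limit q has integral zero too.\<close>

lemma integral_directional_derivative_zero:
  fixes h :: "'a::euclidean_space \<Rightarrow> real"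
  assumes h: "h \<in> borel_measurable borel" "integrable lebesgue h"
    and K: "bounded K" "\<And>x. x \<notin> K \<Longrightarrow> h x = 0"
    and \<delta>: "0 < \<delta>" "\<And>x t. 0 < t \<Longrightarrow> t < \<delta> \<Longrightarrow> \<bar>h (x + t *\<^sub>R b) - h x\<bar> \<le> C * t"
    and q: "q \<in> borel_measurable lebesgue"
      "AE x in lebesgue. ((\<lambda>t. (h (x + t *\<^sub>R b) - h x) / t) \<longlongrightarrow> q x) (at_right 0)"
  shows "(\<integral>x. q x \<partial>lebesgue) = 0"
proof -
  \<comment> \<open>The shift by 2 keeps the denominator positive and every t n strictly below
    \<delta>.\<close>
  define t where "t n = \<delta> / real (n + 2)" for n
  have t: "0 < t n" "t n < \<delta>" for n
    using \<delta>(1) by (auto simp: t_def field_simps intro!: add_pos_nonneg)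
  have "(\<lambda>n. \<delta> / real (n + 2)) \<longlonglongrightarrow> 0"
    using LIMSEQ_ignore_initial_segment[OF lim_const_over_n[of \<delta>], of 2] by simp
  then have tlim: "filterlim t (at_right 0) sequentially"
    using t by (auto simp: filterlim_at t_def[abs_def] intro!: always_eventually)
  obtain R where R: "\<And>x. x \<in> K \<Longrightarrow> norm x \<le> R"
    using K(1) by (auto simp: bounded_iff)
  \<comment> \<open>K enlarged by the longest admissible shift: outside J neither x nor its
    translate meets K.\<close>
  define J where "J = cball (0::'a) (R + \<delta> * norm b)"
  have "(\<lambda>n. \<integral>x. (h (x + t n *\<^sub>R b) - h x) / t n \<partial>lebesgue) \<longlonglongrightarrow> (\<integral>x. q x \<partial>lebesgue)"
  proof (rule integral_dominated_convergence[where w="\<lambda>x. C * indicator J x"])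
    show "q \<in> borel_measurable lebesgue" by (fact q(1))
    show "(\<lambda>x. (h (x + t n *\<^sub>R b) - h x) / t n) \<in> borel_measurable lebesgue" for n
      using lebesgue_integral_shift(1)[OF h, of "t n *\<^sub>R b"] h(2)
      by (intro borel_measurable_divide borel_measurable_diff) auto
    show "integrable lebesgue (\<lambda>x. C * indicator J x)"
      using lmeasurable_cball by (intro integrable_mult_right integrable_real_indicator)
        (auto simp: J_def emeasure_lborel_cball_finite[unfolded infinity_ennreal_def])
    show "AE x in lebesgue. (\<lambda>n. (h (x + t n *\<^sub>R b) - h x) / t n) \<longlonglongrightarrow> q x"
      using q(2) by eventually_elim (rule filterlim_compose[OF _ tlim])
    show "AE x in lebesgue. norm ((h (x + t n *\<^sub>R b) - h x) / t n) \<le> C * indicator J x" for n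
    proof (rule AE_I2)
      fix x
      show "norm ((h (x + t n *\<^sub>R b) - h x) / t n) \<le> C * indicator J x"
      proof (cases "x \<in> J")
        case True
        then show ?thesis
          using \<delta>(2)[OF t, of x] t(1)[of n] by (simp add: field_simps)
      next
        case False
        then have n: "R + \<delta> * norm b < norm x"
          by (simp add: J_def)
        have "\<bar>t n\<bar> * norm b \<le> \<delta> * norm b"
          using t[of n] by (intro mult_right_mono) auto
        moreover have "norm x \<le> norm (x + t n *\<^sub>R b) + \<bar>t n\<bar> * norm b"
          using norm_triangle_ineq4[of "x + t n *\<^sub>R b" "t n *\<^sub>R b"] by simp
        moreover have "0 \<le> \<delta> * norm b"
          using \<delta>(1) by simp
        ultimately have "x \<notin> K" "x + t n *\<^sub>R b \<notin> K"
          using n R[of x] R[of "x + t n *\<^sub>R b"] by auto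
        then show ?thesis
          using K(2) False by simp
      qed
    qed
  qed
  moreover have "(\<integral>x. (h (x + t n *\<^sub>R b) - h x) / t n \<partial>lebesgue) = 0" for n
    using lebesgue_integral_shift[OF h, of "t n *\<^sub>R b"] h(2) by simp
  ultimately have "(\<lambda>n::nat. 0) \<longlonglongrightarrow> (\<integral>x. q x \<partial>lebesgue)"
    by (simp only:)
  then show ?thesis
    by (simp add: LIMSEQ_const_iff)
qed

lemma has_derivative_imp_directional_limit:
  fixes f :: "'a::euclidean_space \<Rightarrow> real"
  assumes "(f has_derivative f') (at x)"
  shows "((\<lambda>t. (f (x + t *\<^sub>R b) - f x) / t) \<longlongrightarrow> f' b) (at_right 0)"
proof -
  have "((\<lambda>t::real. x + t *\<^sub>R b) has_derivative (\<lambda>t. t *\<^sub>R b)) (at 0)"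
    by (auto intro!: derivative_eq_intros)
  moreover have "(f has_derivative f') (at (x + 0 *\<^sub>R b))"
    using assms by simp
  ultimately have "((\<lambda>t. f (x + t *\<^sub>R b)) has_derivative (\<lambda>t. f' (t *\<^sub>R b))) (at 0)"
    by (rule has_derivative_compose)
  moreover have "f' (t *\<^sub>R b) = f' b * t" for t
    using linear_simps(5)[OF has_derivative_bounded_linear[OF assms]] by simp
  ultimately have "((\<lambda>t. f (x + t *\<^sub>R b)) has_real_derivative f' b) (at 0)"
    by (simp add: has_field_derivative_def)
  then have "((\<lambda>t. (f (x + t *\<^sub>R b) - f x) / t) \<longlongrightarrow> f' b) (at 0)"
    by (simp add: DERIV_def)
  then show ?thesis
    by (rule filterlim_mono) (auto simp: at_within_le_at)
qed

lemma test_function_lipschitz: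
  assumes "test_function S \<phi> D" "\<And>x. norm (D x) \<le> B"
  shows "B-lipschitz_on UNIV \<phi>"
proof (rule bounded_derivative_imp_lipschitz)
  show "(\<phi> has_derivative (\<lambda>h. D x \<bullet> h)) (at x within UNIV)" for x
    using assms(1) by (simp add: test_function_def)
  show "onorm (\<lambda>h. D x \<bullet> h) \<le> B" for x
    using assms(2)[of x] by (intro onorm_le) (metis Cauchy_Schwarz_ineq2 mult_right_mono norm_ge_zero order_trans real_norm_def)
  show "0 \<le> B"
    using assms(2) norm_ge_zero order_trans by blast
qed simp

text \<open>Integration by parts against a test function needs only that difference quotients of \<open>\<phi> w\<close> have
  integral zero and converge boundedly; so no form of Rademacher's theorem is involved.\<close>

lemma lipschitz_has_bounded_weak_grad:
  fixes w :: "'a::euclidean_space \<Rightarrow> real"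
  assumes S: "open S" "bounded S" and L: "L-lipschitz_on S w"
    and N: "negligible N" "\<And>x. x \<in> S - N \<Longrightarrow> w differentiable (at x)"
  obtains G B where "has_weak_grad S w G" "G \<in> borel_measurable lebesgue" "\<And>x. norm (G x) \<le> B"
proof -
  \<comment> \<open>Extension by zero gives a Borel function on the whole space, as translation
    requires. Since S is open, it agrees with w near every point of S and has the same derivative
    there.\<close>
  define w0 where "w0 x = indicator S x *\<^sub>R w x" for x
  have cw: "continuous_on S w"
    by (rule lipschitz_on_continuous_on[OF L])
  have L0: "0 \<le> L"
    by (rule lipschitz_on_nonneg[OF L])
  have w0m: "w0 \<in> borel_measurable borel"
    unfolding w0_def using S(1) cw by (intro borel_measurable_continuous_on_indicator) auto
  obtain W where W: "\<And>x. x \<in> S \<Longrightarrow> \<bar>w x\<bar> \<le> W" "0 \<le> W"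
  proof -
    have "bounded (w ` S)"
      using S(2) L bounded_uniformly_continuous_image lipschitz_on_uniformly_continuous by blast
    then obtain W where "\<And>x. x \<in> S \<Longrightarrow> \<bar>w x\<bar> \<le> W"
      unfolding bounded_iff by auto
    then show thesis
      using that[of "max 0 W"] by fastforce
  qed
  \<comment> \<open>A partial derivative written as the limit of a sequence of Borel functions. This
    is Borel on the whole space, whatever value \<open>lim\<close> takes where the sequence
    diverges.\<close>
  define g where "g b x = lim (\<lambda>n. (w0 (x + inverse (real (Suc n)) *\<^sub>R b) - w0 x) / inverse (real (Suc n)))" for b x
  have gm: "g b \<in> borel_measurable borel" for b
  proof -
    have "(\<lambda>x. w0 (x + c)) \<in> borel_measurable borel" for c
      using w0m by measurable
    then show ?thesis
      unfolding g_def using w0m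
      by (intro borel_measurable_lim_metric borel_measurable_divide borel_measurable_diff borel_measurable_const)
  qed
  have seq: "filterlim (\<lambda>n. inverse (real (Suc n))) (at_right 0) sequentially"
    using LIMSEQ_inverse_real_of_nat by (auto simp: filterlim_at intro!: always_eventually)
  have w0d: "(w0 has_derivative frechet_derivative w (at x)) (at x)" if "x \<in> S - N" for x
    by (rule has_derivative_transform_within_open[OF frechet_derivative_works[THEN iffD1, OF N(2)[OF that]] S(1)])
       (use that in \<open>auto simp: w0_def\<close>)
  have g: "g b x = frechet_derivative w (at x) b" if "x \<in> S - N" for b x
    unfolding g_def
    by (intro limI filterlim_compose[OF has_derivative_imp_directional_limit[OF w0d[OF that]] seq])
  have gL: "\<bar>g b x\<bar> \<le> L" if xb: "x \<in> S - N" "b \<in> Basis" for b x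
  proof -
    have lim: "((\<lambda>t. (w0 (x + t *\<^sub>R b) - w0 x) / t) \<longlongrightarrow> g b x) (at_right 0)"
      using has_derivative_imp_directional_limit[OF w0d[OF xb(1)]] g[OF xb(1)] by simp
    obtain e where e: "0 < e" "ball x e \<subseteq> S"
      using S(1) xb(1) by (auto simp: open_contains_ball)
    have "\<forall>\<^sub>F t in at_right 0. norm ((w0 (x + t *\<^sub>R b) - w0 x) / t) \<le> L"
      using eventually_at_right_real[OF e(1)]
    proof eventually_elim
      case (elim t)
      then have "x + t *\<^sub>R b \<in> S" "x \<in> S"
        using e(2) xb by (auto simp: subset_eq dist_norm)
      then show ?case
        using lipschitz_on_normD[OF L, of "x + t *\<^sub>R b" x] elim xb(2)
        by (auto simp: w0_def field_simps)
    qed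
    from tendsto_upperbound[OF tendsto_norm[OF lim] this] show ?thesis
      by simp
  qed
  \<comment> \<open>The indicator of S - N makes the bound hold at every point, not merely almost
    everywhere.\<close>
  define G where "G x = indicator (S - N) x *\<^sub>R (\<Sum>b\<in>Basis. g b x *\<^sub>R b)" for x
  have SN: "S - N \<in> sets lebesgue"
    using S(1) N(1) by (intro sets.Diff) (auto simp: negligible_imp_sets)
  have Gm: "G \<in> borel_measurable lebesgue"
    unfolding G_def using SN gm
    by (intro borel_measurable_scaleR borel_measurable_indicator borel_measurable_sum
          borel_measurable_const measurable_completion) auto
  have GB: "norm (G x) \<le> real DIM('a) * L" for x
  proof (cases "x \<in> S - N")
    case True
    have "norm (\<Sum>b\<in>Basis. g b x *\<^sub>R b) \<le> (\<Sum>b\<in>(Basis::'a set). L)"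
      using gL[OF True] by (intro sum_norm_le) auto
    then show ?thesis
      using True by (simp add: G_def)
  qed (use L0 in \<open>auto simp: G_def\<close>)
  have Gb: "G x \<bullet> b = g b x" if "x \<in> S - N" "b \<in> Basis" for x b
    using that by (simp add: G_def inner_sum_left inner_Basis if_distrib sum.delta cong: if_cong)
  have w0K: "integrable (lebesgue_on K) w" if "compact K" "K \<subseteq> S" for K
  proof (rule finite_measure.integrable_const_bound[where B=W])
    show "finite_measure (lebesgue_on K)"
      using that by (intro finite_measure_lebesgue_on lmeasurable_compact)
    show "w \<in> borel_measurable (lebesgue_on K)"
      using that cw by (intro continuous_imp_measurable_on_sets_lebesgue)
        (auto intro: continuous_on_subset simp: lmeasurable_compact fmeasurableD)
  qed (use that W(1) in \<open>auto intro!: AE_I2\<close>)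
  have GK: "integrable (lebesgue_on K) G" if "compact K" for K
  proof (rule finite_measure.integrable_const_bound[where B="real DIM('a) * L"])
    show "finite_measure (lebesgue_on K)"
      using that by (intro finite_measure_lebesgue_on lmeasurable_compact)
    show "G \<in> borel_measurable (lebesgue_on K)"
      using Gm by (rule measurable_restrict_space1)
  qed (use GB in auto)
  have "has_weak_grad S w G"
    unfolding has_weak_grad_def
  proof (intro conjI allI impI w0K GK)
    fix \<phi> D assume t: "test_function S \<phi> D"
    obtain K where K: "compact K" "K \<subseteq> S" "\<And>x. x \<notin> K \<Longrightarrow> \<phi> x = 0" "\<And>x. x \<notin> K \<Longrightarrow> D x = 0"
      by (rule test_function_grad_support[OF t]) (rule that)
    obtain B where B: "\<And>x. \<bar>\<phi> x\<bar> \<le> B" "\<And>x. norm (D x) \<le> B" "0 \<le> B"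
      by (rule test_function_bounded[OF t]) (rule that)
    \<comment> \<open>A step shorter than e from a point of K stays inside S.\<close>
    obtain e where e: "0 < e" "(\<Union>x\<in>K. ball x e) \<subseteq> S"
      by (rule compact_subset_open_imp_ball_epsilon_subset[OF K(1) S(1) K(2)]) (rule that)
    have lw: "locally_integrable_on S w" and lG: "locally_integrable_on S G"
      using w0K GK by (auto simp: locally_integrable_on_def)
    note iw = test_function_grad_integrable[OF S(1) lw t]
    note iG = test_function_mult_integrable[OF S(1) lG t]
    have cD: "continuous_on UNIV D" and c\<phi>: "continuous_on UNIV \<phi>"
      using t test_function_continuous[OF t] by (auto simp: test_function_def)
    have "((\<integral>x. w x *\<^sub>R D x \<partial>lebesgue_on S) + (\<integral>x. \<phi> x *\<^sub>R G x \<partial>lebesgue_on S)) \<bullet> b = 0"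
      if b: "b \<in> Basis" for b
    proof -
      define q where "q x = indicator S x *\<^sub>R (w x *\<^sub>R D x + \<phi> x *\<^sub>R G x) \<bullet> b" for x
      have qi: "integrable lebesgue (\<lambda>x. indicator S x *\<^sub>R (w x *\<^sub>R D x + \<phi> x *\<^sub>R G x))"
        using iw iG S(1) by (subst integrable_lebesgue_on_iff[symmetric]) auto
      \<comment> \<open>The factor \<phi> vanishes off K, so the possible jump of w0 at the frontier
        of S disappears from the product.\<close>
      define h where "h x = \<phi> x * w0 x" for x
      have hm: "h \<in> borel_measurable borel"
        unfolding h_def using w0m c\<phi>
        by (intro borel_measurable_times) (auto intro: borel_measurable_continuous_onI)
      have "(\<integral>x. q x \<partial>lebesgue) = 0"
      proof (rule integral_directional_derivative_zero[where h=h and K=K and \<delta>=e and b=b and C="B * L + W * B"])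
        show "integrable lebesgue h"
        proof -
          have "integrable (lebesgue_on S) (\<lambda>x. \<phi> x *\<^sub>R w x)"
            by (rule test_function_mult_integrable[OF S(1) lw t])
          then have "integrable lebesgue (\<lambda>x. indicator S x *\<^sub>R (\<phi> x *\<^sub>R w x))"
            using S(1) by (subst (asm) integrable_lebesgue_on_iff) auto
          then show ?thesis
            by (simp add: h_def[abs_def] w0_def mult.left_commute)
        qed
        show "bounded K" using K(1) by (rule compact_imp_bounded)
        show "q \<in> borel_measurable lebesgue"
          unfolding q_def using qi by (intro borel_measurable_inner) auto
        show "h x = 0" if "x \<notin> K" for x
          using K(3) that by (simp add: h_def)
        show "\<bar>h (x + r *\<^sub>R b) - h x\<bar> \<le> (B * L + W * B) * r" if r: "0 < r" "r < e" for x r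
        \<comment> \<open>If one end of the step lies in K, both ends lie in S, where the Lipschitz
          bound for w is available.\<close>
        proof (cases "x \<in> K \<or> x + r *\<^sub>R b \<in> K")
          case True
          have d: "dist x (x + r *\<^sub>R b) < e" "dist (x + r *\<^sub>R b) x < e"
            using r b by (auto simp: dist_norm)
          have in_S: "x \<in> S" "x + r *\<^sub>R b \<in> S"
            using True e(2) K(2) d by (auto simp: subset_eq)
          have "\<bar>w (x + r *\<^sub>R b) - w x\<bar> \<le> L * r"
            using lipschitz_on_normD[OF L in_S(2,1)] r b by simp
          moreover have "\<bar>\<phi> (x + r *\<^sub>R b) - \<phi> x\<bar> \<le> B * r"
            using lipschitz_on_normD[OF test_function_lipschitz[OF t B(2)], of "x + r *\<^sub>R b" x] r b by simp
          moreover have "h (x + r *\<^sub>R b) - h x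
              = \<phi> (x + r *\<^sub>R b) * (w (x + r *\<^sub>R b) - w x) + w x * (\<phi> (x + r *\<^sub>R b) - \<phi> x)"
            using in_S by (simp add: h_def w0_def algebra_simps)
          ultimately have "\<bar>h (x + r *\<^sub>R b) - h x\<bar> \<le> B * (L * r) + W * (B * r)"
            using B W(1)[OF in_S(1)] W(2)
            by (auto intro!: order_trans[OF abs_triangle_ineq] add_mono mult_mono simp: abs_mult)
          then show ?thesis
            by (simp add: algebra_simps)
        next
          case False
          then show ?thesis
            using K(3) r B(3) L0 W(2) by (simp add: h_def)
        qed
        have "AE x in lebesgue. x \<notin> N"
          using N(1) by (intro AE_not_in) (simp add: negligible_iff_null_sets)
        then show "AE x in lebesgue. ((\<lambda>r. (h (x + r *\<^sub>R b) - h x) / r) \<longlongrightarrow> q x) (at_right 0)"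
        proof eventually_elim
          case (elim x)
          show ?case
          proof (cases "x \<in> S")
            case True
            have "(\<phi> has_derivative (\<lambda>h. D x \<bullet> h)) (at x)"
              using t by (simp add: test_function_def)
            from has_derivative_mult[OF this w0d]
            have "(h has_derivative (\<lambda>k. \<phi> x * frechet_derivative w (at x) k + (D x \<bullet> k) * w0 x)) (at x)"
              using True elim by (simp add: h_def[abs_def])
            from has_derivative_imp_directional_limit[OF this, of b]
            show ?thesis
              using True elim b by (simp add: q_def inner_add_left Gb g w0_def mult.commute add.commute)
          next
            case False
            \<comment> \<open>A point outside S has distance at least e from K, so short steps from
              it do not reach K.\<close>
            have "\<forall>\<^sub>F r in at_right 0. (h (x + r *\<^sub>R b) - h x) / r = 0"
              using eventually_at_right_real[OF e(1)]
            proof eventually_elim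
              case (elim r)
              have "x \<notin> K" using False K(2) by auto
              moreover have "x + r *\<^sub>R b \<notin> K"
              proof
                assume "x + r *\<^sub>R b \<in> K"
                moreover have "x \<in> ball (x + r *\<^sub>R b) e"
                  using elim b by (simp add: dist_norm)
                ultimately show False using e(2) False by blast
              qed
              ultimately show ?case using K(3) by (simp add: h_def)
            qed
            then show ?thesis
              using False by (simp add: q_def tendsto_eventually)
          qed
        qed
      qed (use hm e in auto)
      then have "(\<integral>x. indicator S x *\<^sub>R (w x *\<^sub>R D x + \<phi> x *\<^sub>R G x) \<partial>lebesgue) \<bullet> b = 0"
        unfolding q_def using qi by (subst (asm) integral_inner_left) auto
      then have "(\<integral>x. w x *\<^sub>R D x + \<phi> x *\<^sub>R G x \<partial>lebesgue_on S) \<bullet> b = 0"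
        using S(1) by (subst integral_lebesgue_on_eq) auto
      then show ?thesis
        using iw iG by simp
    qed
    then have "(\<integral>x. w x *\<^sub>R D x \<partial>lebesgue_on S) + (\<integral>x. \<phi> x *\<^sub>R G x \<partial>lebesgue_on S) = 0"
      using euclidean_all_zero_iff by blast
    then show "(\<integral>x. w x *\<^sub>R D x \<partial>lebesgue_on S) = - (\<integral>x. \<phi> x *\<^sub>R G x \<partial>lebesgue_on S)"
      by (simp add: eq_neg_iff_add_eq_0)
  qed auto
  then show thesis
    using Gm GB that by blast
qed

subsection \<open>The weighted measure on the cylinder\<close>

lemma lborel_integrable_prod_mult:
  fixes f :: "'a::euclidean_space \<Rightarrow> real" and g :: "'b::euclidean_space \<Rightarrow> real"
  assumes f: "integrable lborel f" and g: "integrable lborel g"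
  shows "integrable lborel (\<lambda>p. f (fst p) * g (snd p))"
    and "(\<integral>p. f (fst p) * g (snd p) \<partial>lborel) = (\<integral>x. f x \<partial>lborel) * (\<integral>y. g y \<partial>lborel)"
proof -
  have i: "integrable (lborel \<Otimes>\<^sub>M lborel) (\<lambda>p. f (fst p) * g (snd p))"
  proof (rule lborel_pair.Fubini_integrable)
    show "(\<lambda>p. f (fst p) * g (snd p)) \<in> borel_measurable (lborel \<Otimes>\<^sub>M lborel)"
      using f g by measurable
    show "integrable lborel (\<lambda>x. \<integral>y. norm (f (fst (x, y)) * g (snd (x, y))) \<partial>lborel)"
      using f g by (simp add: abs_mult)
    show "AE x in lborel. integrable lborel (\<lambda>y. f (fst (x, y)) * g (snd (x, y)))"
      using g by simp
  qed
  then show "integrable lborel (\<lambda>p. f (fst p) * g (snd p))"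
    by (simp add: lborel_prod)
  show "(\<integral>p. f (fst p) * g (snd p) \<partial>lborel) = (\<integral>x. f x \<partial>lborel) * (\<integral>y. g y \<partial>lborel)"
    using lborel_pair.integral_fst'[OF i] by (simp add: lborel_prod)
qed

lemma integrable_powr_interval:
  assumes "- 1 < a" "0 \<le> Y"
  shows "integrable lborel (\<lambda>y::real. indicator {0<..<Y} y * y powr a)"
proof -
  have "(\<lambda>y::real. y powr a) integrable_on {0..Y}"
    using has_integral_powr_from_0[OF assms] by blast
  then have "(\<lambda>y::real. y powr a) absolutely_integrable_on {0..Y}"
    by (rule nonnegative_absolutely_integrable_1) simp
  then have "(\<lambda>y::real. y powr a) absolutely_integrable_on {0<..<Y}"
    by (rule set_integrable_subset) auto
  then have "integrable lebesgue (\<lambda>y::real. indicator {0<..<Y} y * y powr a)"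
    by (simp add: set_integrable_def)
  then show ?thesis
    by (subst (asm) integrable_completion) auto
qed

lemma cyl_open: "open \<Omega> \<Longrightarrow> open (cyl \<Omega> Y)"
  by (simp add: cyl_def open_Times)

lemma cyl_sets: "open \<Omega> \<Longrightarrow> cyl \<Omega> Y \<in> sets lebesgue"
  using cyl_open[of \<Omega> Y] by auto

text \<open>The integral factors into the volume of the domain and a one-dimensional integral. The
  exponent is kept general because both the weight exponent \<open>1 - 2 * s\<close> and its
  negative are used.\<close>

lemma integrable_powr_cyl:
  fixes \<Omega> :: "(real^'n) set"
  assumes "open \<Omega>" "bounded \<Omega>" "0 < Y" "- 1 < a"
  shows "integrable (lebesgue_on (cyl \<Omega> Y)) (\<lambda>p. snd p powr a)"
proof -
  have "emeasure lborel \<Omega> < \<infinity>"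
    using assms(2) emeasure_bounded_finite by blast
  then have "integrable lborel (indicator \<Omega> :: _ \<Rightarrow> real)"
    using assms(1) by (intro integrable_real_indicator) auto
  from lborel_integrable_prod_mult(1)[OF this integrable_powr_interval[OF assms(4), of Y]]
  have "integrable lborel (\<lambda>p::(real^'n) \<times> real. indicator \<Omega> (fst p) * (indicator {0<..<Y} (snd p) * snd p powr a))"
    using assms(3) by simp
  then have "integrable lebesgue (\<lambda>p::(real^'n) \<times> real. indicator \<Omega> (fst p) * (indicator {0<..<Y} (snd p) * snd p powr a))"
    using borel_measurable_integrable by (subst integrable_completion) auto
  moreover have "indicator \<Omega> (fst p) * (indicator {0<..<Y} (snd p) * snd p powr a) = indicator (cyl \<Omega> Y) p *\<^sub>R snd p powr a"
    for p by (auto simp: cyl_def indicator_def mem_Times_iff)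
  ultimately show ?thesis
    using cyl_sets[OF assms(1)] by (subst integrable_lebesgue_on_iff) auto
qed

lemma cyl_weight_measurable: "(\<lambda>p. snd p powr a) \<in> borel_measurable (lebesgue_on (S :: ('a::euclidean_space \<times> real) set))"
proof -
  have "(\<lambda>p. snd p powr a) \<in> borel_measurable ((borel :: 'a measure) \<Otimes>\<^sub>M (borel :: real measure))"
    by measurable
  then show ?thesis
    by (intro measurable_restrict_space1 measurable_completion) (simp add: borel_prod)
qed

lemma sets_cyl_measure [simp]: "sets (cyl_measure \<Omega> s Y) = sets (lebesgue_on (cyl \<Omega> Y))"
  by (simp add: cyl_measure_def)

lemma space_cyl_measure [simp]: "space (cyl_measure \<Omega> s Y) = cyl \<Omega> Y"
  by (simp add: cyl_measure_def)

lemma borel_measurable_cyl_measure: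
  "f \<in> borel_measurable (cyl_measure \<Omega> s Y) \<longleftrightarrow> f \<in> borel_measurable (lebesgue_on (cyl \<Omega> Y))"
  by (simp add: cyl_measure_def)

lemma integrable_cyl_measure_iff:
  fixes f :: "(real^'n) \<times> real \<Rightarrow> 'b::euclidean_space"
  assumes "f \<in> borel_measurable (lebesgue_on (cyl \<Omega> Y))"
  shows "integrable (cyl_measure \<Omega> s Y) f
           \<longleftrightarrow> integrable (lebesgue_on (cyl \<Omega> Y)) (\<lambda>p. (snd p powr (1 - 2 * s)) *\<^sub>R f p)"
  unfolding cyl_measure_def using assms cyl_weight_measurable by (intro integrable_density) auto

lemma integral_cyl_measure:
  fixes f :: "(real^'n) \<times> real \<Rightarrow> 'b::euclidean_space"
  assumes "f \<in> borel_measurable (lebesgue_on (cyl \<Omega> Y))"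
  shows "(\<integral>p. f p \<partial>cyl_measure \<Omega> s Y)
           = (\<integral>p. (snd p powr (1 - 2 * s)) *\<^sub>R f p \<partial>lebesgue_on (cyl \<Omega> Y))"
  unfolding cyl_measure_def using assms cyl_weight_measurable by (intro integral_density) auto

text \<open>The weight is positive on the cylinder, so the weighted and the Lebesgue measure have
  the same null sets. Weak gradients are unique for the latter, while norms and forms use the
  former.\<close>

lemma AE_cyl_measure_iff:
  "(AE p in cyl_measure \<Omega> s Y. P p) \<longleftrightarrow> (AE p in lebesgue_on (cyl \<Omega> Y). P p)"
proof -
  have "(AE p in cyl_measure \<Omega> s Y. P p)
      \<longleftrightarrow> (AE p in lebesgue_on (cyl \<Omega> Y). 0 < ennreal (snd p powr (1 - 2 * s)) \<longrightarrow> P p)"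
    unfolding cyl_measure_def using cyl_weight_measurable by (intro AE_density) simp
  also have "\<dots> \<longleftrightarrow> (AE p in lebesgue_on (cyl \<Omega> Y). P p)"
    by (intro AE_cong) (auto simp: cyl_def)
  finally show ?thesis .
qed

text \<open>The condition s < 1 says that the exponent of the weight exceeds -1. Finiteness makes
  bounded functions square integrable.\<close>

lemma finite_measure_cyl_measure:
  fixes \<Omega> :: "(real^'n) set"
  assumes "open \<Omega>" "bounded \<Omega>" "0 < Y" "s < 1"
  shows "finite_measure (cyl_measure \<Omega> s Y)"
proof -
  have "integrable (cyl_measure \<Omega> s Y) (\<lambda>_. 1::real)"
    using integrable_powr_cyl[OF assms(1-3), of "1 - 2 * s"] assms(4)
    by (subst integrable_cyl_measure_iff) auto
  then have "emeasure (cyl_measure \<Omega> s Y) (space (cyl_measure \<Omega> s Y)) < \<infinity>"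
    by (simp add: integrable_iff_bounded)
  then show ?thesis
    by (intro finite_measureI) auto
qed

text \<open>The dual weight \<open>y\<^sup>-\<^sup>\<alpha>\<close> is integrable as well, since \<open>\<alpha> < 1\<close>.\<close>

lemma cyl_weighted_pairing:
  fixes \<Omega> :: "(real^'n) set"
  assumes "open \<Omega>" "bounded \<Omega>" "0 < Y" "0 < s"
    and \<beta>: "\<beta> \<in> borel_measurable (lebesgue_on (cyl \<Omega> Y))" "\<And>p. \<bar>\<beta> p\<bar> \<le> B"
  obtains C where "0 \<le> C"
    "\<And>u. u \<in> L2 (cyl_measure \<Omega> s Y) \<Longrightarrow> integrable (lebesgue_on (cyl \<Omega> Y)) (\<lambda>p. u p * \<beta> p)"
    "\<And>u. u \<in> L2 (cyl_measure \<Omega> s Y) \<Longrightarrow>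
       \<bar>\<integral>p. u p * \<beta> p \<partial>lebesgue_on (cyl \<Omega> Y)\<bar> \<le> C * l2norm (cyl_measure \<Omega> s Y) u"
proof -
  \<comment> \<open>Dividing \<beta> by the weight turns the unweighted pairing with \<beta> into a
    weighted inner product with \<theta>. Its weighted square is \<beta>^2 times y to the power 2s -
    1, integrable because s > 0.\<close>
  define \<theta> where "\<theta> p = \<beta> p * snd p powr (2 * s - 1)" for p
  have \<theta>m: "\<theta> \<in> borel_measurable (lebesgue_on (cyl \<Omega> Y))"
    unfolding \<theta>_def using \<beta>(1) cyl_weight_measurable by (rule borel_measurable_times)
  have w: "snd p powr (1 - 2 * s) * snd p powr (2 * s - 1) = 1" if "p \<in> cyl \<Omega> Y" for p
    using that by (simp add: cyl_def mem_Times_iff powr_add[symmetric])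
  have "integrable (lebesgue_on (cyl \<Omega> Y)) (\<lambda>p. (\<beta> p)\<^sup>2 *\<^sub>R snd p powr (2 * s - 1))"
  proof (rule integrable_bounded_mult[where B="B\<^sup>2"])
    show "integrable (lebesgue_on (cyl \<Omega> Y)) (\<lambda>p. snd p powr (2 * s - 1))"
      using assms(4) by (intro integrable_powr_cyl assms) auto
    have "\<bar>(\<beta> p)\<^sup>2\<bar> \<le> B\<^sup>2" for p
      using \<beta>(2)[of p] by (metis abs_power2 power2_abs abs_ge_zero power_mono)
    then show "AE p in lebesgue_on (cyl \<Omega> Y). \<bar>(\<beta> p)\<^sup>2\<bar> \<le> B\<^sup>2"
      by simp
  qed (use \<beta>(1) in auto)
  moreover have "(\<beta> p)\<^sup>2 *\<^sub>R snd p powr (2 * s - 1) = snd p powr (1 - 2 * s) *\<^sub>R (norm (\<theta> p))\<^sup>2"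
    if "p \<in> space (lebesgue_on (cyl \<Omega> Y))" for p
  proof -
    have wp: "snd p powr (1 - 2 * s) * snd p powr (2 * s - 1) = 1"
      using w that by simp
    have "snd p powr (1 - 2 * s) *\<^sub>R (norm (\<theta> p))\<^sup>2
        = (\<beta> p)\<^sup>2 * (snd p powr (1 - 2 * s) * snd p powr (2 * s - 1)) * snd p powr (2 * s - 1)"
      by (simp add: \<theta>_def power2_eq_square)
    from this[unfolded wp] show ?thesis by simp
  qed
  ultimately have "integrable (lebesgue_on (cyl \<Omega> Y)) (\<lambda>p. snd p powr (1 - 2 * s) *\<^sub>R (norm (\<theta> p))\<^sup>2)"
    by (subst Bochner_Integration.integrable_cong[OF refl, symmetric]) auto
  then have \<theta>: "\<theta> \<in> L2 (cyl_measure \<Omega> s Y)"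
    using \<theta>m by (simp add: L2_def borel_measurable_cyl_measure integrable_cyl_measure_iff)
  show thesis
  proof (rule that[of "l2norm (cyl_measure \<Omega> s Y) \<theta>"])
    fix u :: "(real^'n) \<times> real \<Rightarrow> real" assume u: "u \<in> L2 (cyl_measure \<Omega> s Y)"
    have um: "u \<in> borel_measurable (lebesgue_on (cyl \<Omega> Y))"
      using u by (simp add: L2_def borel_measurable_cyl_measure)
    have m: "(\<lambda>p. u p \<bullet> \<theta> p) \<in> borel_measurable (lebesgue_on (cyl \<Omega> Y))"
      using um \<theta>m by simp
    have eq: "snd p powr (1 - 2 * s) *\<^sub>R (u p \<bullet> \<theta> p) = u p * \<beta> p"
      if "p \<in> space (lebesgue_on (cyl \<Omega> Y))" for p
    proof -
      have wp: "snd p powr (1 - 2 * s) * snd p powr (2 * s - 1) = 1"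
        using w that by simp
      have "snd p powr (1 - 2 * s) *\<^sub>R (u p \<bullet> \<theta> p)
          = (snd p powr (1 - 2 * s) * snd p powr (2 * s - 1)) * (u p * \<beta> p)"
        by (simp add: \<theta>_def)
      from this[unfolded wp] show ?thesis by simp
    qed
    have "integrable (lebesgue_on (cyl \<Omega> Y)) (\<lambda>p. snd p powr (1 - 2 * s) *\<^sub>R (u p \<bullet> \<theta> p))"
      using L2_inner_integrable[OF u \<theta>] unfolding integrable_cyl_measure_iff[OF m] .
    from iffD1[OF Bochner_Integration.integrable_cong[OF refl eq] this]
    show "integrable (lebesgue_on (cyl \<Omega> Y)) (\<lambda>p. u p * \<beta> p)" .
    have "(\<integral>p. u p * \<beta> p \<partial>lebesgue_on (cyl \<Omega> Y)) = (\<integral>p. u p \<bullet> \<theta> p \<partial>cyl_measure \<Omega> s Y)"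
      unfolding integral_cyl_measure[OF m] by (rule Bochner_Integration.integral_cong[OF refl eq[symmetric]])
    then show "\<bar>\<integral>p. u p * \<beta> p \<partial>lebesgue_on (cyl \<Omega> Y)\<bar>
        \<le> l2norm (cyl_measure \<Omega> s Y) \<theta> * l2norm (cyl_measure \<Omega> s Y) u"
      using l2_Cauchy_Schwarz[OF u \<theta>] by (simp add: mult.commute)
  qed simp
qed

subsection \<open>Uniqueness of traces\<close>

lemma test_function_cyl:
  fixes \<Omega> :: "(real^'n) set"
  assumes t: "test_function \<Omega> \<psi> D"
    and \<rho>: "\<And>y. (\<rho> has_real_derivative \<rho>' y) (at y)" "continuous_on UNIV \<rho>'"
    and J: "compact J" "J \<subseteq> {0<..<Y}" "\<And>y. y \<notin> J \<Longrightarrow> \<rho> y = 0"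
  shows "test_function (cyl \<Omega> Y) (\<lambda>p. \<psi> (fst p) * \<rho> (snd p))
           (\<lambda>p. (\<rho> (snd p) *\<^sub>R D (fst p), \<psi> (fst p) * \<rho>' (snd p)))"
proof -
  obtain K where K: "compact K" "K \<subseteq> \<Omega>" "\<And>x. x \<notin> K \<Longrightarrow> \<psi> x = 0"
    using t unfolding test_function_def by metis
  have c: "continuous_on UNIV \<psi>" "continuous_on UNIV D" "continuous_on UNIV \<rho>"
    using t test_function_continuous[OF t] \<rho>(1)
    by (auto simp: test_function_def intro!: DERIV_continuous_on)
  show ?thesis
    unfolding test_function_def
  proof (intro conjI allI exI[of _ "K \<times> J"] impI)
    fix p :: "(real^'n) \<times> real"
    have "((\<lambda>p. \<psi> (fst p)) has_derivative (\<lambda>h. D (fst p) \<bullet> fst h)) (at p)"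
      by (rule has_derivative_compose[of fst fst p UNIV \<psi>])
         (use t in \<open>auto simp: test_function_def intro!: has_derivative_fst has_derivative_ident\<close>)
    moreover have "((\<lambda>p. \<rho> (snd p)) has_derivative (\<lambda>h. \<rho>' (snd p) * snd h)) (at p)"
      by (rule has_derivative_compose[of snd snd p UNIV \<rho>])
         (use \<rho>(1)[of "snd p"] in \<open>auto simp: has_field_derivative_def intro!: has_derivative_snd has_derivative_ident\<close>)
    ultimately show "((\<lambda>p. \<psi> (fst p) * \<rho> (snd p)) has_derivative
        (\<lambda>h. (\<rho> (snd p) *\<^sub>R D (fst p), \<psi> (fst p) * \<rho>' (snd p)) \<bullet> h)) (at p)"
      by (rule has_derivative_eq_rhs[OF has_derivative_mult]) (auto simp: inner_prod_def fun_eq_iff)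
    show "\<psi> (fst p) * \<rho> (snd p) = 0" if "p \<notin> K \<times> J"
      using that K(3) J(3) by (auto simp: mem_Times_iff)
    show "continuous_on UNIV (\<lambda>p. (\<rho> (snd p) *\<^sub>R D (fst p), \<psi> (fst p) * \<rho>' (snd p)))"
      by (intro continuous_intros continuous_on_compose2[OF c(1)] continuous_on_compose2[OF c(2)]
            continuous_on_compose2[OF c(3)] continuous_on_compose2[OF \<rho>(2)]) auto
  qed (use K J in \<open>auto simp: cyl_def intro!: compact_Times\<close>)
qed

section \<open>Cutoff functions in the extended variable y\<close>

lemma smooth_step_deriv_bounded:
  obtains B where "\<And>t. smooth_step_deriv t \<le> B" "0 \<le> B"
proof -
  have "bounded (smooth_step_deriv ` {0..1})"
    by (intro compact_imp_bounded compact_continuous_image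
          continuous_on_subset[OF continuous_smooth_step_deriv]) auto
  then obtain B where "\<forall>x \<in> smooth_step_deriv ` {0..1}. norm x \<le> B"
    unfolding bounded_iff by blast
  then have B: "\<And>t. t \<in> {0..1} \<Longrightarrow> smooth_step_deriv t \<le> B"
    by (auto simp: abs_le_iff)
  show thesis
  proof (rule that[of "max 0 B"])
    show "smooth_step_deriv t \<le> max 0 B" for t
      using B[of t] smooth_step_deriv_eq_0[of t] by (cases "0 \<le> t \<and> t \<le> 1") auto
  qed simp
qed

text \<open>The argument is at least 1 for y \<le> Y/3 and at most 0 for y \<ge> 2Y/3: the function
  is 1 near the base and vanishes near the lid, so integration by parts leaves no term at y =
  Y.\<close>

definition cutoff :: "real \<Rightarrow> real \<Rightarrow> real" where
  "cutoff Y y = smooth_step (2 - 3 * y / Y)"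

definition cutoff_deriv :: "real \<Rightarrow> real \<Rightarrow> real" where
  "cutoff_deriv Y y = smooth_step_deriv (2 - 3 * y / Y) * (- 3 / Y)"

lemma has_real_derivative_cutoff: "(cutoff Y has_real_derivative cutoff_deriv Y y) (at y)"
proof -
  have "((\<lambda>y. 2 - (3 / Y) * y) has_real_derivative 0 - 3 / Y) (at y)"
    by (intro DERIV_diff DERIV_const DERIV_cmult_Id)
  then have "((\<lambda>y. 2 - 3 * y / Y) has_real_derivative - 3 / Y) (at y)"
    by simp
  then show ?thesis
    unfolding cutoff_def cutoff_deriv_def by (rule DERIV_chain2[OF has_real_derivative_smooth_step])
qed

lemma continuous_cutoff: "continuous_on UNIV (cutoff Y)"
  by (rule DERIV_continuous_on[OF has_field_derivative_at_within[OF has_real_derivative_cutoff]])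

lemma continuous_cutoff_deriv: "continuous_on UNIV (cutoff_deriv Y)"
  unfolding cutoff_deriv_def divide_inverse
  by (intro continuous_intros continuous_on_compose2[OF continuous_smooth_step_deriv]) auto

lemma cutoff_near_0:
  assumes "0 < Y" "y \<le> Y / 3"
  shows "cutoff Y y = 1" "cutoff_deriv Y y = 0"
proof -
  have "1 \<le> 2 - 3 * y / Y"
    using assms by (simp add: field_simps)
  then show "cutoff Y y = 1" "cutoff_deriv Y y = 0"
    by (simp_all add: cutoff_def cutoff_deriv_def smooth_step_eq_1 smooth_step_deriv_eq_0)
qed

lemma cutoff_eq_0:
  assumes "0 < Y" "2 * Y / 3 \<le> y"
  shows "cutoff Y y = 0"
  unfolding cutoff_def using assms by (intro smooth_step_eq_0) (simp add: field_simps)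

text \<open>It rises from 0 to 1 between 1/n and 2/n. Vanishing near 0 makes products with
  \<open>cutoff\<close> compactly supported in the open interval, while the derivative is an
  approximate identity at the base.\<close>

definition ramp :: "nat \<Rightarrow> real \<Rightarrow> real" where
  "ramp n y = smooth_step (real n * y - 1)"

definition ramp_deriv :: "nat \<Rightarrow> real \<Rightarrow> real" where
  "ramp_deriv n y = smooth_step_deriv (real n * y - 1) * real n"

lemma has_real_derivative_ramp: "(ramp n has_real_derivative ramp_deriv n y) (at y)"
  unfolding ramp_def ramp_deriv_def
  by (rule DERIV_chain2[OF has_real_derivative_smooth_step]) (auto intro!: derivative_eq_intros)

lemma continuous_ramp: "continuous_on UNIV (ramp n)"
  by (rule DERIV_continuous_on[OF has_field_derivative_at_within[OF has_real_derivative_ramp]])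

lemma continuous_ramp_deriv: "continuous_on UNIV (ramp_deriv n)"
  unfolding ramp_deriv_def
  by (intro continuous_intros continuous_on_compose2[OF continuous_smooth_step_deriv]) auto

lemma ramp_deriv_nonneg: "0 \<le> ramp_deriv n y"
  by (simp add: ramp_deriv_def smooth_step_deriv_nonneg)

lemma ramp_deriv_eq_0: "0 < n \<Longrightarrow> y \<le> 1 / real n \<or> 2 / real n \<le> y \<Longrightarrow> ramp_deriv n y = 0"
  unfolding ramp_deriv_def by (subst smooth_step_deriv_eq_0) (auto simp: field_simps)

lemma ramp_eq_0: "0 < n \<Longrightarrow> y \<le> 1 / real n \<Longrightarrow> ramp n y = 0"
  unfolding ramp_def by (intro smooth_step_eq_0) (auto simp: field_simps)

lemma ramp_eq_1: "0 < n \<Longrightarrow> 2 / real n \<le> y \<Longrightarrow> ramp n y = 1"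
  unfolding ramp_def by (intro smooth_step_eq_1) (auto simp: field_simps)

lemma has_bochner_integral_ramp_deriv:
  assumes "0 < n"
  shows "has_bochner_integral lborel (ramp_deriv n) 1"
proof -
  have "has_bochner_integral lborel (\<lambda>y. ramp_deriv n y * indicator {1 / real n..2 / real n} y)
      (ramp n (2 / real n) - ramp n (1 / real n))"
  proof (rule has_bochner_integral_FTC_Icc_real)
    show "isCont (ramp_deriv n) x" for x
      using continuous_ramp_deriv[of n] by (simp add: continuous_on_eq_continuous_at)
  qed (use assms in \<open>auto simp: has_real_derivative_ramp divide_right_mono\<close>)
  moreover have "ramp_deriv n y * indicator {1 / real n..2 / real n} y = ramp_deriv n y" for y
    using ramp_deriv_eq_0[OF assms, of y] by (cases "y \<le> 1 / real n \<or> 2 / real n \<le> y") (auto simp: indicator_def)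
  ultimately show ?thesis
    using assms by (simp add: ramp_eq_0 ramp_eq_1)
qed

lemma L2_snd:
  fixes G :: "'a \<Rightarrow> 'b::euclidean_space \<times> real"
  assumes "G \<in> L2 M"
  shows "(\<lambda>p. snd (G p)) \<in> L2 M" "l2norm M (\<lambda>p. snd (G p)) \<le> l2norm M G"
proof -
  have G: "G \<in> borel_measurable M" "integrable M (\<lambda>x. (norm (G x))\<^sup>2)"
    using assms by (auto simp: L2_def)
  have m: "(\<lambda>p. snd (G p)) \<in> borel_measurable M"
    by (rule borel_measurable_continuous_on[OF continuous_on_snd[OF continuous_on_id] G(1)])
  have le: "(norm (snd (G p)))\<^sup>2 \<le> (norm (G p))\<^sup>2" for p
    using norm_snd_le[of "snd (G p)" "fst (G p)"] by (intro power_mono) auto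
  have i: "integrable M (\<lambda>p. (norm (snd (G p)))\<^sup>2)"
    by (rule Bochner_Integration.integrable_bound[OF G(2)]) (use m le in auto)
  then show "(\<lambda>p. snd (G p)) \<in> L2 M"
    using m by (simp add: L2_def)
  show "l2norm M (\<lambda>p. snd (G p)) \<le> l2norm M G"
    unfolding l2norm_def using i G(2) le by (intro real_sqrt_le_mono integral_mono) auto
qed

text \<open>Membership in \<open>H1\<close> provides some square integrable gradient; by uniqueness
  the chosen one agrees with it almost everywhere.\<close>

lemma H1_weak_grad_L2:
  fixes \<Omega> :: "(real^'n) set"
  assumes "open \<Omega>" "w \<in> H1 (cyl_measure \<Omega> s Y) (cyl \<Omega> Y)"
  shows "w \<in> L2 (cyl_measure \<Omega> s Y)" "has_weak_grad (cyl \<Omega> Y) w (weak_grad (cyl \<Omega> Y) w)"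
    "weak_grad (cyl \<Omega> Y) w \<in> L2 (cyl_measure \<Omega> s Y)"
proof -
  obtain G where G: "G \<in> L2 (cyl_measure \<Omega> s Y)" "has_weak_grad (cyl \<Omega> Y) w G"
    using assms(2) by (auto simp: H1_def)
  show "w \<in> L2 (cyl_measure \<Omega> s Y)"
    using assms(2) by (simp add: H1_def)
  show "has_weak_grad (cyl \<Omega> Y) w (weak_grad (cyl \<Omega> Y) w)"
    using G(2) by (rule has_weak_grad_weak_grad)
  show "weak_grad (cyl \<Omega> Y) w \<in> L2 (cyl_measure \<Omega> s Y)"
  proof (rule L2_cong_AE[OF G(1)])
    show "weak_grad (cyl \<Omega> Y) w \<in> borel_measurable (cyl_measure \<Omega> s Y)"
      using weak_grad_measurable[OF cyl_open[OF assms(1)] G(2)] by (simp add: borel_measurable_cyl_measure)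
    show "AE p in cyl_measure \<Omega> s Y. G p = weak_grad (cyl \<Omega> Y) w p"
      unfolding AE_cyl_measure_iff using weak_grad_AE_eq[OF cyl_open[OF assms(1)] G(2)]
      by eventually_elim simp
  qed
qed

text \<open>An approximate identity in \<open>y\<close> concentrating at \<open>0\<close> recovers the boundary values.\<close>

lemma ramp_deriv_tendsto_boundary_value:
  fixes \<Omega> :: "(real^'n) set"
  assumes \<Omega>: "open \<Omega>" "bounded \<Omega>" and Y: "0 < Y" and s: "0 < s"
    and t: "test_function \<Omega> \<psi> D"
    and v: "v \<in> L2 (cyl_measure \<Omega> s Y)" "continuous_on (closure (cyl \<Omega> Y)) v"
  shows "(\<lambda>n. \<integral>p. v p * (\<psi> (fst p) * ramp_deriv n (snd p)) \<partial>lebesgue_on (cyl \<Omega> Y))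
           \<longlonglongrightarrow> (\<integral>x. v (x, 0) * \<psi> x \<partial>lebesgue_on \<Omega>)"
proof (cases "\<Omega> = {}")
  case True
  then show ?thesis by (simp add: cyl_def)
next
  case ne: False
  define I where "I n = (\<integral>p. v p * (\<psi> (fst p) * ramp_deriv n (snd p)) \<partial>lebesgue_on (cyl \<Omega> Y))" for n
  define f where "f x = v (x, 0) * \<psi> x" for x
  have clos: "closure (cyl \<Omega> Y) = closure \<Omega> \<times> {0..Y}"
    using Y by (simp add: cyl_def closure_Times)
  have comp: "compact (closure (cyl \<Omega> Y))"
    unfolding clos using \<Omega>(2) by (intro compact_Times) (auto simp: compact_closure)
  obtain B where B: "\<And>x. \<bar>\<psi> x\<bar> \<le> B" "0 \<le> B"
    by (rule test_function_bounded[OF t]) (rule that)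
  have \<psi>0: "\<psi> x = 0" if "x \<notin> \<Omega>" for x
    using t that unfolding test_function_def by blast
  have c\<psi>: "continuous_on A \<psi>" for A
    by (rule test_function_continuous[OF t])
  obtain W where W: "\<And>p. p \<in> closure (cyl \<Omega> Y) \<Longrightarrow> \<bar>v p\<bar> \<le> W"
    using compact_imp_bounded[OF compact_continuous_image[OF v(2) comp]] unfolding bounded_iff by auto
  have "emeasure lborel \<Omega> < \<infinity>"
    using \<Omega>(2) emeasure_bounded_finite by blast
  then have i1: "integrable lborel (\<lambda>x. c * indicator \<Omega> x :: real)" for c
    using \<Omega>(1) by (intro integrable_mult_right integrable_real_indicator) auto
  have "continuous_on \<Omega> f"
    unfolding f_def
    by (intro continuous_intros c\<psi> continuous_on_compose2[OF v(2)])
       (use Y closure_subset in \<open>auto simp: clos\<close>)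
  then have "(\<lambda>x. indicator \<Omega> x *\<^sub>R f x) \<in> borel_measurable borel"
    using \<Omega>(1) by (intro borel_measurable_continuous_on_indicator) auto
  moreover have "(\<lambda>x. indicator \<Omega> x *\<^sub>R f x) = f"
    using \<psi>0 by (auto simp: f_def indicator_def fun_eq_iff)
  ultimately have fm: "f \<in> borel_measurable borel" by simp
  have fi: "integrable lborel f"
  proof (rule Bochner_Integration.integrable_bound[OF i1[of "W * B"]])
    have "norm (f x) \<le> norm (W * B * indicator \<Omega> x)" for x
    proof (cases "x \<in> \<Omega>")
      case True
      then have "(x, 0) \<in> closure (cyl \<Omega> Y)"
        using Y closure_subset by (auto simp: clos)
      from W[OF this] B(1)[of x] have "\<bar>v (x, 0)\<bar> * \<bar>\<psi> x\<bar> \<le> W * B"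
        by (intro mult_mono) auto
      also have "\<dots> \<le> \<bar>W * B\<bar>" by simp
      finally show ?thesis using True by (simp add: f_def abs_mult)
    qed (simp add: f_def \<psi>0)
    then show "AE x in lborel. norm (f x) \<le> norm (W * B * indicator \<Omega> x)" by simp
  qed (use fm in auto)
  have \<psi>m: "\<psi> \<in> borel_measurable borel"
    using c\<psi> by (rule borel_measurable_continuous_onI)
  have \<psi>i: "integrable lborel (\<lambda>x. \<bar>\<psi> x\<bar>)"
  proof (rule Bochner_Integration.integrable_bound[OF i1[of B]])
    have "norm \<bar>\<psi> x\<bar> \<le> norm (B * indicator \<Omega> x)" for x
      using B(1)[of x] \<psi>0[of x] by (cases "x \<in> \<Omega>") auto
    then show "AE x in lborel. norm \<bar>\<psi> x\<bar> \<le> norm (B * indicator \<Omega> x)" by simp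
  qed (use \<psi>m in auto)
  \<comment> \<open>Once 2/n \<le> Y, the layer carrying the unit mass of
    \<open>ramp_deriv n\<close> lies inside the cylinder, so integrating out y returns the integral
    of g.\<close>
  have product: "integrable (lebesgue_on (cyl \<Omega> Y)) (\<lambda>p. g (fst p) * ramp_deriv n (snd p))
      \<and> (\<integral>p. g (fst p) * ramp_deriv n (snd p) \<partial>lebesgue_on (cyl \<Omega> Y)) = (\<integral>x. g x \<partial>lborel)"
    if g: "integrable lborel g" "\<And>x. x \<notin> \<Omega> \<Longrightarrow> g x = 0" and n: "0 < n" "2 / real n \<le> Y" for g n
  proof -
    have l: "integrable lborel (ramp_deriv n)" "(\<integral>y. ramp_deriv n y \<partial>lborel) = 1"
      using has_bochner_integral_ramp_deriv[OF n(1)] by (auto simp: has_bochner_integral_iff)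
    note pr = lborel_integrable_prod_mult[OF g(1) l(1)]
    have m: "(\<lambda>p. g (fst p) * ramp_deriv n (snd p)) \<in> borel_measurable lborel"
      using pr(1) by (rule borel_measurable_integrable)
    have 1: "0 < snd p \<and> snd p < Y" if "ramp_deriv n (snd p) \<noteq> 0" for p :: "(real^'n) \<times> real"
    proof -
      have "1 / real n < snd p \<and> snd p < 2 / real n"
        using ramp_deriv_eq_0[OF n(1), of "snd p"] that by force
      moreover have "0 < 1 / real n" using n(1) by simp
      ultimately show ?thesis using n(2) by linarith
    qed
    have eq: "indicator (cyl \<Omega> Y) p *\<^sub>R (g (fst p) * ramp_deriv n (snd p)) = g (fst p) * ramp_deriv n (snd p)" for p
      using 1[of p] g(2)[of "fst p"] by (auto simp: cyl_def indicator_def mem_Times_iff)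
    show ?thesis
      unfolding integrable_lebesgue_on_iff[OF cyl_sets[OF \<Omega>(1)]] integral_lebesgue_on_eq[OF cyl_sets[OF \<Omega>(1)]] eq
        integrable_completion[OF m] integral_completion[OF m]
      using pr l(2) by simp
  qed
  have fI: "(\<integral>x. f x \<partial>lborel) = (\<integral>x. f x \<partial>lebesgue_on \<Omega>)"
  proof -
    have eq: "indicator \<Omega> x *\<^sub>R f x = f x" for x
      using \<psi>0 by (auto simp: f_def indicator_def)
    have "\<Omega> \<in> sets lebesgue"
      using \<Omega>(1) by simp
    from integral_lebesgue_on_eq[OF this, of f, unfolded eq] show ?thesis
      using fm by (simp add: integral_completion)
  qed
  define a where "a = (\<integral>x. \<bar>\<psi> x\<bar> \<partial>lborel)"
  have a0: "0 \<le> a" unfolding a_def by simp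
  have "I \<longlonglongrightarrow> (\<integral>x. f x \<partial>lborel)"
  proof (rule LIMSEQ_I)
    fix e :: real assume e: "0 < e"
    \<comment> \<open>Adding 1 avoids division by zero when a = 0, and the factor 2 makes the
      inequality strict.\<close>
    define e' where "e' = e / (2 * (a + 1))"
    have e': "0 < e'" "e' * a < e"
      using e a0 by (auto simp: e'_def field_simps intro: add_nonneg_pos)
    \<comment> \<open>Uniform continuity allows v p to be replaced by its value at the foot point
      (fst p, 0), with error e', on the whole thin layer.\<close>
    have "uniformly_continuous_on (closure (cyl \<Omega> Y)) v"
      using v(2) comp by (rule compact_uniformly_continuous)
    then obtain d where d: "0 < d"
      "\<And>p q. p \<in> closure (cyl \<Omega> Y) \<Longrightarrow> q \<in> closure (cyl \<Omega> Y) \<Longrightarrow> dist p q < d \<Longrightarrow> dist (v p) (v q) < e'"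
      using e'(1) unfolding uniformly_continuous_on_def by meson
    \<comment> \<open>For n \<ge> n0 the layer below 2/n fits into the cylinder and is thinner than
      d.\<close>
    obtain n0 :: nat where n0: "2 / min d Y < real n0"
      using reals_Archimedean2 by blast
    have pos: "0 < 2 / min d Y" using d(1) Y by simp
    show "\<exists>n0. \<forall>n\<ge>n0. norm (I n - (\<integral>x. f x \<partial>lborel)) < e"
    proof (intro exI[of _ n0] allI impI)
      fix n assume n: "n0 \<le> n"
      then have big: "2 / min d Y < real n" using n0 by linarith
      then have "0 < real n" using pos by linarith
      moreover from this have "2 / real n < min d Y"
        using big d(1) Y by (simp add: divide_less_eq mult.commute del: min_less_iff_conj)
      ultimately have n': "0 < n" "2 / real n < d" "2 / real n < Y"
        by auto
      obtain Bl where Bl: "\<And>t. smooth_step_deriv t \<le> Bl" "0 \<le> Bl"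
        by (rule smooth_step_deriv_bounded) (rule that)
      have iv: "integrable (lebesgue_on (cyl \<Omega> Y)) (\<lambda>p. v p * (\<psi> (fst p) * ramp_deriv n (snd p)))"
      proof (rule cyl_weighted_pairing[OF \<Omega> Y s])
        show "(\<lambda>p. \<psi> (fst p) * ramp_deriv n (snd p)) \<in> borel_measurable (lebesgue_on (cyl \<Omega> Y))"
          by (intro continuous_imp_lebesgue_on_measurable continuous_intros continuous_on_compose2[OF c\<psi>]
                continuous_on_compose2[OF continuous_ramp_deriv]) auto
        show "\<bar>\<psi> (fst p) * ramp_deriv n (snd p)\<bar> \<le> B * (Bl * real n)" for p
          unfolding abs_mult using B Bl(1) ramp_deriv_nonneg[of n "snd p"]
          by (intro mult_mono) (auto simp: ramp_deriv_def intro!: mult_right_mono)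
      qed (use v(1) in blast)
      have if': "integrable (lebesgue_on (cyl \<Omega> Y)) (\<lambda>p. f (fst p) * ramp_deriv n (snd p))"
        "(\<integral>p. f (fst p) * ramp_deriv n (snd p) \<partial>lebesgue_on (cyl \<Omega> Y)) = (\<integral>x. f x \<partial>lborel)"
        using product[OF fi _ n'(1)] n'(3) \<psi>0 by (auto simp: f_def)
      have ia: "integrable (lebesgue_on (cyl \<Omega> Y)) (\<lambda>p. \<bar>\<psi> (fst p)\<bar> * ramp_deriv n (snd p))"
        "(\<integral>p. \<bar>\<psi> (fst p)\<bar> * ramp_deriv n (snd p) \<partial>lebesgue_on (cyl \<Omega> Y)) = a"
        using product[OF \<psi>i _ n'(1)] n'(3) \<psi>0 by (auto simp: a_def)
      have bound: "norm (v p * (\<psi> (fst p) * ramp_deriv n (snd p)) - f (fst p) * ramp_deriv n (snd p))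
          \<le> e' * (\<bar>\<psi> (fst p)\<bar> * ramp_deriv n (snd p))" if p: "p \<in> cyl \<Omega> Y" for p
      proof (cases "2 / real n \<le> snd p")
        case True
        then show ?thesis using ramp_deriv_eq_0[OF n'(1), of "snd p"] by simp
      next
        case False
        have "p \<in> closure (cyl \<Omega> Y)" "(fst p, 0) \<in> closure (cyl \<Omega> Y)"
          using p closure_subset[of \<Omega>] Y unfolding clos by (auto simp: cyl_def mem_Times_iff)
        moreover have "dist p (fst p, 0) < d"
          using p False n'(2) by (auto simp: dist_prod_def cyl_def mem_Times_iff dist_real_def)
        ultimately have "\<bar>v p - v (fst p, 0)\<bar> \<le> e'"
          using d(2)[of p "(fst p, 0)"] by (simp add: dist_real_def)
        then have "\<bar>v p - v (fst p, 0)\<bar> * (\<bar>\<psi> (fst p)\<bar> * ramp_deriv n (snd p))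
            \<le> e' * (\<bar>\<psi> (fst p)\<bar> * ramp_deriv n (snd p))"
          by (intro mult_right_mono mult_nonneg_nonneg) (auto simp: ramp_deriv_nonneg)
        moreover have "v p * (\<psi> (fst p) * ramp_deriv n (snd p)) - f (fst p) * ramp_deriv n (snd p)
            = (v p - v (fst p, 0)) * (\<psi> (fst p) * ramp_deriv n (snd p))"
          by (simp add: f_def algebra_simps)
        ultimately show ?thesis
          by (simp add: abs_mult ramp_deriv_nonneg)
      qed
      have "norm (I n - (\<integral>x. f x \<partial>lborel))
          = norm (\<integral>p. v p * (\<psi> (fst p) * ramp_deriv n (snd p)) - f (fst p) * ramp_deriv n (snd p) \<partial>lebesgue_on (cyl \<Omega> Y))"
        unfolding I_def if'(2)[symmetric] using iv if'(1) by simp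
      also have "\<dots> \<le> (\<integral>p. e' * (\<bar>\<psi> (fst p)\<bar> * ramp_deriv n (snd p)) \<partial>lebesgue_on (cyl \<Omega> Y))"
        by (rule Bochner_Integration.integral_norm_bound_integral) (use iv if'(1) ia(1) bound in auto)
      also have "\<dots> = e' * a"
        using ia by simp
      finally show "norm (I n - (\<integral>x. f x \<partial>lborel)) < e"
        using e'(2) by linarith
    qed
  qed
  then have "I \<longlonglongrightarrow> (\<integral>x. f x \<partial>lebesgue_on \<Omega>)"
    unfolding fI .
  then show ?thesis
    unfolding I_def f_def .
qed

text \<open>The transition regions are disjoint: below Y/3 the cutoff is 1, and above 2/n the ramp
  is 1. Hence the product rule collapses to a sum.\<close>

lemma has_real_derivative_cutoff_ramp:
  assumes "0 < Y" "0 < n" "2 / real n \<le> Y / 3"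
  shows "((\<lambda>y. cutoff Y y * ramp n y) has_real_derivative cutoff_deriv Y y + ramp_deriv n y) (at y)"
proof -
  have "cutoff_deriv Y y * ramp n y + ramp_deriv n y * cutoff Y y = cutoff_deriv Y y + ramp_deriv n y"
  proof (cases "y \<le> Y / 3")
    case True
    then show ?thesis using cutoff_near_0[OF assms(1)] by simp
  next
    case False
    then show ?thesis using assms ramp_eq_1[of n y] ramp_deriv_eq_0[of n y] by simp
  qed
  then show ?thesis
    using DERIV_mult[OF has_real_derivative_cutoff[of Y y] has_real_derivative_ramp[of n y]] by simp
qed

text \<open>The definition of the weak gradient is tested with \<open>\<psi>\<close> times
  \<open>cutoff\<close> times \<open>ramp n\<close>. As n grows, the term with
  \<open>ramp_deriv\<close> tends to the boundary pairing, and in the gradient term the ramp tends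
  to 1 under dominated convergence.\<close>

lemma trace_duality:
  fixes \<Omega> :: "(real^'n) set"
  assumes \<Omega>: "open \<Omega>" "bounded \<Omega>" and Y: "0 < Y" and s: "0 < s"
    and t: "test_function \<Omega> \<psi> D"
    and v: "v \<in> H1 (cyl_measure \<Omega> s Y) (cyl \<Omega> Y)" "continuous_on (closure (cyl \<Omega> Y)) v"
  shows "(\<integral>x. v (x, 0) * \<psi> x \<partial>lebesgue_on \<Omega>)
    = - (\<integral>p. snd (weak_grad (cyl \<Omega> Y) v p) * (\<psi> (fst p) * cutoff Y (snd p)) \<partial>lebesgue_on (cyl \<Omega> Y))
      - (\<integral>p. v p * (\<psi> (fst p) * cutoff_deriv Y (snd p)) \<partial>lebesgue_on (cyl \<Omega> Y))"
proof -
  define G where "G = weak_grad (cyl \<Omega> Y) v"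
  define M where "M = lebesgue_on (cyl \<Omega> Y)"
  note vG = H1_weak_grad_L2[OF \<Omega>(1) v(1), folded G_def]
  note Gs = L2_snd(1)[OF vG(3)]
  have o: "open (cyl \<Omega> Y)" by (rule cyl_open[OF \<Omega>(1)])
  obtain B where B: "\<And>x. \<bar>\<psi> x\<bar> \<le> B" "0 \<le> B"
    by (rule test_function_bounded[OF t]) (rule that)
  obtain Bl where Bl: "\<And>t. smooth_step_deriv t \<le> Bl" "0 \<le> Bl"
    by (rule smooth_step_deriv_bounded) (rule that)
  have c\<psi>: "continuous_on A \<psi>" for A
    by (rule test_function_continuous[OF t])
  have int: "integrable M (\<lambda>p. u p * (\<psi> (fst p) * g (snd p)))"
    if u: "u \<in> L2 (cyl_measure \<Omega> s Y)" and g: "continuous_on UNIV g" "\<And>y. \<bar>g y\<bar> \<le> C" for u g C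
    unfolding M_def
  proof (rule cyl_weighted_pairing[OF \<Omega> Y s])
    show "(\<lambda>p. \<psi> (fst p) * g (snd p)) \<in> borel_measurable (lebesgue_on (cyl \<Omega> Y))"
      by (intro continuous_imp_lebesgue_on_measurable continuous_intros continuous_on_compose2[OF c\<psi>]
            continuous_on_compose2[OF g(1)]) auto
    show "\<bar>\<psi> (fst p) * g (snd p)\<bar> \<le> B * C" for p
      unfolding abs_mult using B g(2) by (intro mult_mono) auto
  qed (use u in blast)
  have cl: "\<bar>cutoff Y y * ramp n y\<bar> \<le> 1" for n y
    using smooth_step_bounds by (auto simp: cutoff_def ramp_def abs_mult intro!: mult_le_one)
  have cd: "\<bar>cutoff_deriv Y y\<bar> \<le> Bl * (3 / Y)" for y
    using Bl(1) smooth_step_deriv_nonneg Y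
    by (auto simp: cutoff_deriv_def abs_mult intro!: divide_right_mono)
  have ld: "\<bar>ramp_deriv n y\<bar> \<le> Bl * real n" for n y
    using Bl(1) ramp_deriv_nonneg[of n y] by (auto simp: ramp_deriv_def intro!: mult_right_mono)
  have id: "integrable M (\<lambda>p. v p * (\<psi> (fst p) * cutoff_deriv Y (snd p)))"
    by (rule int[OF vG(1) continuous_cutoff_deriv cd])
  have il: "integrable M (\<lambda>p. v p * (\<psi> (fst p) * ramp_deriv n (snd p)))" for n
    by (rule int[OF vG(1) continuous_ramp_deriv ld])
  have step: "(\<integral>p. v p * (\<psi> (fst p) * ramp_deriv n (snd p)) \<partial>M)
      = - (\<integral>p. snd (G p) * (\<psi> (fst p) * (cutoff Y (snd p) * ramp n (snd p))) \<partial>M)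
        - (\<integral>p. v p * (\<psi> (fst p) * cutoff_deriv Y (snd p)) \<partial>M)"
    if n: "0 < n" "2 / real n \<le> Y / 3" for n
  proof -
    let ?D = "\<lambda>p. ((cutoff Y (snd p) * ramp n (snd p)) *\<^sub>R D (fst p),
                    \<psi> (fst p) * (cutoff_deriv Y (snd p) + ramp_deriv n (snd p)))"
    have tc: "test_function (cyl \<Omega> Y) (\<lambda>p. \<psi> (fst p) * (cutoff Y (snd p) * ramp n (snd p))) ?D"
    proof (rule test_function_cyl[OF t has_real_derivative_cutoff_ramp[OF Y n]])
      show "continuous_on UNIV (\<lambda>y. cutoff_deriv Y y + ramp_deriv n y)"
        by (intro continuous_on_add continuous_cutoff_deriv continuous_ramp_deriv)
      show "{1 / real n..2 * Y / 3} \<subseteq> {0<..<Y}"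
      proof -
        have "0 < 1 / real n" using n(1) by simp
        then have "0 < y \<and> y < Y" if "1 / real n \<le> y" "y \<le> 2 * Y / 3" for y
          using that Y by linarith
        then show ?thesis by auto
      qed
      show "cutoff Y y * ramp n y = 0" if "y \<notin> {1 / real n..2 * Y / 3}" for y
        using that ramp_eq_0[OF n(1), of y] cutoff_eq_0[OF Y, of y] by auto
    qed simp
    have i1: "integrable M (\<lambda>p. v p *\<^sub>R ?D p)"
      unfolding M_def by (rule test_function_grad_integrable[OF o has_weak_grad_locally_integrable(1)[OF vG(2)] tc])
    have i2: "integrable M (\<lambda>p. (\<psi> (fst p) * (cutoff Y (snd p) * ramp n (snd p))) *\<^sub>R G p)"
      unfolding M_def by (rule test_function_mult_integrable[OF o has_weak_grad_locally_integrable(2)[OF vG(2)] tc])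
    have "(\<integral>p. v p *\<^sub>R ?D p \<partial>M) = - (\<integral>p. (\<psi> (fst p) * (cutoff Y (snd p) * ramp n (snd p))) *\<^sub>R G p \<partial>M)"
      using vG(2) tc unfolding has_weak_grad_def M_def by blast
    \<comment> \<open>Only the y-component of the vector identity is kept; it contains the
      derivative of the ramp.\<close>
    then have "snd (\<integral>p. v p *\<^sub>R ?D p \<partial>M) = - snd (\<integral>p. (\<psi> (fst p) * (cutoff Y (snd p) * ramp n (snd p))) *\<^sub>R G p \<partial>M)"
      by simp
    then have "(\<integral>p. snd (v p *\<^sub>R ?D p) \<partial>M)
        = - (\<integral>p. snd ((\<psi> (fst p) * (cutoff Y (snd p) * ramp n (snd p))) *\<^sub>R G p) \<partial>M)"
      by (simp only: integral_bounded_linear[OF bounded_linear_snd i1] integral_bounded_linear[OF bounded_linear_snd i2])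
    moreover have "(\<integral>p. snd (v p *\<^sub>R ?D p) \<partial>M)
        = (\<integral>p. v p * (\<psi> (fst p) * cutoff_deriv Y (snd p)) + v p * (\<psi> (fst p) * ramp_deriv n (snd p)) \<partial>M)"
      by (simp add: algebra_simps)
    moreover have "\<dots> = (\<integral>p. v p * (\<psi> (fst p) * cutoff_deriv Y (snd p)) \<partial>M)
        + (\<integral>p. v p * (\<psi> (fst p) * ramp_deriv n (snd p)) \<partial>M)"
      using id il by simp
    moreover have "(\<integral>p. snd ((\<psi> (fst p) * (cutoff Y (snd p) * ramp n (snd p))) *\<^sub>R G p) \<partial>M)
        = (\<integral>p. snd (G p) * (\<psi> (fst p) * (cutoff Y (snd p) * ramp n (snd p))) \<partial>M)"
      by (simp add: mult.commute)
    ultimately show ?thesis by linarith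
  qed
  have ev: "\<forall>\<^sub>F n in sequentially. 0 < n \<and> 2 / real n \<le> e" if "0 < e" for e
  proof -
    have "(\<lambda>n. 2 / real n) \<longlonglongrightarrow> 0" by (rule lim_const_over_n)
    then have "\<forall>\<^sub>F n in sequentially. 2 / real n < e"
      using that by (rule order_tendstoD)
    then show ?thesis
      using eventually_gt_at_top[of 0] by eventually_elim auto
  qed
  have "(\<lambda>n. \<integral>p. snd (G p) * (\<psi> (fst p) * (cutoff Y (snd p) * ramp n (snd p))) \<partial>M)
      \<longlonglongrightarrow> (\<integral>p. snd (G p) * (\<psi> (fst p) * cutoff Y (snd p)) \<partial>M)"
  proof (rule integral_dominated_convergence[where w="\<lambda>p. norm (snd (G p) * (\<psi> (fst p) * cutoff Y (snd p)))"])
    have ic: "integrable M (\<lambda>p. snd (G p) * (\<psi> (fst p) * cutoff Y (snd p)))"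
      by (rule int[OF Gs continuous_cutoff, where C=1])
         (use smooth_step_bounds in \<open>auto simp: cutoff_def\<close>)
    then show "(\<lambda>p. snd (G p) * (\<psi> (fst p) * cutoff Y (snd p))) \<in> borel_measurable M"
      "integrable M (\<lambda>p. norm (snd (G p) * (\<psi> (fst p) * cutoff Y (snd p))))"
      by auto
    show "(\<lambda>p. snd (G p) * (\<psi> (fst p) * (cutoff Y (snd p) * ramp n (snd p)))) \<in> borel_measurable M" for n
      by (rule borel_measurable_integrable[OF int[OF Gs continuous_on_mult[OF continuous_cutoff continuous_ramp] cl]])
    have "norm (snd (G p) * (\<psi> (fst p) * (cutoff Y (snd p) * ramp n (snd p))))
        \<le> norm (snd (G p) * (\<psi> (fst p) * cutoff Y (snd p)))" for n p
      using smooth_step_bounds[of "real n * snd p - 1"]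
      by (simp add: abs_mult ramp_def mult.assoc[symmetric] mult_left_le)
    then show "AE p in M. norm (snd (G p) * (\<psi> (fst p) * (cutoff Y (snd p) * ramp n (snd p))))
        \<le> norm (snd (G p) * (\<psi> (fst p) * cutoff Y (snd p)))" for n
      by simp
    show "AE p in M. (\<lambda>n. snd (G p) * (\<psi> (fst p) * (cutoff Y (snd p) * ramp n (snd p))))
        \<longlonglongrightarrow> snd (G p) * (\<psi> (fst p) * cutoff Y (snd p))"
    proof (rule AE_I2)
      fix p assume "p \<in> space M"
      then have "0 < snd p" by (auto simp: M_def cyl_def)
      from ev[OF this] have "\<forall>\<^sub>F n in sequentially. ramp n (snd p) = 1"
        by eventually_elim (simp add: ramp_eq_1)
      then have "(\<lambda>n. ramp n (snd p)) \<longlonglongrightarrow> 1"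
        by (rule tendsto_eventually)
      then have "(\<lambda>n. snd (G p) * (\<psi> (fst p) * (cutoff Y (snd p) * ramp n (snd p))))
        \<longlonglongrightarrow> snd (G p) * (\<psi> (fst p) * (cutoff Y (snd p) * 1))"
        by (intro tendsto_mult tendsto_const)
      then show "(\<lambda>n. snd (G p) * (\<psi> (fst p) * (cutoff Y (snd p) * ramp n (snd p))))
        \<longlonglongrightarrow> snd (G p) * (\<psi> (fst p) * cutoff Y (snd p))"
        by simp
    qed
  qed
  then have "(\<lambda>n. - (\<integral>p. snd (G p) * (\<psi> (fst p) * (cutoff Y (snd p) * ramp n (snd p))) \<partial>M)
        - (\<integral>p. v p * (\<psi> (fst p) * cutoff_deriv Y (snd p)) \<partial>M))
      \<longlonglongrightarrow> - (\<integral>p. snd (G p) * (\<psi> (fst p) * cutoff Y (snd p)) \<partial>M)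
        - (\<integral>p. v p * (\<psi> (fst p) * cutoff_deriv Y (snd p)) \<partial>M)"
    by (intro tendsto_diff tendsto_minus tendsto_const)
  moreover have "\<forall>\<^sub>F n in sequentially.
      - (\<integral>p. snd (G p) * (\<psi> (fst p) * (cutoff Y (snd p) * ramp n (snd p))) \<partial>M)
        - (\<integral>p. v p * (\<psi> (fst p) * cutoff_deriv Y (snd p)) \<partial>M)
      = (\<integral>p. v p * (\<psi> (fst p) * ramp_deriv n (snd p)) \<partial>M)"
    using ev[of "Y / 3"] Y by (auto elim!: eventually_mono simp: step)
  ultimately have "(\<lambda>n. \<integral>p. v p * (\<psi> (fst p) * ramp_deriv n (snd p)) \<partial>M)
      \<longlonglongrightarrow> - (\<integral>p. snd (G p) * (\<psi> (fst p) * cutoff Y (snd p)) \<partial>M)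
        - (\<integral>p. v p * (\<psi> (fst p) * cutoff_deriv Y (snd p)) \<partial>M)"
    by (rule Lim_transform_eventually)
  from LIMSEQ_unique[OF ramp_deriv_tendsto_boundary_value[OF \<Omega> Y s t vG(1) v(2)] this[unfolded M_def]]
  show ?thesis
    unfolding G_def .
qed

text \<open>Integrating by parts in \<open>y\<close> expresses the pairing of a trace with a test function by a functional
  that is bounded in \<open>H\<^sup>1(y\<^sup>\<alpha>)\<close>; this makes the trace unique.\<close>

lemma has_trace_pairing:
  fixes \<Omega> :: "(real^'n) set"
  assumes \<Omega>: "open \<Omega>" "bounded \<Omega>" and Y: "0 < Y" and s: "0 < s"
    and t: "test_function \<Omega> \<psi> D" and u: "has_trace \<Omega> s Y w u"
  shows "(\<integral>x. u x * \<psi> x \<partial>lebesgue_on \<Omega>)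
    = - (\<integral>p. snd (weak_grad (cyl \<Omega> Y) w p) * (\<psi> (fst p) * cutoff Y (snd p)) \<partial>lebesgue_on (cyl \<Omega> Y))
      - (\<integral>p. w p * (\<psi> (fst p) * cutoff_deriv Y (snd p)) \<partial>lebesgue_on (cyl \<Omega> Y))"
proof -
  define m where "m = cyl_measure \<Omega> s Y"
  define M where "M = lebesgue_on (cyl \<Omega> Y)"
  define \<beta> where "\<beta> p = \<psi> (fst p) * cutoff Y (snd p)" for p
  define \<beta>' where "\<beta>' p = \<psi> (fst p) * cutoff_deriv Y (snd p)" for p
  define \<Lambda> where "\<Lambda> w = - (\<integral>p. snd (weak_grad (cyl \<Omega> Y) w p) * \<beta> p \<partial>M) - (\<integral>p. w p * \<beta>' p \<partial>M)" for w
  obtain v where v': "\<forall>j. v j \<in> H1 m (cyl \<Omega> Y) \<and> continuous_on (closure (cyl \<Omega> Y)) (v j)"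
    and v_lim: "(\<lambda>j. h1norm m (cyl \<Omega> Y) (\<lambda>p. v j p - w p)) \<longlonglongrightarrow> 0"
    and u_lim: "(\<lambda>j. l2norm (lebesgue_on \<Omega>) (\<lambda>x. v j (x, 0) - u x)) \<longlonglongrightarrow> 0"
    and w: "w \<in> H1 m (cyl \<Omega> Y)" and u2: "u \<in> L2 (lebesgue_on \<Omega>)"
    using u unfolding has_trace_def m_def by blast
  have v: "v j \<in> H1 m (cyl \<Omega> Y)" "continuous_on (closure (cyl \<Omega> Y)) (v j)" for j
    using v' by auto
  have o: "open (cyl \<Omega> Y)" by (rule cyl_open[OF \<Omega>(1)])
  obtain B where B: "\<And>x. \<bar>\<psi> x\<bar> \<le> B" "0 \<le> B"
    by (rule test_function_bounded[OF t]) (rule that)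
  obtain Bl where Bl: "\<And>t. smooth_step_deriv t \<le> Bl" "0 \<le> Bl"
    by (rule smooth_step_deriv_bounded) (rule that)
  have c\<psi>: "continuous_on A \<psi>" for A
    by (rule test_function_continuous[OF t])
  have \<beta>m: "\<beta> \<in> borel_measurable (lebesgue_on (cyl \<Omega> Y))" "\<beta>' \<in> borel_measurable (lebesgue_on (cyl \<Omega> Y))"
    unfolding \<beta>_def \<beta>'_def
    by (intro continuous_imp_lebesgue_on_measurable continuous_intros continuous_on_compose2[OF c\<psi>]
          continuous_on_compose2[OF continuous_cutoff] continuous_on_compose2[OF continuous_cutoff_deriv]; auto)+
  have \<beta>b: "\<bar>\<beta> p\<bar> \<le> B * 1" for p
    unfolding \<beta>_def abs_mult using B smooth_step_bounds by (intro mult_mono) (auto simp: cutoff_def)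
  have \<beta>b': "\<bar>\<beta>' p\<bar> \<le> B * (Bl * (3 / Y))" for p
    unfolding \<beta>'_def abs_mult using B Bl(1) smooth_step_deriv_nonneg Y
    by (intro mult_mono) (auto simp: cutoff_deriv_def abs_mult intro!: divide_right_mono)
  obtain C where C: "0 \<le> C" "\<And>u. u \<in> L2 m \<Longrightarrow> integrable M (\<lambda>p. u p * \<beta> p)"
    "\<And>u. u \<in> L2 m \<Longrightarrow> \<bar>\<integral>p. u p * \<beta> p \<partial>M\<bar> \<le> C * l2norm m u"
    by (rule cyl_weighted_pairing[OF \<Omega> Y s \<beta>m(1) \<beta>b, folded m_def M_def]) (rule that)
  obtain C' where C': "0 \<le> C'" "\<And>u. u \<in> L2 m \<Longrightarrow> integrable M (\<lambda>p. u p * \<beta>' p)"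
    "\<And>u. u \<in> L2 m \<Longrightarrow> \<bar>\<integral>p. u p * \<beta>' p \<partial>M\<bar> \<le> C' * l2norm m u"
    by (rule cyl_weighted_pairing[OF \<Omega> Y s \<beta>m(2) \<beta>b', folded m_def M_def]) (rule that)
  \<comment> \<open>\<Lambda> consists of unweighted integrals; the pairing lemma with the
    reciprocal weight makes it continuous in the weighted norm.\<close>
  have bound: "\<bar>\<Lambda> (v j) - \<Lambda> w\<bar> \<le> (C + C') * h1norm m (cyl \<Omega> Y) (\<lambda>p. v j p - w p)" for j
  proof -
    note hv = H1_weak_grad_L2[OF \<Omega>(1) v(1)[of j, unfolded m_def], folded m_def]
    note hw = H1_weak_grad_L2[OF \<Omega>(1) w[unfolded m_def], folded m_def]
    \<comment> \<open>\<open>h1norm\<close> contains the chosen gradient of the difference, whereas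
      \<Lambda> produces the difference of the chosen gradients. The two agree almost
      everywhere.\<close>
    define E where "E p = weak_grad (cyl \<Omega> Y) (v j) p - weak_grad (cyl \<Omega> Y) w p" for p
    have E2: "E \<in> L2 m"
      unfolding E_def by (rule L2_diff[OF hv(3) hw(3)])
    have d2: "(\<lambda>p. v j p - w p) \<in> L2 m"
      by (rule L2_diff[OF hv(1) hw(1)])
    have "has_weak_grad (cyl \<Omega> Y) (\<lambda>p. 1 * v j p + (- 1) * w p)
       (\<lambda>p. 1 *\<^sub>R weak_grad (cyl \<Omega> Y) (v j) p + (- 1) *\<^sub>R weak_grad (cyl \<Omega> Y) w p)"
      by (rule has_weak_grad_lincomb[OF o hv(2) hw(2)])
    then have wE: "has_weak_grad (cyl \<Omega> Y) (\<lambda>p. v j p - w p) E"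
      by (simp add: E_def[abs_def])
    have "AE p in m. weak_grad (cyl \<Omega> Y) (\<lambda>p. v j p - w p) p = E p"
      unfolding m_def AE_cyl_measure_iff by (rule weak_grad_AE_eq[OF o wE])
    then have lE: "l2norm m (weak_grad (cyl \<Omega> Y) (\<lambda>p. v j p - w p)) = l2norm m E"
      using E2 weak_grad_measurable[OF o wE]
      by (intro l2norm_cong_AE) (auto simp: L2_def m_def borel_measurable_cyl_measure)
    have h: "l2norm m (\<lambda>p. v j p - w p) \<le> h1norm m (cyl \<Omega> Y) (\<lambda>p. v j p - w p)"
      "l2norm m E \<le> h1norm m (cyl \<Omega> Y) (\<lambda>p. v j p - w p)"
      unfolding h1norm_def lE by (intro real_le_rsqrt; simp)+
    have "\<Lambda> (v j) - \<Lambda> w = - (\<integral>p. snd (E p) * \<beta> p \<partial>M) - (\<integral>p. (v j p - w p) * \<beta>' p \<partial>M)"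
      unfolding \<Lambda>_def E_def
      using C(2)[OF L2_snd(1)[OF hv(3)]] C(2)[OF L2_snd(1)[OF hw(3)]] C'(2)[OF hv(1)] C'(2)[OF hw(1)]
      by (simp add: left_diff_distrib)
    also have "\<bar>\<dots>\<bar> \<le> C * l2norm m (\<lambda>p. snd (E p)) + C' * l2norm m (\<lambda>p. v j p - w p)"
      using C(3)[OF L2_snd(1)[OF E2]] C'(3)[OF d2] by linarith
    also have "\<dots> \<le> C * h1norm m (cyl \<Omega> Y) (\<lambda>p. v j p - w p) + C' * h1norm m (cyl \<Omega> Y) (\<lambda>p. v j p - w p)"
      using C(1) C'(1) h L2_snd(2)[OF E2] by (intro add_mono mult_left_mono) auto
    finally show ?thesis by (simp add: algebra_simps)
  qed
  have "(\<lambda>j. (C + C') * h1norm m (cyl \<Omega> Y) (\<lambda>p. v j p - w p)) \<longlonglongrightarrow> 0"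
    by (rule tendsto_mult_right_zero[OF v_lim])
  then have "(\<lambda>j. \<Lambda> (v j) - \<Lambda> w) \<longlonglongrightarrow> 0"
    by (rule Lim_null_comparison[rotated]) (simp add: bound)
  then have L1: "(\<lambda>j. \<Lambda> (v j)) \<longlonglongrightarrow> \<Lambda> w"
    by (simp add: LIM_zero_iff)
  have fin: "finite_measure (lebesgue_on \<Omega>)"
    using \<Omega> by (intro finite_measure_lebesgue_on bounded_set_imp_lmeasurable) auto
  have \<psi>2: "\<psi> \<in> L2 (lebesgue_on \<Omega>)"
    by (rule L2_bounded[OF fin continuous_imp_lebesgue_on_measurable[OF c\<psi>], where B=B]) (use B in auto)
  have v2: "(\<lambda>x. v j (x, 0)) \<in> L2 (lebesgue_on \<Omega>)" for j
  proof (cases "\<Omega> = {}")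
    case False
    then have clos: "closure (cyl \<Omega> Y) = closure \<Omega> \<times> {0..Y}"
      using Y by (simp add: cyl_def closure_Times)
    have c0: "continuous_on (closure \<Omega>) (\<lambda>x. v j (x, 0))"
      by (rule continuous_on_compose2[OF v(2)]) (use Y in \<open>auto simp: clos intro!: continuous_intros\<close>)
    have "bounded ((\<lambda>x. v j (x, 0)) ` closure \<Omega>)"
      using \<Omega>(2) by (intro compact_imp_bounded compact_continuous_image c0) (simp add: compact_closure)
    then obtain W where W: "\<And>x. x \<in> closure \<Omega> \<Longrightarrow> \<bar>v j (x, 0)\<bar> \<le> W"
      unfolding bounded_iff by auto
    show ?thesis
    proof (rule L2_bounded[OF fin, of _ W])
      show "(\<lambda>x. v j (x, 0)) \<in> borel_measurable (lebesgue_on \<Omega>)"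
        using \<Omega>(1) by (intro continuous_imp_measurable_on_sets_lebesgue continuous_on_subset[OF c0 closure_subset]) auto
      show "AE x in lebesgue_on \<Omega>. norm (v j (x, 0)) \<le> W"
        using W closure_subset by (intro AE_I2) auto
    qed
  qed (simp add: L2_def measurable_def)
  have pb: "\<bar>(\<integral>x. v j (x, 0) * \<psi> x \<partial>lebesgue_on \<Omega>) - (\<integral>x. u x * \<psi> x \<partial>lebesgue_on \<Omega>)\<bar>
      \<le> l2norm (lebesgue_on \<Omega>) (\<lambda>x. v j (x, 0) - u x) * l2norm (lebesgue_on \<Omega>) \<psi>" for j
    using l2_Cauchy_Schwarz[OF L2_diff[OF v2 u2] \<psi>2, of j]
      L2_inner_integrable[OF v2 \<psi>2, of j] L2_inner_integrable[OF u2 \<psi>2]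
    by (simp add: left_diff_distrib)
  have pl: "(\<lambda>j. l2norm (lebesgue_on \<Omega>) (\<lambda>x. v j (x, 0) - u x) * l2norm (lebesgue_on \<Omega>) \<psi>)
      \<longlonglongrightarrow> 0"
    by (rule tendsto_mult_left_zero[OF u_lim])
  have "(\<lambda>j. (\<integral>x. v j (x, 0) * \<psi> x \<partial>lebesgue_on \<Omega>) - (\<integral>x. u x * \<psi> x \<partial>lebesgue_on \<Omega>)) \<longlonglongrightarrow> 0"
    by (rule Lim_null_comparison[OF _ pl]) (simp only: real_norm_def pb eventually_True)
  then have "(\<lambda>j. \<integral>x. v j (x, 0) * \<psi> x \<partial>lebesgue_on \<Omega>) \<longlonglongrightarrow> (\<integral>x. u x * \<psi> x \<partial>lebesgue_on \<Omega>)"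
    by (simp add: LIM_zero_iff)
  moreover have "(\<integral>x. v j (x, 0) * \<psi> x \<partial>lebesgue_on \<Omega>) = \<Lambda> (v j)" for j
    unfolding \<Lambda>_def \<beta>_def \<beta>'_def M_def
    by (rule trace_duality[OF \<Omega> Y s t v(1)[of j, unfolded m_def] v(2)])
  ultimately have "(\<lambda>j. \<Lambda> (v j)) \<longlonglongrightarrow> (\<integral>x. u x * \<psi> x \<partial>lebesgue_on \<Omega>)"
    by simp
  from LIMSEQ_unique[OF this L1] show ?thesis
    unfolding \<Lambda>_def \<beta>_def \<beta>'_def M_def .
qed

text \<open>On a bounded domain the constant 1 is square integrable, and pairing with it gives
  integrability.\<close>

lemma L2_locally_integrable:
  fixes \<Omega> :: "'a::euclidean_space set" and u :: "'a \<Rightarrow> real"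
  assumes "open \<Omega>" "bounded \<Omega>" "u \<in> L2 (lebesgue_on \<Omega>)"
  shows "locally_integrable_on \<Omega> u"
proof -
  have fin: "finite_measure (lebesgue_on \<Omega>)"
    using assms by (intro finite_measure_lebesgue_on bounded_set_imp_lmeasurable) auto
  have "(\<lambda>_. 1 :: real) \<in> L2 (lebesgue_on \<Omega>)"
    by (rule L2_bounded[OF fin, of _ 1]) auto
  from L2_inner_integrable[OF assms(3) this] have "integrable (lebesgue_on \<Omega>) u"
    by simp
  then have i: "integrable lebesgue (\<lambda>x. indicator \<Omega> x *\<^sub>R u x)"
    using assms(1) by (subst (asm) integrable_lebesgue_on_iff) auto
  have "integrable (lebesgue_on K) u" if K: "compact K" "K \<subseteq> \<Omega>" for K
  proof -
    have Ks: "K \<in> sets lebesgue"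
      using K(1) by (simp add: lmeasurable_compact fmeasurableD)
    have "(\<lambda>x. indicator K x *\<^sub>R indicator \<Omega> x *\<^sub>R u x) = (\<lambda>x. indicator K x *\<^sub>R u x)"
      using K(2) by (auto simp: indicator_def fun_eq_iff)
    then show ?thesis
      using integrable_mult_indicator[OF Ks i] by (subst integrable_lebesgue_on_iff[OF Ks]) simp
  qed
  then show ?thesis
    by (simp add: locally_integrable_on_def)
qed

text \<open>The right-hand side of the pairing formula depends on w alone, so two traces of w have
  equal integrals against every test function.\<close>

lemma has_trace_unique:
  fixes \<Omega> :: "(real^'n) set"
  assumes \<Omega>: "open \<Omega>" "bounded \<Omega>" and Y: "0 < Y" and s: "0 < s"
    and u: "has_trace \<Omega> s Y w u" "has_trace \<Omega> s Y w u'"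
  shows "AE x in lebesgue_on \<Omega>. u x = u' x"
proof -
  have u2: "u \<in> L2 (lebesgue_on \<Omega>)" "u' \<in> L2 (lebesgue_on \<Omega>)"
    using u by (auto simp: has_trace_def)
  have "AE x in lebesgue_on \<Omega>. u x - u' x = 0"
  proof (rule AE_zero_if_test_integrals_zero[OF \<Omega>(1) L2_locally_integrable[OF \<Omega> L2_diff[OF u2]]])
    fix \<phi> D assume t: "test_function \<Omega> \<phi> D"
    have i: "integrable (lebesgue_on \<Omega>) (\<lambda>x. \<phi> x * u x)" "integrable (lebesgue_on \<Omega>) (\<lambda>x. \<phi> x * u' x)"
      using test_function_mult_integrable[OF \<Omega>(1) L2_locally_integrable[OF \<Omega> u2(1)] t]
        test_function_mult_integrable[OF \<Omega>(1) L2_locally_integrable[OF \<Omega> u2(2)] t] by auto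
    have "(\<integral>x. u x * \<phi> x \<partial>lebesgue_on \<Omega>) = (\<integral>x. u' x * \<phi> x \<partial>lebesgue_on \<Omega>)"
      unfolding has_trace_pairing[OF \<Omega> Y s t u(1)] has_trace_pairing[OF \<Omega> Y s t u(2)] ..
    then show "(\<integral>x. \<phi> x * (u x - u' x) \<partial>lebesgue_on \<Omega>) = 0"
      using i by (simp add: right_diff_distrib mult.commute)
  qed
  then show ?thesis
    by eventually_elim simp
qed

subsection \<open>The discrete space\<close>

lemma lipschitz_on_mult_bounded:
  fixes f g :: "'a::metric_space \<Rightarrow> real"
  assumes f: "K-lipschitz_on X f" and g: "L-lipschitz_on X g"
    and b: "\<And>x. x \<in> X \<Longrightarrow> \<bar>f x\<bar> \<le> B" "\<And>x. x \<in> X \<Longrightarrow> \<bar>g x\<bar> \<le> B" "0 \<le> B"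
  shows "(B * L + B * K)-lipschitz_on X (\<lambda>x. f x * g x)"
proof (rule lipschitz_onI)
  show "0 \<le> B * L + B * K"
    using b(3) lipschitz_on_nonneg[OF f] lipschitz_on_nonneg[OF g] by simp
  fix x y assume xy: "x \<in> X" "y \<in> X"
  have "\<bar>f x * g x - f y * g y\<bar> = \<bar>f x * (g x - g y) + g y * (f x - f y)\<bar>"
    by (simp add: algebra_simps)
  also have "\<dots> \<le> \<bar>f x\<bar> * \<bar>g x - g y\<bar> + \<bar>g y\<bar> * \<bar>f x - f y\<bar>"
    by (metis abs_mult abs_triangle_ineq)
  also have "\<dots> \<le> B * (L * dist x y) + B * (K * dist x y)"
    using lipschitz_onD[OF f xy] lipschitz_onD[OF g xy] b xy
    by (intro add_mono mult_mono) (auto simp: dist_real_def)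
  finally show "dist (f x * g x) (f y * g y) \<le> (B * L + B * K) * dist x y"
    by (simp add: dist_real_def algebra_simps)
qed

lemma lipschitz_on_sum_ex:
  fixes f :: "nat \<Rightarrow> 'a::metric_space \<Rightarrow> real"
  assumes "\<And>i. i < m \<Longrightarrow> \<exists>L. L-lipschitz_on X (f i)"
  shows "\<exists>L. L-lipschitz_on X (\<lambda>x. \<Sum>i<m. f i x)"
  using assms
proof (induction m)
  case 0
  then show ?case using lipschitz_on_constant[of X "0::real"] by auto
next
  case (Suc m)
  obtain K L where "K-lipschitz_on X (\<lambda>x. \<Sum>i<m. f i x)" "L-lipschitz_on X (f m)"
    using Suc by (metis less_Suc_eq)
  from lipschitz_on_add[OF this] show ?case by auto
qed

text \<open>Along every segment the pieces cut out finitely many closed sets of parameters.\<close>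

lemma piecewise_lipschitz_imp_lipschitz:
  fixes v :: "'a::euclidean_space \<Rightarrow> real"
  assumes X: "convex X" "X \<subseteq> \<Union>\<T>" and fin: "finite \<T>" and cl: "\<And>T. T \<in> \<T> \<Longrightarrow> closed T"
    and L: "\<And>T. T \<in> \<T> \<Longrightarrow> L-lipschitz_on T v" "0 \<le> L"
  shows "L-lipschitz_on X v"
proof (rule lipschitz_onI[OF _ L(2)])
  fix x y assume xy: "x \<in> X" "y \<in> X"
  define \<gamma> where "\<gamma> t = x + t *\<^sub>R (y - x)" for t :: real
  define g where "g t = v (\<gamma> t)" for t
  define U where "U T = \<gamma> -` T" for T
  have c: "continuous_on UNIV \<gamma>"
    unfolding \<gamma>_def by (intro continuous_intros)
  have dg: "dist (\<gamma> t) (\<gamma> t') = norm (y - x) * dist t t'" for t t'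
  proof -
    have "\<gamma> t - \<gamma> t' = (t - t') *\<^sub>R (y - x)"
      by (simp add: \<gamma>_def algebra_simps)
    then show ?thesis by (simp add: dist_norm)
  qed
  have "(L * norm (y - x))-lipschitz_on {0..1} g"
  proof (rule lipschitz_on_closed_Union[where I=\<T> and U=U])
    show "(L * norm (y - x))-lipschitz_on (U T) g" if T: "T \<in> \<T>" for T
    proof (rule lipschitz_onI)
      fix t t' assume "t \<in> U T" "t' \<in> U T"
      then show "dist (g t) (g t') \<le> L * norm (y - x) * dist t t'"
        using lipschitz_onD[OF L(1)[OF T], of "\<gamma> t" "\<gamma> t'"]
        by (auto simp: U_def g_def dg mult.assoc)
    qed (use L(2) in simp)
    show "closed (U T)" if "T \<in> \<T>" for T
      unfolding U_def using closed_vimage[OF cl[OF that] c] .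
    show "{0..1} \<subseteq> (\<Union>T\<in>\<T>. U T)"
    proof
      fix t :: real assume t: "t \<in> {0..1}"
      have "\<gamma> t = (1 - t) *\<^sub>R x + t *\<^sub>R y"
        by (simp add: \<gamma>_def algebra_simps)
      then have "\<gamma> t \<in> X"
        using t xy X(1) by (auto simp: convex_alt)
      then show "t \<in> (\<Union>T\<in>\<T>. U T)"
        using X(2) by (auto simp: U_def)
    qed
  qed (use fin L(2) in auto)
  from lipschitz_onD[OF this, of 1 0] show "dist (v x) (v y) \<le> L * dist x y"
    by (simp add: g_def \<gamma>_def dist_commute dist_norm norm_minus_commute)
qed

lemma conforming_meshD:
  fixes \<Omega> :: "(real^'n) set"
  assumes "conforming_mesh \<Omega> \<T>"
  shows "finite \<T>" "\<Union>\<T> = closure \<Omega>" "T \<in> \<T> \<Longrightarrow> closed T" "T \<in> \<T> \<Longrightarrow> convex T"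
  using assms by (auto simp: conforming_mesh_def triangulation_def dest!: bspec
      intro: closed_simplex convex_simplex)

text \<open>On each cell the function is affine with slope \<open>norm (a T)\<close>. The sum of all
  slopes is a common constant, nonnegative without a separate argument.\<close>

lemma S10_lipschitz:
  fixes \<Omega> :: "(real^'n) set"
  assumes "convex \<Omega>" "conforming_mesh \<Omega> \<T>" "v \<in> S10 \<Omega> \<T>"
  shows "\<exists>L. L-lipschitz_on (closure \<Omega>) v"
proof -
  note m = conforming_meshD[OF assms(2)]
  have "\<forall>T\<in>\<T>. \<exists>a b. \<forall>x\<in>T. v x = a \<bullet> x + b"
    using assms(3) by (simp add: S10_def)
  then obtain a b where ab: "\<And>T x. T \<in> \<T> \<Longrightarrow> x \<in> T \<Longrightarrow> v x = a T \<bullet> x + b T"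
    by metis
  define L where "L = (\<Sum>T\<in>\<T>. norm (a T))"
  have "L-lipschitz_on (closure \<Omega>) v"
  proof (rule piecewise_lipschitz_imp_lipschitz[where \<T>=\<T>])
    show L0: "0 \<le> L" unfolding L_def by (rule sum_nonneg) simp
    show "L-lipschitz_on T v" if T: "T \<in> \<T>" for T
    proof (rule lipschitz_onI[OF _ L0])
      fix x y assume xy: "x \<in> T" "y \<in> T"
      have "dist (v x) (v y) = \<bar>a T \<bullet> (x - y)\<bar>"
        using ab[OF T xy(1)] ab[OF T xy(2)] by (simp add: dist_real_def inner_diff_right)
      also have "\<dots> \<le> norm (a T) * norm (x - y)"
        by (rule Cauchy_Schwarz_ineq2)
      also have "\<dots> \<le> L * norm (x - y)"
        unfolding L_def using m(1) T by (intro mult_right_mono member_le_sum) auto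
      finally show "dist (v x) (v y) \<le> L * dist x y"
        by (simp add: dist_norm)
    qed
  qed (use m assms(1) in \<open>auto simp: convex_closure\<close>)
  then show ?thesis by blast
qed

text \<open>Take the least m whose interval has right end at least y. By minimality y lies beyond
  the right end of interval m - 1, which is the left end of interval m; for m = 1 the left end is
  0.\<close>

lemma geo_interval_cover:
  assumes "0 < \<sigma>" "1 \<le> M"
  shows "{0..Y} \<subseteq> (\<Union>m\<in>{1..M}. geo_interval Y \<sigma> M m)"
proof
  fix y assume y: "y \<in> {0..Y}"
  define P where "P m \<longleftrightarrow> 1 \<le> m \<and> y \<le> Y * \<sigma> ^ (M - m)" for m
  have PM: "P M" using y assms by (simp add: P_def)
  define m where "m = (LEAST m. P m)"
  have Pm: "P m" unfolding m_def using PM by (rule LeastI)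
  have mM: "m \<le> M" unfolding m_def using PM by (rule Least_le)
  have m1: "1 \<le> m" using Pm by (simp add: P_def)
  have "y \<in> geo_interval Y \<sigma> M m"
  proof (cases "m = 1")
    case True
    then show ?thesis using y Pm by (simp add: geo_interval_def P_def)
  next
    case False
    then have "\<not> P (m - 1)"
      unfolding m_def[symmetric] using m1 by (metis diff_less less_numeral_extra(1) less_le_trans m_def not_less_Least)
    then have "Y * \<sigma> ^ (M - (m - 1)) < y"
      using False m1 by (auto simp: P_def)
    moreover have "M - (m - 1) = M - m + 1"
      using mM m1 by simp
    ultimately show ?thesis
      using False Pm by (simp add: geo_interval_def P_def)
  qed
  then show "y \<in> (\<Union>m\<in>{1..M}. geo_interval Y \<sigma> M m)"
    using m1 mM by auto
qed

lemma geo_interval_convex_closed: "convex (geo_interval Y \<sigma> M m)" "closed (geo_interval Y \<sigma> M m)"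
  by (auto simp: geo_interval_def)

lemma compact_geo_interval: "compact (geo_interval Y \<sigma> M m)"
  by (auto simp: geo_interval_def)

lemma poly_lipschitz:
  fixes p :: "real poly"
  assumes "compact I" "convex I"
  shows "\<exists>L. L-lipschitz_on I (poly p)"
proof -
  have "bounded (poly (pderiv p) ` I)"
    using assms(1) by (intro compact_imp_bounded compact_continuous_image) (auto intro!: continuous_intros)
  then obtain L where L: "\<And>x. x \<in> I \<Longrightarrow> \<bar>poly (pderiv p) x\<bar> \<le> L"
    unfolding bounded_iff by auto
  have "(max 0 L)-lipschitz_on I (poly p)"
  proof (rule bounded_derivative_imp_lipschitz)
    show "(poly p has_derivative (\<lambda>h. poly (pderiv p) x * h)) (at x within I)" for x
      using poly_DERIV[of p x] by (simp add: has_field_derivative_def has_derivative_at_withinI)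
    show "onorm (\<lambda>h. poly (pderiv p) x * h) \<le> max 0 L" if "x \<in> I" for x
      using L[OF that] by (intro onorm_le) (auto simp: abs_mult intro!: mult_right_mono)
  qed (use assms in auto)
  then show ?thesis by blast
qed

lemma Sr_lipschitz:
  assumes "0 < \<sigma>" "1 \<le> M" "z \<in> Sr Y \<sigma> M slope"
  shows "\<exists>L. L-lipschitz_on {0..Y} z"
proof -
  have "\<exists>p. \<forall>y\<in>geo_interval Y \<sigma> M m. z y = poly p y" if "m \<in> {1..M}" for m
    using assms(3) that unfolding Sr_def by blast
  then have "\<exists>L. L-lipschitz_on (geo_interval Y \<sigma> M m) z" if "m \<in> {1..M}" for m
    using that poly_lipschitz[OF compact_geo_interval geo_interval_convex_closed(1)]
      lipschitz_on_transform by metis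
  then obtain L where L: "\<And>m. m \<in> {1..M} \<Longrightarrow> (L m)-lipschitz_on (geo_interval Y \<sigma> M m) z"
    by metis
  define K where "K = (\<Sum>m\<in>{1..M}. \<bar>L m\<bar>)"
  have "K-lipschitz_on {0..Y} z"
  proof (rule piecewise_lipschitz_imp_lipschitz[where \<T>="geo_interval Y \<sigma> M ` {1..M}"])
    show "K-lipschitz_on T z" if "T \<in> geo_interval Y \<sigma> M ` {1..M}" for T
    proof -
      obtain m where m: "m \<in> {1..M}" "T = geo_interval Y \<sigma> M m" using \<open>T \<in> _\<close> by auto
      have "L m \<le> \<bar>L m\<bar>" by simp
      also have "\<dots> \<le> K"
        unfolding K_def using m by (intro member_le_sum) auto
      finally show ?thesis
        unfolding m(2) by (rule lipschitz_on_mono[OF L[OF m(1)] order_refl])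
    qed
    show "0 \<le> K" unfolding K_def by (rule sum_nonneg) simp
  qed (use geo_interval_cover[OF assms(1,2)] geo_interval_convex_closed in auto)
  then show ?thesis by blast
qed

lemma VV_lipschitz:
  fixes \<Omega> :: "(real^'n) set"
  assumes \<Omega>: "bounded \<Omega>" "convex \<Omega>" "\<Omega> \<noteq> {}" and mesh: "conforming_mesh \<Omega> \<T>"
    and g: "0 < \<sigma>" "1 \<le> M" "0 < Y" and w: "w \<in> VV \<Omega> Y \<T> \<sigma> M slope"
  shows "\<exists>L. L-lipschitz_on (closure (cyl \<Omega> Y)) w"
proof -
  obtain m v z where vz: "\<And>i. i < (m::nat) \<Longrightarrow> v i \<in> S10 \<Omega> \<T>" "\<And>i. i < m \<Longrightarrow> z i \<in> Sr Y \<sigma> M slope"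
    and weq: "w = (\<lambda>p. \<Sum>i<m. v i (fst p) * z i (snd p))"
    using w by (auto simp: VV_def tensor_space_def)
  have clos: "closure (cyl \<Omega> Y) = closure \<Omega> \<times> {0..Y}"
    using g by (simp add: cyl_def closure_Times)
  have "\<exists>L. L-lipschitz_on (closure \<Omega> \<times> {0..Y}) (\<lambda>p. v i (fst p) * z i (snd p))" if i: "i < m" for i
  proof -
    obtain K where K: "K-lipschitz_on (closure \<Omega>) (v i)"
      using S10_lipschitz[OF \<Omega>(2) mesh vz(1)[OF i]] by blast
    obtain L where L: "L-lipschitz_on {0..Y} (z i)"
      using Sr_lipschitz[OF g(1,2) vz(2)[OF i]] by blast
    have K': "K-lipschitz_on (closure \<Omega> \<times> {0..Y}) (\<lambda>p. v i (fst p))"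
    proof (rule lipschitz_onI[OF _ lipschitz_on_nonneg[OF K]])
      fix p q assume "p \<in> closure \<Omega> \<times> {0..Y}" "q \<in> closure \<Omega> \<times> {0..Y}"
      then have "dist (v i (fst p)) (v i (fst q)) \<le> K * dist (fst p) (fst q)"
        by (intro lipschitz_onD[OF K]) auto
      also have "\<dots> \<le> K * dist p q"
        using lipschitz_on_nonneg[OF K] by (intro mult_left_mono dist_fst_le)
      finally show "dist (v i (fst p)) (v i (fst q)) \<le> K * dist p q" .
    qed
    have L': "L-lipschitz_on (closure \<Omega> \<times> {0..Y}) (\<lambda>p. z i (snd p))"
    proof (rule lipschitz_onI[OF _ lipschitz_on_nonneg[OF L]])
      fix p q assume "p \<in> closure \<Omega> \<times> {0..Y}" "q \<in> closure \<Omega> \<times> {0..Y}"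
      then have "dist (z i (snd p)) (z i (snd q)) \<le> L * dist (snd p) (snd q)"
        by (intro lipschitz_onD[OF L]) auto
      also have "\<dots> \<le> L * dist p q"
        using lipschitz_on_nonneg[OF L] by (intro mult_left_mono dist_snd_le)
      finally show "dist (z i (snd p)) (z i (snd q)) \<le> L * dist p q" .
    qed
    have "bounded (v i ` closure \<Omega>)" "bounded (z i ` {0..Y})"
      using \<Omega>(1) lipschitz_on_continuous_on[OF K] lipschitz_on_continuous_on[OF L]
      by (auto intro!: compact_imp_bounded compact_continuous_image simp: compact_closure)
    then obtain B1 B2 where "\<forall>x\<in>v i ` closure \<Omega>. norm x \<le> B1" "\<forall>y\<in>z i ` {0..Y}. norm y \<le> B2"
      unfolding bounded_iff by blast
    then have B: "\<bar>v i x\<bar> \<le> B1" "\<bar>z i y\<bar> \<le> B2" if "x \<in> closure \<Omega>" "y \<in> {0..Y}" for x y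
      using that by auto
    define B where "B = max 0 (max B1 B2)"
    \<comment> \<open>The bounds were obtained for x and y jointly, so each single bound needs some
      point of the other factor: 0 here, and an element of the nonempty closure for the bound on
      z.\<close>
    have Bv: "\<bar>v i x\<bar> \<le> B" if "x \<in> closure \<Omega>" for x
      using B(1)[OF that, of 0] g(3) by (simp add: B_def)
    have Bz: "\<bar>z i y\<bar> \<le> B" if "y \<in> {0..Y}" for y
    proof -
      obtain x where "x \<in> closure \<Omega>" using \<Omega>(3) closure_subset[of \<Omega>] by blast
      from B(2)[OF this that] show ?thesis by (simp add: B_def)
    qed
    have "(B * L + B * K)-lipschitz_on (closure \<Omega> \<times> {0..Y}) (\<lambda>p. v i (fst p) * z i (snd p))"
    proof (rule lipschitz_on_mult_bounded[OF K' L'])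
      show "0 \<le> B" by (simp add: B_def)
    qed (use Bv Bz in auto)
    then show ?thesis by blast
  qed
  then show ?thesis
    unfolding clos weq by (rule lipschitz_on_sum_ex)
qed

text \<open>Away from the frontiers of the mesh slabs the function is locally a finite sum of affine
  functions times polynomials. A slab over a full factor is convex, and convex sets have negligible
  frontier.\<close>

lemma VV_differentiable_ae:
  fixes \<Omega> :: "(real^'n) set"
  assumes mesh: "conforming_mesh \<Omega> \<T>"
    and g: "0 < \<sigma>" "1 \<le> M" and w: "w \<in> VV \<Omega> Y \<T> \<sigma> M slope"
  obtains N where "negligible N" "\<And>p. p \<in> cyl \<Omega> Y - N \<Longrightarrow> w differentiable (at p)"
proof -
  note m = conforming_meshD[OF mesh]
  let ?X = "\<lambda>T. T \<times> (UNIV :: real set)" and ?I = "\<lambda>k. (UNIV :: (real^'n) set) \<times> geo_interval Y \<sigma> M k"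
  define N where "N = (\<Union>T\<in>\<T>. frontier (?X T)) \<union> (\<Union>k\<in>{1..M}. frontier (?I k))"
  have "negligible (frontier (?X T))" if "T \<in> \<T>" for T
    using m(4)[OF that] by (intro negligible_convex_frontier convex_Times) auto
  moreover have "negligible (frontier (?I k))" for k
    using geo_interval_convex_closed by (intro negligible_convex_frontier convex_Times) auto
  ultimately have "negligible N"
    unfolding N_def using m(1) by (intro negligible_Un negligible_Union) auto
  moreover have "w differentiable (at p)" if p: "p \<in> cyl \<Omega> Y - N" for p
  proof -
    obtain n v z where vz: "\<And>i. i < (n::nat) \<Longrightarrow> v i \<in> S10 \<Omega> \<T>" "\<And>i. i < n \<Longrightarrow> z i \<in> Sr Y \<sigma> M slope"
      and weq: "w = (\<lambda>p. \<Sum>i<n. v i (fst p) * z i (snd p))"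
      using w by (auto simp: VV_def tensor_space_def)
    have "fst p \<in> \<Union>\<T>"
      unfolding m(2) using p closure_subset[of \<Omega>] by (auto simp: cyl_def)
    then obtain T where T: "T \<in> \<T>" "fst p \<in> T" by blast
    have "snd p \<in> {0..Y}" using p by (auto simp: cyl_def)
    then obtain k where k: "k \<in> {1..M}" "snd p \<in> geo_interval Y \<sigma> M k"
      using geo_interval_cover[OF g, of Y] by blast
    \<comment> \<open>An open neighbourhood of p on which all factors keep their local formulas, so
      that the derivative of the formulas transfers.\<close>
    define Q where "Q = interior (?X T) \<inter> interior (?I k)"
    have "p \<in> closure (?X T)" "p \<in> closure (?I k)"
      using T k by (auto intro!: subsetD[OF closure_subset] simp: mem_Times_iff)
    then have pQ: "p \<in> Q"
      using p T k by (auto simp: Q_def N_def frontier_def)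
    have oQ: "open Q" by (simp add: Q_def open_Int)
    have Qs: "fst q \<in> T" "snd q \<in> geo_interval Y \<sigma> M k" if "q \<in> Q" for q
      using that interior_subset[of "?X T"] interior_subset[of "?I k"] by (auto simp: Q_def mem_Times_iff)
    have "(\<lambda>p. v i (fst p) * z i (snd p)) differentiable (at p)" if i: "i < n" for i
    proof -
      obtain a b where ab: "\<And>x. x \<in> T \<Longrightarrow> v i x = a \<bullet> x + b"
        using vz(1)[OF i] T(1) by (auto simp: S10_def)
      obtain q where q: "\<And>y. y \<in> geo_interval Y \<sigma> M k \<Longrightarrow> z i y = poly q y"
        using vz(2)[OF i] k(1) unfolding Sr_def by blast
      have "((\<lambda>p. poly q (snd p)) has_derivative (\<lambda>h. poly (pderiv q) (snd p) * snd h)) (at p)"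
        by (rule has_derivative_compose[of snd snd p UNIV "poly q"])
           (use poly_DERIV[of q "snd p"] in \<open>auto simp: has_field_derivative_def intro!: has_derivative_snd has_derivative_ident\<close>)
      moreover have "((\<lambda>p. a \<bullet> fst p + b) has_derivative (\<lambda>h. a \<bullet> fst h)) (at p)"
        by (auto intro!: derivative_eq_intros)
      ultimately have "(\<lambda>p. (a \<bullet> fst p + b) * poly q (snd p)) differentiable (at p)"
        by (intro differentiable_mult) (auto simp: differentiable_def)
      then obtain f' where "((\<lambda>p. (a \<bullet> fst p + b) * poly q (snd p)) has_derivative f') (at p)"
        by (auto simp: differentiable_def)
      then have "((\<lambda>p. v i (fst p) * z i (snd p)) has_derivative f') (at p)"
        by (rule has_derivative_transform_within_open[OF _ oQ pQ]) (use Qs ab q in auto)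
      then show ?thesis
        by (auto simp: differentiable_def)
    qed
    then show ?thesis
      unfolding weq by (intro differentiable_sum) auto
  qed
  ultimately show thesis
    by (rule that)
qed

lemma S10_cmult:
  assumes "v \<in> S10 \<Omega> \<T>"
  shows "(\<lambda>x. a * v x) \<in> S10 \<Omega> \<T>"
  unfolding S10_def
proof (intro CollectI conjI ballI)
  show "continuous_on (closure \<Omega>) (\<lambda>x. a * v x)"
    using assms by (auto simp: S10_def intro!: continuous_intros)
  fix T assume "T \<in> \<T>"
  then obtain a' b where "\<forall>x\<in>T. v x = a' \<bullet> x + b"
    using assms unfolding S10_def by blast
  then show "\<exists>c d. \<forall>x\<in>T. a * v x = c \<bullet> x + d"
    by (intro exI[of _ "a *\<^sub>R a'"] exI[of _ "a * b"]) (simp add: algebra_simps)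
qed (use assms in \<open>auto simp: S10_def\<close>)

text \<open>The two tensor sums are concatenated by shifting the second index by m. Coefficients are
  absorbed into the first factors, so only \<open>S10\<close> has to be closed under
  scaling.\<close>

lemma VV_lincomb:
  assumes "w \<in> VV \<Omega> Y \<T> \<sigma> M slope" "w' \<in> VV \<Omega> Y \<T> \<sigma> M slope"
  shows "(\<lambda>p. a * w p + b * w' p) \<in> VV \<Omega> Y \<T> \<sigma> M slope"
proof -
  obtain m v z where 1: "\<And>i. i < (m::nat) \<Longrightarrow> v i \<in> S10 \<Omega> \<T>" "\<And>i. i < m \<Longrightarrow> z i \<in> Sr Y \<sigma> M slope"
    "w = (\<lambda>p. \<Sum>i<m. v i (fst p) * z i (snd p))"
    using assms(1) by (auto simp: VV_def tensor_space_def)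
  obtain m' v' z' where 2: "\<And>i. i < (m'::nat) \<Longrightarrow> v' i \<in> S10 \<Omega> \<T>" "\<And>i. i < m' \<Longrightarrow> z' i \<in> Sr Y \<sigma> M slope"
    "w' = (\<lambda>p. \<Sum>i<m'. v' i (fst p) * z' i (snd p))"
    using assms(2) by (auto simp: VV_def tensor_space_def)
  define V where "V i = (if i < m then (\<lambda>x. a * v i x) else (\<lambda>x. b * v' (i - m) x))" for i
  define Z where "Z i = (if i < m then z i else z' (i - m))" for i
  have split: "(\<Sum>i<m + n. f i) = (\<Sum>i<m. f i) + (\<Sum>i<n. f (m + i))" for f :: "nat \<Rightarrow> real" and n
    by (induction n) (auto simp: algebra_simps)
  have "(\<lambda>p. a * w p + b * w' p) = (\<lambda>p. \<Sum>i<m + m'. V i (fst p) * Z i (snd p))"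
    unfolding split by (simp add: V_def Z_def 1(3) 2(3) sum_distrib_left mult.assoc)
  moreover have "V i \<in> S10 \<Omega> \<T> \<and> Z i \<in> Sr Y \<sigma> M slope" if "i < m + m'" for i
    using that 1(1,2) 2(1,2) by (auto simp: V_def Z_def intro!: S10_cmult)
  ultimately show ?thesis
    unfolding VV_def tensor_space_def by blast
qed

subsection \<open>Functions with bounded weak gradient\<close>

text \<open>A Lebesgue null set need not be Borel, so it is first enclosed in a Borel null set,
  whose product with the whole space has measure zero.\<close>

lemma null_sets_Times_UNIV:
  fixes N :: "'a::euclidean_space set"
  assumes "N \<in> null_sets lebesgue"
  shows "N \<times> (UNIV :: 'b::euclidean_space set) \<in> null_sets lebesgue"
proof -
  obtain N' where N': "N' \<in> null_sets lborel" "N \<subseteq> N'"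
    using assms by (auto simp: null_sets_completion_iff2)
  have "emeasure (lborel \<Otimes>\<^sub>M lborel) (N' \<times> (UNIV :: 'b set)) = 0"
    using N'(1) by (subst lborel.emeasure_pair_measure_Times) (auto dest: null_setsD1 null_setsD2)
  moreover have "N' \<times> (UNIV :: 'b set) \<in> sets (lborel \<Otimes>\<^sub>M lborel)"
    using N'(1) by (intro pair_measureI) (auto dest: null_setsD2)
  ultimately have "N' \<times> (UNIV :: 'b set) \<in> null_sets lborel"
    unfolding lborel_prod by (rule null_setsI)
  then show ?thesis
    using N'(2) unfolding null_sets_completion_iff2
    by (intro bexI[of _ "N' \<times> UNIV"]) auto
qed

text \<open>Borel measurability of \<open>fst\<close> alone does not cover preimages of Lebesgue
  sets. Each is split into an F-sigma set and a null set; the latter stays null after multiplication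
  by the whole space. This lifts the coefficient c, which is only Lebesgue measurable.\<close>

lemma measurable_fst_lebesgue:
  "fst \<in> measurable (lebesgue :: ('a::euclidean_space \<times> 'b::euclidean_space) measure) lebesgue"
proof (rule measurableI)
  fix X :: "'a set" assume "X \<in> sets lebesgue"
  then obtain C N where C: "fsigma C" "N \<in> null_sets lebesgue" "C \<union> N = X" "disjnt C N"
    by (rule lebesgue_set_almost_fsigma)
  have "C \<in> sets borel"
    using C(1) by (induction rule: fsigma.induct) auto
  then have "C \<times> (UNIV :: 'b set) \<in> sets ((borel :: 'a measure) \<Otimes>\<^sub>M (borel :: 'b measure))"
    by (intro pair_measureI) auto
  then have "C \<times> (UNIV :: 'b set) \<in> sets lborel"
    by (simp only: borel_prod sets_lborel)
  then have "C \<times> (UNIV :: 'b set) \<in> sets lebesgue"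
    by (rule sets_completionI_sets)
  moreover have "N \<times> (UNIV :: 'b set) \<in> sets lebesgue"
    using null_sets_Times_UNIV[OF C(2)] by (rule null_setsD2)
  ultimately have "C \<times> (UNIV :: 'b set) \<union> N \<times> UNIV \<in> sets lebesgue"
    by (rule sets.Un)
  moreover have "C \<times> (UNIV :: 'b set) \<union> N \<times> UNIV = fst -` X"
    using C(3) by auto
  ultimately show "fst -` X \<inter> space (lebesgue :: ('a \<times> 'b) measure) \<in> sets lebesgue"
    by simp
qed simp

lemma cyl_measurable_fst:
  fixes c :: "real^'n \<Rightarrow> real"
  assumes "open \<Omega>" "c \<in> borel_measurable (lebesgue_on \<Omega>)"
  shows "(\<lambda>p. c (fst p)) \<in> borel_measurable (lebesgue_on (cyl \<Omega> Y))"
proof -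
  have "(\<lambda>x. if x \<in> \<Omega> then c x else 0) \<in> borel_measurable lebesgue"
    using assms by (subst borel_measurable_if) auto
  from measurable_compose[OF measurable_fst_lebesgue this]
  have "(\<lambda>p. if fst p \<in> \<Omega> then c (fst p) else 0) \<in> borel_measurable (lebesgue_on (cyl \<Omega> Y))"
    by (rule measurable_restrict_space1)
  then show ?thesis
    by (rule measurable_cong[THEN iffD1, rotated]) (auto simp: cyl_def)
qed

lemma cyl_AE_fst:
  fixes \<Omega> :: "(real^'n) set"
  assumes "open \<Omega>" "AE x in lebesgue_on \<Omega>. P x"
  shows "AE p in lebesgue_on (cyl \<Omega> Y). P (fst p)"
proof -
  have "AE x in lebesgue. x \<in> \<Omega> \<longrightarrow> P x"
    using assms by (subst (asm) AE_restrict_space_iff) auto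
  then obtain N where N: "N \<in> null_sets lebesgue" "{x. \<not> (x \<in> \<Omega> \<longrightarrow> P x)} \<subseteq> N"
    by (auto simp: eventually_ae_filter)
  have "AE p in lebesgue. p \<notin> N \<times> (UNIV :: real set)"
    by (rule AE_not_in[OF null_sets_Times_UNIV[OF N(1)]])
  then have "AE p in lebesgue. p \<in> cyl \<Omega> Y \<longrightarrow> P (fst p)"
    by eventually_elim (use N(2) in \<open>auto simp: cyl_def\<close>)
  then show ?thesis
    using cyl_sets[OF assms(1)] by (subst AE_restrict_space_iff) auto
qed

text \<open>Closed under sums and products, this class reduces integrability of the form's integrand
  on the finite weighted measure to its single factors.\<close>

definition ess_bounded :: "'a measure \<Rightarrow> ('a \<Rightarrow> real) \<Rightarrow> bool" where
  "ess_bounded M f \<longleftrightarrow> f \<in> borel_measurable M \<and> (\<exists>B. AE x in M. \<bar>f x\<bar> \<le> B)"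

lemma ess_bounded_mult:
  assumes "ess_bounded M f" "ess_bounded M g"
  shows "ess_bounded M (\<lambda>x. f x * g x)"
proof -
  obtain B C where B: "AE x in M. \<bar>f x\<bar> \<le> B" and C: "AE x in M. \<bar>g x\<bar> \<le> C"
    using assms by (auto simp: ess_bounded_def)
  have "AE x in M. \<bar>f x * g x\<bar> \<le> \<bar>B\<bar> * \<bar>C\<bar>"
    using B C by eventually_elim (auto simp: abs_mult intro!: mult_mono)
  then show ?thesis
    using assms by (auto simp: ess_bounded_def)
qed

lemma ess_bounded_add:
  assumes "ess_bounded M f" "ess_bounded M g"
  shows "ess_bounded M (\<lambda>x. f x + g x)"
proof -
  obtain B C where B: "AE x in M. \<bar>f x\<bar> \<le> B" and C: "AE x in M. \<bar>g x\<bar> \<le> C"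
    using assms by (auto simp: ess_bounded_def)
  have "AE x in M. \<bar>f x + g x\<bar> \<le> B + C"
    using B C by eventually_elim linarith
  then show ?thesis
    using assms by (auto simp: ess_bounded_def)
qed

lemma ess_bounded_sum:
  assumes "finite I" "\<And>i. i \<in> I \<Longrightarrow> ess_bounded M (f i)"
  shows "ess_bounded M (\<lambda>x. \<Sum>i\<in>I. f i x)"
  using assms
proof (induction I rule: finite_induct)
  case empty
  have "AE x in M. \<bar>0::real\<bar> \<le> 0" by simp
  then show ?case unfolding ess_bounded_def by auto
next
  case (insert i I)
  then show ?case by (simp add: ess_bounded_add)
qed

lemma ess_bounded_integrable:
  assumes "finite_measure M" "ess_bounded M f"
  shows "integrable M f"
proof -
  obtain B where "AE x in M. norm (f x) \<le> B"
    using assms(2) by (auto simp: ess_bounded_def)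
  then show ?thesis
    using assms(2) by (intro finite_measure.integrable_const_bound[OF assms(1)]) (auto simp: ess_bounded_def)
qed

text \<open>Two demands for two purposes: continuity up to the closure identifies the trace with
  restriction, and the bounded gradient makes the form integrable. The class is closed under the
  linear combinations occurring in the scheme.\<close>

definition regular_fun :: "'a::euclidean_space set \<Rightarrow> ('a \<Rightarrow> real) \<Rightarrow> bool" where
  "regular_fun S w \<longleftrightarrow> continuous_on (closure S) w \<and>
     (\<exists>G B. has_weak_grad S w G \<and> (\<forall>x. norm (G x) \<le> B))"

lemma regular_fun_lincomb:
  assumes "open S" "regular_fun S w" "regular_fun S w'"
  shows "regular_fun S (\<lambda>x. a * w x + b * w' x)"
proof -
  obtain G B where G: "has_weak_grad S w G" "\<And>x. norm (G x) \<le> B"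
    using assms(2) by (auto simp: regular_fun_def)
  obtain G' B' where G': "has_weak_grad S w' G'" "\<And>x. norm (G' x) \<le> B'"
    using assms(3) by (auto simp: regular_fun_def)
  have "norm (a *\<^sub>R G x + b *\<^sub>R G' x) \<le> \<bar>a\<bar> * B + \<bar>b\<bar> * B'" for x
    using G(2)[of x] G'(2)[of x]
    by (intro order_trans[OF norm_triangle_ineq] add_mono) (auto intro: mult_left_mono)
  moreover have "continuous_on (closure S) (\<lambda>x. a * w x + b * w' x)"
    using assms(2,3) by (auto simp: regular_fun_def intro!: continuous_intros)
  ultimately show ?thesis
    using has_weak_grad_lincomb[OF assms(1) G(1) G'(1), of a b] unfolding regular_fun_def by blast
qed

lemma VV_regular_fun:
  fixes \<Omega> :: "(real^'n) set"
  assumes "open_convex_polytope \<Omega>" "conforming_mesh \<Omega> \<T>"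
    and "0 < \<sigma>" "1 \<le> M" "0 < Y" "w \<in> VV \<Omega> Y \<T> \<sigma> M slope"
  shows "regular_fun (cyl \<Omega> Y) w"
proof -
  have \<Omega>: "open \<Omega>" "bounded \<Omega>" "convex \<Omega>" "\<Omega> \<noteq> {}"
    using assms(1) by (auto simp: open_convex_polytope_def)
  obtain L where L: "L-lipschitz_on (closure (cyl \<Omega> Y)) w"
    using VV_lipschitz[OF \<Omega>(2-4) assms(2-6)] by blast
  obtain N where N: "negligible N" "\<And>p. p \<in> cyl \<Omega> Y - N \<Longrightarrow> w differentiable (at p)"
    using VV_differentiable_ae[OF assms(2-4,6)] by blast
  have b: "bounded (cyl \<Omega> Y)"
    unfolding cyl_def using \<Omega>(2) by (intro bounded_Times) auto
  obtain G B where "has_weak_grad (cyl \<Omega> Y) w G" "\<And>x. norm (G x) \<le> B"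
    by (rule lipschitz_has_bounded_weak_grad[OF cyl_open[OF \<Omega>(1)] b lipschitz_on_subset[OF L closure_subset] N])
       (auto intro: that)
  then show ?thesis
    using lipschitz_on_continuous_on[OF L] by (auto simp: regular_fun_def)
qed

section \<open>Regular functions: chosen gradients, Sobolev membership and traces\<close>

context
  fixes \<Omega> :: "(real^'n) set" and s Y :: real
  assumes \<Omega>: "open \<Omega>" "bounded \<Omega>" "\<Omega> \<noteq> {}" and sY: "0 < s" "s < 1" "0 < Y"
begin

lemma regular_fun_weak_grad:
  assumes "regular_fun (cyl \<Omega> Y) w"
  shows "has_weak_grad (cyl \<Omega> Y) w (weak_grad (cyl \<Omega> Y) w)"
    "weak_grad (cyl \<Omega> Y) w \<in> borel_measurable (cyl_measure \<Omega> s Y)"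
    "\<exists>B. AE p in cyl_measure \<Omega> s Y. norm (weak_grad (cyl \<Omega> Y) w p) \<le> B"
proof -
  obtain G B where G: "has_weak_grad (cyl \<Omega> Y) w G" "\<And>x. norm (G x) \<le> B"
    using assms by (auto simp: regular_fun_def)
  show "has_weak_grad (cyl \<Omega> Y) w (weak_grad (cyl \<Omega> Y) w)"
    using G(1) by (rule has_weak_grad_weak_grad)
  show "weak_grad (cyl \<Omega> Y) w \<in> borel_measurable (cyl_measure \<Omega> s Y)"
    using weak_grad_measurable[OF cyl_open[OF \<Omega>(1)] G(1)] by (simp add: borel_measurable_cyl_measure)
  have "AE p in cyl_measure \<Omega> s Y. norm (weak_grad (cyl \<Omega> Y) w p) \<le> B"
    unfolding AE_cyl_measure_iff using weak_grad_AE_eq[OF cyl_open[OF \<Omega>(1)] G(1)]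
    by eventually_elim (use G(2) in auto)
  then show "\<exists>B. AE p in cyl_measure \<Omega> s Y. norm (weak_grad (cyl \<Omega> Y) w p) \<le> B" ..
qed

lemma closure_cyl: "closure (cyl \<Omega> Y) = closure \<Omega> \<times> {0..Y}"
  using sY by (simp add: cyl_def closure_Times)

lemma regular_fun_bounded:
  assumes "regular_fun (cyl \<Omega> Y) w"
  obtains B where "\<And>p. p \<in> closure (cyl \<Omega> Y) \<Longrightarrow> \<bar>w p\<bar> \<le> B"
proof -
  have "compact (closure (cyl \<Omega> Y))"
    unfolding closure_cyl using \<Omega>(2) by (intro compact_Times) (auto simp: compact_closure)
  then have "bounded (w ` closure (cyl \<Omega> Y))"
    using assms by (intro compact_imp_bounded compact_continuous_image) (auto simp: regular_fun_def)
  then obtain B where "\<forall>x\<in>w ` closure (cyl \<Omega> Y). norm x \<le> B"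
    unfolding bounded_iff by blast
  then show thesis
    by (intro that[of B]) auto
qed

lemma regular_fun_ess_bounded:
  assumes "regular_fun (cyl \<Omega> Y) w"
  shows "ess_bounded (cyl_measure \<Omega> s Y) w"
proof -
  obtain B where B: "\<And>p. p \<in> closure (cyl \<Omega> Y) \<Longrightarrow> \<bar>w p\<bar> \<le> B"
    by (rule regular_fun_bounded[OF assms]) (rule that)
  have "w \<in> borel_measurable (lebesgue_on (cyl \<Omega> Y))"
    using assms cyl_sets[OF \<Omega>(1)] continuous_on_subset[OF _ closure_subset]
    by (intro continuous_imp_measurable_on_sets_lebesgue) (auto simp: regular_fun_def)
  moreover have "AE p in cyl_measure \<Omega> s Y. \<bar>w p\<bar> \<le> B"
    using B closure_subset[of "cyl \<Omega> Y"] by (intro AE_I2) auto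
  ultimately show ?thesis
    by (auto simp: ess_bounded_def borel_measurable_cyl_measure)
qed

lemma regular_fun_H1:
  assumes "regular_fun (cyl \<Omega> Y) w"
  shows "w \<in> H1 (cyl_measure \<Omega> s Y) (cyl \<Omega> Y)"
proof -
  note f = finite_measure_cyl_measure[OF \<Omega>(1,2) sY(3,2)]
  obtain B where "AE p in cyl_measure \<Omega> s Y. \<bar>w p\<bar> \<le> B"
    using regular_fun_ess_bounded[OF assms] by (auto simp: ess_bounded_def)
  then have "w \<in> L2 (cyl_measure \<Omega> s Y)"
    using regular_fun_ess_bounded[OF assms] by (intro L2_bounded[OF f]) (auto simp: ess_bounded_def)
  moreover obtain B' where "AE p in cyl_measure \<Omega> s Y. norm (weak_grad (cyl \<Omega> Y) w p) \<le> B'"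
    using regular_fun_weak_grad(3)[OF assms] by blast
  then have "weak_grad (cyl \<Omega> Y) w \<in> L2 (cyl_measure \<Omega> s Y)"
    by (rule L2_bounded[OF f regular_fun_weak_grad(2)[OF assms]])
  ultimately show ?thesis
    using regular_fun_weak_grad(1)[OF assms] by (auto simp: H1_def)
qed

lemma regular_fun_boundary_L2:
  assumes "regular_fun (cyl \<Omega> Y) w"
  shows "(\<lambda>x. w (x, 0)) \<in> L2 (lebesgue_on \<Omega>)"
proof -
  obtain B where B: "\<And>p. p \<in> closure (cyl \<Omega> Y) \<Longrightarrow> \<bar>w p\<bar> \<le> B"
    by (rule regular_fun_bounded[OF assms]) (rule that)
  have mem: "(x, 0) \<in> closure (cyl \<Omega> Y)" if "x \<in> \<Omega>" for x
    using that sY closure_subset[of \<Omega>] by (auto simp: closure_cyl)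
  have fin: "finite_measure (lebesgue_on \<Omega>)"
    using \<Omega> by (intro finite_measure_lebesgue_on bounded_set_imp_lmeasurable) auto
  show ?thesis
  proof (rule L2_bounded[OF fin, of _ B])
    have "continuous_on \<Omega> (\<lambda>x. w (x, 0))"
      by (rule continuous_on_compose2[of "closure (cyl \<Omega> Y)" w])
         (use assms mem in \<open>auto simp: regular_fun_def intro!: continuous_intros\<close>)
    then show "(\<lambda>x. w (x, 0)) \<in> borel_measurable (lebesgue_on \<Omega>)"
      using \<Omega>(1) by (intro continuous_imp_measurable_on_sets_lebesgue) auto
    show "AE x in lebesgue_on \<Omega>. norm (w (x, 0)) \<le> B"
      using B mem by (intro AE_I2) auto
  qed
qed

text \<open>The constant sequence w shows that restriction to y = 0 is a trace; uniqueness then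
  identifies the chosen trace with it almost everywhere.\<close>

lemma regular_fun_tr:
  assumes "regular_fun (cyl \<Omega> Y) w"
  shows "tr \<Omega> s Y w \<in> L2 (lebesgue_on \<Omega>)" "AE x in lebesgue_on \<Omega>. tr \<Omega> s Y w x = w (x, 0)"
proof -
  \<comment> \<open>The distance of w to itself is not zero by mere computation: the gradient of the
    zero function is again a choice, zero only almost everywhere.\<close>
  have z: "weak_grad (cyl \<Omega> Y) (\<lambda>p. w p - w p) \<in> borel_measurable (cyl_measure \<Omega> s Y)"
    "AE p in cyl_measure \<Omega> s Y. weak_grad (cyl \<Omega> Y) (\<lambda>p. w p - w p) p = 0"
  proof -
    note h = regular_fun_weak_grad(1)[OF assms]
    have "has_weak_grad (cyl \<Omega> Y) (\<lambda>p. 1 * w p + (- 1) * w p)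
        (\<lambda>p. 1 *\<^sub>R weak_grad (cyl \<Omega> Y) w p + (- 1) *\<^sub>R weak_grad (cyl \<Omega> Y) w p)"
      by (rule has_weak_grad_lincomb[OF cyl_open[OF \<Omega>(1)] h h])
    then have h0: "has_weak_grad (cyl \<Omega> Y) (\<lambda>p. w p - w p) (\<lambda>_. 0)"
      by simp
    show "weak_grad (cyl \<Omega> Y) (\<lambda>p. w p - w p) \<in> borel_measurable (cyl_measure \<Omega> s Y)"
      using weak_grad_measurable[OF cyl_open[OF \<Omega>(1)] h0] by (simp only: borel_measurable_cyl_measure)
    show "AE p in cyl_measure \<Omega> s Y. weak_grad (cyl \<Omega> Y) (\<lambda>p. w p - w p) p = 0"
      unfolding AE_cyl_measure_iff by (rule weak_grad_AE_eq[OF cyl_open[OF \<Omega>(1)] h0])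
  qed
  have "l2norm (cyl_measure \<Omega> s Y) (weak_grad (cyl \<Omega> Y) (\<lambda>p. w p - w p)) = l2norm (cyl_measure \<Omega> s Y) (\<lambda>_. 0 :: (real^'n) \<times> real)"
    by (rule l2norm_cong_AE) (use z in auto)
  then have "h1norm (cyl_measure \<Omega> s Y) (cyl \<Omega> Y) (\<lambda>p. w p - w p) = 0"
    by (simp add: h1norm_def l2norm_def)
  moreover have "l2norm (lebesgue_on \<Omega>) (\<lambda>x. w (x, 0) - w (x, 0)) = 0"
    by (simp add: l2norm_def)
  ultimately have t: "has_trace \<Omega> s Y w (\<lambda>x. w (x, 0))"
    unfolding has_trace_def using regular_fun_H1[OF assms] regular_fun_boundary_L2[OF assms] assms
    by (intro conjI exI[of _ "\<lambda>_. w"]) (auto simp: regular_fun_def)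
  then have "has_trace \<Omega> s Y w (tr \<Omega> s Y w)"
    unfolding tr_def by (rule someI[where P="has_trace \<Omega> s Y w"])
  then show "tr \<Omega> s Y w \<in> L2 (lebesgue_on \<Omega>)" "AE x in lebesgue_on \<Omega>. tr \<Omega> s Y w x = w (x, 0)"
    using has_trace_unique[OF \<Omega>(1,2) sY(3,1) _ t] by (auto simp: has_trace_def)
qed

lemma tr_l2norm:
  assumes "regular_fun (cyl \<Omega> Y) w"
  shows "l2norm (lebesgue_on \<Omega>) (tr \<Omega> s Y w) = l2norm (lebesgue_on \<Omega>) (\<lambda>x. w (x, 0))"
  using regular_fun_tr[OF assms] regular_fun_boundary_L2[OF assms]
  by (intro l2norm_cong_AE) (auto simp: L2_def)

text \<open>Two names for the first argument serve both uses: u is a trace and v its restriction in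
  the inertia term, while u = v is the source on the right-hand side.\<close>

lemma tr_l2inner:
  assumes "regular_fun (cyl \<Omega> Y) w" "u \<in> L2 (lebesgue_on \<Omega>)" "v \<in> L2 (lebesgue_on \<Omega>)"
    "AE x in lebesgue_on \<Omega>. u x = v x"
  shows "l2inner (lebesgue_on \<Omega>) u (tr \<Omega> s Y w) = l2inner (lebesgue_on \<Omega>) v (\<lambda>x. w (x, 0))"
  unfolding l2inner_def
proof (rule integral_cong_AE)
  show "AE x in lebesgue_on \<Omega>. u x * tr \<Omega> s Y w x = v x * w (x, 0)"
    using assms(4) regular_fun_tr(2)[OF assms(1)] by eventually_elim simp
qed (use assms(2,3) regular_fun_tr(1)[OF assms(1)] regular_fun_boundary_L2[OF assms(1)] in
      \<open>auto simp: L2_def\<close>)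

end

subsection \<open>The bilinear form and the energy estimate\<close>

lemma d_const_pos: "0 < s \<Longrightarrow> s < 1 \<Longrightarrow> 0 < d_const s"
  by (simp add: d_const_def Gamma_real_pos)

text \<open>Coordinates expose sums of products of essentially bounded factors.\<close>

lemma diagA_inner_eq_sum:
  "diagA B \<xi> \<bullet> \<eta>
     = (\<Sum>i\<in>UNIV. \<Sum>j\<in>UNIV. B $ i $ j * (fst \<xi> $ j * fst \<eta> $ i)) + snd \<xi> * snd \<eta>"
  by (simp add: diagA_def inner_prod_def inner_vec_def matrix_vector_mult_def sum_distrib_right mult.assoc)

lemma diagA_lincomb: "diagA B (a *\<^sub>R \<xi> + b *\<^sub>R \<eta>) = a *\<^sub>R diagA B \<xi> + b *\<^sub>R diagA B \<eta>"
  by (simp add: diagA_def matrix_vector_right_distrib matrix_vector_mult_scaleR)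

lemma diagA_symmetric:
  assumes "transpose B = B"
  shows "diagA B \<xi> \<bullet> \<eta> = diagA B \<eta> \<bullet> \<xi>"
proof -
  have "(B *v x) \<bullet> y = (B *v y) \<bullet> x" for x y
    using dot_lmul_matrix[of y B x] vector_transpose_matrix[of y B] assms by (metis inner_commute)
  then show ?thesis
    by (simp add: diagA_def inner_prod_def mult.commute)
qed

definition form_density ::
    "(real^'n) set \<Rightarrow> (real^'n \<Rightarrow> real^'n^'n) \<Rightarrow> (real^'n \<Rightarrow> real) \<Rightarrow> real \<Rightarrow>
     ((real^'n) \<times> real \<Rightarrow> real) \<Rightarrow> ((real^'n) \<times> real \<Rightarrow> real) \<Rightarrow> (real^'n) \<times> real \<Rightarrow> real" where
  "form_density \<Omega> A c Y w \<phi> p =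
     diagA (A (fst p)) (weak_grad (cyl \<Omega> Y) w p) \<bullet> weak_grad (cyl \<Omega> Y) \<phi> p + c (fst p) * w p * \<phi> p"

lemma aY_eq_form_density:
  "aY \<Omega> A c s Y w \<phi> = 1 / d_const s * (\<integral>p. form_density \<Omega> A c Y w \<phi> p \<partial>cyl_measure \<Omega> s Y)"
  by (simp add: aY_def form_density_def)

context
  fixes \<Omega> :: "(real^'n) set" and s Y :: real and A :: "real^'n \<Rightarrow> real^'n^'n" and c :: "real^'n \<Rightarrow> real"
  assumes \<Omega>: "open \<Omega>" "bounded \<Omega>" "\<Omega> \<noteq> {}" and sY: "0 < s" "s < 1" "0 < Y"
    and A: "admissible_diffusion \<Omega> A" and c: "admissible_reaction \<Omega> c"
begin

lemma diffusion_ess_bounded: "ess_bounded (cyl_measure \<Omega> s Y) (\<lambda>p. A (fst p) $ i $ j)"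
proof -
  obtain L where L: "L-lipschitz_on \<Omega> A"
    using A by (auto simp: admissible_diffusion_def)
  have "bounded (A ` \<Omega>)"
    using \<Omega>(2) L bounded_uniformly_continuous_image lipschitz_on_uniformly_continuous by blast
  then obtain B where B: "\<forall>M\<in>A ` \<Omega>. norm M \<le> B"
    unfolding bounded_iff by blast
  have "\<bar>A x $ i $ j\<bar> \<le> B" if "x \<in> \<Omega>" for x
  proof -
    have "\<bar>A x $ i $ j\<bar> \<le> norm (A x $ i)" by (rule component_le_norm_cart)
    also have "\<dots> \<le> norm (A x)" by (rule Finite_Cartesian_Product.norm_nth_le)
    finally show ?thesis using B that by force
  qed
  then have "AE p in cyl_measure \<Omega> s Y. \<bar>A (fst p) $ i $ j\<bar> \<le> B"
    by (intro AE_I2) (auto simp: cyl_def)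
  moreover have "continuous_on (cyl \<Omega> Y) (\<lambda>p. A (fst p) $ i $ j)"
    by (intro continuous_intros continuous_on_compose2[OF lipschitz_on_continuous_on[OF L]]) (auto simp: cyl_def)
  then have "(\<lambda>p. A (fst p) $ i $ j) \<in> borel_measurable (lebesgue_on (cyl \<Omega> Y))"
    by (rule continuous_imp_measurable_on_sets_lebesgue[OF _ cyl_sets[OF \<Omega>(1)]])
  ultimately show ?thesis
    by (auto simp: ess_bounded_def borel_measurable_cyl_measure)
qed

lemma reaction_ess_bounded: "ess_bounded (cyl_measure \<Omega> s Y) (\<lambda>p. c (fst p))"
proof -
  obtain B where "AE x in lebesgue_on \<Omega>. \<bar>c x\<bar> \<le> B"
    using c by (auto simp: admissible_reaction_def)
  from cyl_AE_fst[OF \<Omega>(1) this] have "AE p in cyl_measure \<Omega> s Y. \<bar>c (fst p)\<bar> \<le> B"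
    unfolding AE_cyl_measure_iff .
  then show ?thesis
    using cyl_measurable_fst[OF \<Omega>(1), of c Y] c
    by (auto simp: ess_bounded_def borel_measurable_cyl_measure admissible_reaction_def)
qed

lemma weak_grad_component_ess_bounded:
  assumes "regular_fun (cyl \<Omega> Y) w"
  shows "ess_bounded (cyl_measure \<Omega> s Y) (\<lambda>p. fst (weak_grad (cyl \<Omega> Y) w p) $ j)"
    and "ess_bounded (cyl_measure \<Omega> s Y) (\<lambda>p. snd (weak_grad (cyl \<Omega> Y) w p))"
proof -
  note g = regular_fun_weak_grad[OF \<Omega> sY assms]
  obtain B where B: "AE p in cyl_measure \<Omega> s Y. norm (weak_grad (cyl \<Omega> Y) w p) \<le> B"
    using g(3) by blast
  have le: "\<bar>fst x $ j\<bar> \<le> norm x" "\<bar>snd x\<bar> \<le> norm x" for x :: "(real^'n) \<times> real"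
    using component_le_norm_cart[of "fst x" j] norm_fst_le[of "fst x" "snd x"] norm_snd_le[of "snd x" "fst x"]
    by auto
  have "AE p in cyl_measure \<Omega> s Y. \<bar>fst (weak_grad (cyl \<Omega> Y) w p) $ j\<bar> \<le> B"
    using B by eventually_elim (rule order_trans[OF le(1)])
  moreover have "(\<lambda>p. fst (weak_grad (cyl \<Omega> Y) w p) $ j) \<in> borel_measurable (cyl_measure \<Omega> s Y)"
    by (rule borel_measurable_continuous_on[OF _ g(2), of "\<lambda>x. fst x $ j"]) (intro continuous_intros)
  ultimately show "ess_bounded (cyl_measure \<Omega> s Y) (\<lambda>p. fst (weak_grad (cyl \<Omega> Y) w p) $ j)"
    by (auto simp: ess_bounded_def)
  have "AE p in cyl_measure \<Omega> s Y. \<bar>snd (weak_grad (cyl \<Omega> Y) w p)\<bar> \<le> B"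
    using B by eventually_elim (rule order_trans[OF le(2)])
  moreover have "(\<lambda>p. snd (weak_grad (cyl \<Omega> Y) w p)) \<in> borel_measurable (cyl_measure \<Omega> s Y)"
    by (rule borel_measurable_continuous_on[OF _ g(2), of snd]) (intro continuous_intros)
  ultimately show "ess_bounded (cyl_measure \<Omega> s Y) (\<lambda>p. snd (weak_grad (cyl \<Omega> Y) w p))"
    by (auto simp: ess_bounded_def)
qed

lemma form_density_integrable:
  assumes "regular_fun (cyl \<Omega> Y) w" "regular_fun (cyl \<Omega> Y) \<phi>"
  shows "integrable (cyl_measure \<Omega> s Y) (form_density \<Omega> A c Y w \<phi>)"
proof (rule ess_bounded_integrable[OF finite_measure_cyl_measure[OF \<Omega>(1,2) sY(3,2)]])
  show "ess_bounded (cyl_measure \<Omega> s Y) (form_density \<Omega> A c Y w \<phi>)"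
    unfolding form_density_def[abs_def] diagA_inner_eq_sum
    by (intro ess_bounded_add ess_bounded_sum ess_bounded_mult finite_class.finite_UNIV
          diffusion_ess_bounded reaction_ess_bounded weak_grad_component_ess_bounded assms
          regular_fun_ess_bounded[OF \<Omega> sY])
qed

text \<open>The integrands agree pointwise on the cylinder by symmetry of A, so the identity holds
  for arbitrary arguments.\<close>

lemma aY_symmetric: "aY \<Omega> A c s Y w \<phi> = aY \<Omega> A c s Y \<phi> w"
proof -
  have "form_density \<Omega> A c Y w \<phi> p = form_density \<Omega> A c Y \<phi> w p" if "p \<in> space (cyl_measure \<Omega> s Y)" for p
  proof -
    have "fst p \<in> \<Omega>" using that by (auto simp: cyl_def)
    then have "transpose (A (fst p)) = A (fst p)"
      using A by (simp add: admissible_diffusion_def)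
    from diagA_symmetric[OF this] show ?thesis
      by (simp add: form_density_def)
  qed
  then have "(\<integral>p. form_density \<Omega> A c Y w \<phi> p \<partial>cyl_measure \<Omega> s Y)
      = (\<integral>p. form_density \<Omega> A c Y \<phi> w p \<partial>cyl_measure \<Omega> s Y)"
    by (rule Bochner_Integration.integral_cong[OF refl])
  then show ?thesis
    unfolding aY_eq_form_density by simp
qed

lemma aY_nonneg: "0 \<le> aY \<Omega> A c s Y w w"
proof -
  have "AE p in cyl_measure \<Omega> s Y. 0 \<le> c (fst p)"
    unfolding AE_cyl_measure_iff using c by (intro cyl_AE_fst[OF \<Omega>(1)]) (simp add: admissible_reaction_def)
  moreover have "AE p in cyl_measure \<Omega> s Y. p \<in> cyl \<Omega> Y"
    by (intro AE_I2) simp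
  ultimately have "AE p in cyl_measure \<Omega> s Y. 0 \<le> form_density \<Omega> A c Y w w p"
  proof eventually_elim
    case (elim p)
    obtain a where a: "0 < a" "\<forall>x\<in>\<Omega>. \<forall>\<xi>. a * (norm \<xi>)\<^sup>2 \<le> \<xi> \<bullet> (A x *v \<xi>)"
      using A by (auto simp: admissible_diffusion_def)
    have "0 \<le> \<xi> \<bullet> (A (fst p) *v \<xi>)" for \<xi>
    proof -
      have "0 \<le> a * (norm \<xi>)\<^sup>2" using a(1) by simp
      also have "\<dots> \<le> \<xi> \<bullet> (A (fst p) *v \<xi>)" using a(2) elim(2) by (auto simp: cyl_def)
      finally show ?thesis .
    qed
    then have "0 \<le> diagA (A (fst p)) \<xi> \<bullet> \<xi>" for \<xi>
      by (simp add: diagA_def inner_prod_def inner_commute)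
    then show ?case
      using elim(1) by (simp add: form_density_def mult.assoc)
  qed
  then show ?thesis
    unfolding aY_eq_form_density using d_const_pos[OF sY(1,2)]
    by (intro mult_nonneg_nonneg integral_nonneg_AE) auto
qed

text \<open>The chosen gradient is linear almost everywhere, which the integral does not notice;
  regularity gives the integrability needed to split it.\<close>

lemma aY_lincomb_left:
  assumes w: "regular_fun (cyl \<Omega> Y) w" "regular_fun (cyl \<Omega> Y) w'" and \<phi>: "regular_fun (cyl \<Omega> Y) \<phi>"
  shows "aY \<Omega> A c s Y (\<lambda>p. a * w p + b * w' p) \<phi> = a * aY \<Omega> A c s Y w \<phi> + b * aY \<Omega> A c s Y w' \<phi>"
proof -
  note o = cyl_open[OF \<Omega>(1), of Y]
  note i = form_density_integrable[OF w(1) \<phi>] form_density_integrable[OF w(2) \<phi>]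
    form_density_integrable[OF regular_fun_lincomb[OF o w, of a b] \<phi>]
  have "AE p in cyl_measure \<Omega> s Y. weak_grad (cyl \<Omega> Y) (\<lambda>p. a * w p + b * w' p) p
      = a *\<^sub>R weak_grad (cyl \<Omega> Y) w p + b *\<^sub>R weak_grad (cyl \<Omega> Y) w' p"
    unfolding AE_cyl_measure_iff
    by (rule weak_grad_lincomb_AE[OF o regular_fun_weak_grad(1)[OF \<Omega> sY w(1)] regular_fun_weak_grad(1)[OF \<Omega> sY w(2)]])
  then have "AE p in cyl_measure \<Omega> s Y. form_density \<Omega> A c Y (\<lambda>p. a * w p + b * w' p) \<phi> p
      = a * form_density \<Omega> A c Y w \<phi> p + b * form_density \<Omega> A c Y w' \<phi> p"
    by eventually_elim (simp add: form_density_def diagA_lincomb inner_add_left algebra_simps)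
  then have "(\<integral>p. form_density \<Omega> A c Y (\<lambda>p. a * w p + b * w' p) \<phi> p \<partial>cyl_measure \<Omega> s Y)
      = (\<integral>p. a * form_density \<Omega> A c Y w \<phi> p + b * form_density \<Omega> A c Y w' \<phi> p \<partial>cyl_measure \<Omega> s Y)"
    using i by (intro integral_cong_AE) auto
  also have "\<dots> = a * (\<integral>p. form_density \<Omega> A c Y w \<phi> p \<partial>cyl_measure \<Omega> s Y)
      + b * (\<integral>p. form_density \<Omega> A c Y w' \<phi> p \<partial>cyl_measure \<Omega> s Y)"
    using i by simp
  finally show ?thesis
    unfolding aY_eq_form_density by (simp add: algebra_simps)
qed

text \<open>A difference-of-squares identity in which symmetry cancels the mixed terms. With w and
  w' the two midpoint values, the left arguments are the weighted average and the test function of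
  the scheme.\<close>

lemma aY_half_sum_twice_diff:
  assumes "regular_fun (cyl \<Omega> Y) w" "regular_fun (cyl \<Omega> Y) w'"
  shows "aY \<Omega> A c s Y (\<lambda>p. 1 / 2 * w p + 1 / 2 * w' p) (\<lambda>p. 2 * w p + (- 2) * w' p)
           = aY \<Omega> A c s Y w w - aY \<Omega> A c s Y w' w'"
proof -
  note r = regular_fun_lincomb[OF cyl_open[OF \<Omega>(1), of Y] assms, of 2 "- 2"]
  have right: "aY \<Omega> A c s Y v (\<lambda>p. 2 * w p + (- 2) * w' p) = 2 * aY \<Omega> A c s Y v w + (- 2) * aY \<Omega> A c s Y v w'"
    if "regular_fun (cyl \<Omega> Y) v" for v
    using aY_lincomb_left[OF assms that, of 2 "- 2"]
    by (simp only: aY_symmetric[of v])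
  show ?thesis
    unfolding aY_lincomb_left[OF assms r] right[OF assms(1)] right[OF assms(2)]
    using aY_symmetric[of w w'] by (simp add: algebra_simps)
qed

text \<open>Testing with \<open>u - t = 2 (m\<^sub>1 - m\<^sub>0)\<close> makes both terms on the left of the scheme telescope.\<close>

lemma trapezoidal_energy_step:
  assumes u: "regular_fun (cyl \<Omega> Y) u" and v: "regular_fun (cyl \<Omega> Y) v" and t: "regular_fun (cyl \<Omega> Y) t"
    and dt: "0 < dt" and F: "F \<in> L2 (lebesgue_on \<Omega>)"
    and m1: "m1 = (\<lambda>p. (u p + v p) / 2)" and m0: "m0 = (\<lambda>p. (v p + t p) / 2)"
    and d1: "d1 = (\<lambda>p. (u p - v p) / dt)" and d0: "d0 = (\<lambda>p. (v p - t p) / dt)"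
    and eq: "1 / dt\<^sup>2 * l2inner (lebesgue_on \<Omega>) (tr \<Omega> s Y (\<lambda>p. u p - 2 * v p + t p))
                 (tr \<Omega> s Y (\<lambda>p. u p - t p))
             + aY \<Omega> A c s Y (\<lambda>p. (u p + 2 * v p + t p) / 4) (\<lambda>p. u p - t p)
             = l2inner (lebesgue_on \<Omega>) F (tr \<Omega> s Y (\<lambda>p. u p - t p))"
  shows "sqrt ((l2norm (lebesgue_on \<Omega>) (tr \<Omega> s Y d1))\<^sup>2 + aY \<Omega> A c s Y m1 m1)
    \<le> sqrt ((l2norm (lebesgue_on \<Omega>) (tr \<Omega> s Y d0))\<^sup>2 + aY \<Omega> A c s Y m0 m0)
      + dt * l2norm (lebesgue_on \<Omega>) F"
proof -
  note o = cyl_open[OF \<Omega>(1), of Y]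
  define N where "N = lebesgue_on \<Omega>"
  have lc: "regular_fun (cyl \<Omega> Y) w" if "regular_fun (cyl \<Omega> Y) w1" "regular_fun (cyl \<Omega> Y) w2"
    "w = (\<lambda>p. a * w1 p + b * w2 p)" for w w1 w2 a b
    using regular_fun_lincomb[OF o that(1,2)] that(3) by simp
  have rm1: "regular_fun (cyl \<Omega> Y) m1"
    by (rule lc[OF u v, of _ "1 / 2" "1 / 2"]) (auto simp: m1 fun_eq_iff field_simps)
  have rm0: "regular_fun (cyl \<Omega> Y) m0"
    by (rule lc[OF v t, of _ "1 / 2" "1 / 2"]) (auto simp: m0 fun_eq_iff field_simps)
  have rd1: "regular_fun (cyl \<Omega> Y) d1"
    by (rule lc[OF u v, of _ "1 / dt" "- 1 / dt"]) (auto simp: d1 fun_eq_iff diff_divide_distrib)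
  have rd0: "regular_fun (cyl \<Omega> Y) d0"
    by (rule lc[OF v t, of _ "1 / dt" "- 1 / dt"]) (auto simp: d0 fun_eq_iff diff_divide_distrib)
  have rW: "regular_fun (cyl \<Omega> Y) (\<lambda>p. u p - t p)"
    by (rule lc[OF u t, of _ 1 "- 1"]) auto
  \<comment> \<open>The second difference is dt times d1 - d0.\<close>
  have rD: "regular_fun (cyl \<Omega> Y) (\<lambda>p. u p - 2 * v p + t p)"
    by (rule lc[OF rd1 rd0, of _ dt "- dt"]) (use dt in \<open>auto simp: d1 d0 fun_eq_iff field_simps\<close>)
  \<comment> \<open>Restrictions to y = 0 stand in for the chosen traces, so that the algebra holds
    pointwise; the traces return in the last line.\<close>
  define D1 where "D1 x = d1 (x, 0)" for x
  define D0 where "D0 x = d0 (x, 0)" for x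
  have D2: "D1 \<in> L2 N" "D0 \<in> L2 N"
    unfolding D1_def D0_def N_def by (intro regular_fun_boundary_L2[OF \<Omega> sY] rd1 rd0)+
  have W: "u (x, 0) - t (x, 0) = dt * (D1 x + D0 x)" for x
    using dt by (simp add: D1_def D0_def d1 d0 field_simps)
  have "1 / dt\<^sup>2 * l2inner N (tr \<Omega> s Y (\<lambda>p. u p - 2 * v p + t p)) (tr \<Omega> s Y (\<lambda>p. u p - t p))
      = 1 / dt\<^sup>2 * l2inner N (\<lambda>x. u (x, 0) - 2 * v (x, 0) + t (x, 0)) (\<lambda>x. u (x, 0) - t (x, 0))"
    unfolding N_def
    by (intro arg_cong[of _ _ "\<lambda>r. 1 / dt\<^sup>2 * r"] tr_l2inner[OF \<Omega> sY rW regular_fun_tr(1)[OF \<Omega> sY rD]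
          regular_fun_boundary_L2[OF \<Omega> sY rD] regular_fun_tr(2)[OF \<Omega> sY rD]])
  also have "\<dots> = (\<integral>x. 1 / dt\<^sup>2 * ((u (x, 0) - 2 * v (x, 0) + t (x, 0)) * (u (x, 0) - t (x, 0))) \<partial>N)"
    by (simp add: l2inner_def)
  also have "\<dots> = (\<integral>x. (norm (D1 x))\<^sup>2 - (norm (D0 x))\<^sup>2 \<partial>N)"
  proof (rule Bochner_Integration.integral_cong[OF refl])
    fix x
    have "(D1 x)\<^sup>2 - (D0 x)\<^sup>2 = 1 / dt\<^sup>2 * ((u (x, 0) - v (x, 0))\<^sup>2 - (v (x, 0) - t (x, 0))\<^sup>2)"
      unfolding D1_def D0_def d1 d0 power_divide by (simp add: right_diff_distrib)
    also have "(u (x, 0) - v (x, 0))\<^sup>2 - (v (x, 0) - t (x, 0))\<^sup>2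
        = (u (x, 0) - 2 * v (x, 0) + t (x, 0)) * (u (x, 0) - t (x, 0))"
      by (simp add: power2_eq_square algebra_simps)
    finally show "1 / dt\<^sup>2 * ((u (x, 0) - 2 * v (x, 0) + t (x, 0)) * (u (x, 0) - t (x, 0)))
        = (norm (D1 x))\<^sup>2 - (norm (D0 x))\<^sup>2"
      by simp
  qed
  also have "\<dots> = (l2norm N D1)\<^sup>2 - (l2norm N D0)\<^sup>2"
    using D2 by (simp add: l2norm_sq L2_def)
  finally have e1: "1 / dt\<^sup>2 * l2inner N (tr \<Omega> s Y (\<lambda>p. u p - 2 * v p + t p)) (tr \<Omega> s Y (\<lambda>p. u p - t p))
      = (l2norm N D1)\<^sup>2 - (l2norm N D0)\<^sup>2" .
  have "(\<lambda>p. (u p + 2 * v p + t p) / 4) = (\<lambda>p. 1 / 2 * m1 p + 1 / 2 * m0 p)"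
    "(\<lambda>p. u p - t p) = (\<lambda>p. 2 * m1 p + (- 2) * m0 p)"
    by (auto simp: m1 m0 fun_eq_iff field_simps)
  then have e2: "aY \<Omega> A c s Y (\<lambda>p. (u p + 2 * v p + t p) / 4) (\<lambda>p. u p - t p)
      = aY \<Omega> A c s Y m1 m1 - aY \<Omega> A c s Y m0 m0"
    using aY_half_sum_twice_diff[OF rm1 rm0] by simp
  have "l2inner N F (tr \<Omega> s Y (\<lambda>p. u p - t p)) = l2inner N F (\<lambda>x. u (x, 0) - t (x, 0))"
    unfolding N_def by (rule tr_l2inner[OF \<Omega> sY rW F F]) simp
  also have "\<dots> = (\<integral>x. dt * (F x \<bullet> D1 x) + dt * (F x \<bullet> D0 x) \<partial>N)"
    unfolding l2inner_def W by (simp add: algebra_simps)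
  also have "\<dots> = dt * (\<integral>x. F x \<bullet> D1 x \<partial>N) + dt * (\<integral>x. F x \<bullet> D0 x \<partial>N)"
    using L2_inner_integrable[OF F[folded N_def] D2(1)] L2_inner_integrable[OF F[folded N_def] D2(2)] by simp
  also have "\<dots> \<le> dt * (l2norm N F * l2norm N D1) + dt * (l2norm N F * l2norm N D0)"
    using l2_Cauchy_Schwarz[OF F[folded N_def] D2(1)] l2_Cauchy_Schwarz[OF F[folded N_def] D2(2)] dt
    by (intro add_mono mult_left_mono) auto
  finally have e3: "l2inner N F (tr \<Omega> s Y (\<lambda>p. u p - t p)) \<le> dt * l2norm N F * (l2norm N D1 + l2norm N D0)"
    by (simp add: algebra_simps)
  define E1 where "E1 = sqrt ((l2norm N D1)\<^sup>2 + aY \<Omega> A c s Y m1 m1)"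
  define E0 where "E0 = sqrt ((l2norm N D0)\<^sup>2 + aY \<Omega> A c s Y m0 m0)"
  have E2: "E1\<^sup>2 = (l2norm N D1)\<^sup>2 + aY \<Omega> A c s Y m1 m1" "E0\<^sup>2 = (l2norm N D0)\<^sup>2 + aY \<Omega> A c s Y m0 m0"
    unfolding E1_def E0_def using aY_nonneg by auto
  have Ege: "l2norm N D1 \<le> E1" "l2norm N D0 \<le> E0"
    unfolding E1_def E0_def using aY_nonneg by (auto intro!: real_le_rsqrt)
  have E_nonneg: "0 \<le> E1" "0 \<le> E0"
    unfolding E1_def E0_def using aY_nonneg by auto
  define \<delta> where "\<delta> = dt * l2norm N F"
  have \<delta>: "0 \<le> \<delta>" unfolding \<delta>_def using dt by simp
  have "E1\<^sup>2 - E0\<^sup>2 = l2inner N F (tr \<Omega> s Y (\<lambda>p. u p - t p))"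
    using eq e1 e2 unfolding E2 N_def by linarith
  also have "\<dots> \<le> \<delta> * (l2norm N D1 + l2norm N D0)"
    using e3 unfolding \<delta>_def .
  also have "\<dots> \<le> \<delta> * (E1 + E0)"
    using Ege \<delta> by (intro mult_left_mono) auto
  finally have "(E1 - E0) * (E1 + E0) \<le> \<delta> * (E1 + E0)"
    by (simp add: power2_eq_square algebra_simps)
  \<comment> \<open>Divide by E1 + E0 when it is positive. Otherwise both terms vanish and the claim
    reads 0 \<le> \<delta>.\<close>
  then have "E1 \<le> E0 + \<delta>"
    using E_nonneg \<delta> by (cases "0 < E1 + E0") (auto dest: mult_right_le_imp_le)
  then show ?thesis
    unfolding E1_def E0_def \<delta>_def D1_def D0_def N_def tr_l2norm[OF \<Omega> sY rd1] tr_l2norm[OF \<Omega> sY rd0] .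
qed

end

section \<open>Summation of the energy steps over the time grid\<close>

theorem lemma6p5:
  fixes \<Omega> :: "(real^'n) set"
    and A :: "real^'n \<Rightarrow> real^'n^'n"
    and c :: "real^'n \<Rightarrow> real"
    and lam :: "nat \<Rightarrow> real" and \<phi> :: "nat \<Rightarrow> real^'n \<Rightarrow> real"
    and s Y T :: real
  assumes "open_convex_polytope \<Omega>"
    and "admissible_diffusion \<Omega> A"
    and "admissible_reaction \<Omega> c"
    and "dirichlet_eigenpairs \<Omega> A c lam \<phi>"
    and "0 < s" and "s < 1"
    and "0 < Y" and "0 < T"
  shows "\<exists>C>0. \<forall>(\<T> :: (real^'n) set set) (\<sigma> :: real) (M :: nat) (slope :: real) (K :: nat)
           (f :: real \<Rightarrow> real^'n \<Rightarrow> real) g h w (V :: nat \<Rightarrow> (real^'n) \<times> real \<Rightarrow> real) (dt :: real)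
           (F :: nat \<Rightarrow> real^'n \<Rightarrow> real).
         conforming_mesh \<Omega> \<T> \<and> 0 < \<sigma> \<and> \<sigma> < 1 \<and> 1 \<le> M \<and> 1 \<le> K \<and>
         dt = T / real K \<and> F = (\<lambda>k. f (real k * dt)) \<and>
         continuous_L2 \<Omega> T f \<and>
         g \<in> HH \<Omega> lam \<phi> s \<and> h \<in> HH \<Omega> lam \<phi> s \<and> w \<in> HH \<Omega> lam \<phi> s \<and>
         trapezoidal_solution \<Omega> A c s Y (VV \<Omega> Y \<T> \<sigma> M slope) K dt F g h w V
         \<longrightarrow>
         (\<forall>l\<in>{1..K}.
            l2norm (lebesgue_on \<Omega>) (tr \<Omega> s Y (dquot dt V l))
            + energy_norm \<Omega> A c s Y (mid V (l - 1))
            \<le> C * (l2norm (lebesgue_on \<Omega>) (tr \<Omega> s Y (dquot dt V 1))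
                   + energy_norm \<Omega> A c s Y (mid V 0)
                   + (\<Sum>k | k \<in> {1..l} \<and> k < K. dt * l2norm (lebesgue_on \<Omega>) (cavg F k))))"
proof -
  have \<Omega>: "open \<Omega>" "bounded \<Omega>" "\<Omega> \<noteq> {}"
    using assms(1) by (auto simp: open_convex_polytope_def)
  define E where "E V dt k = sqrt ((l2norm (lebesgue_on \<Omega>) (tr \<Omega> s Y (dquot dt V k)))\<^sup>2
      + aY \<Omega> A c s Y (mid V (k - 1)) (mid V (k - 1)))" for V dt k
  have nonneg: "0 \<le> aY \<Omega> A c s Y w w" for w
    by (rule aY_nonneg[OF \<Omega> assms(5-7) assms(2,3)])
  have E_le: "E V dt k \<le> l2norm (lebesgue_on \<Omega>) (tr \<Omega> s Y (dquot dt V k)) + energy_norm \<Omega> A c s Y (mid V (k - 1))"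
    for V dt k
    unfolding E_def energy_norm_def using sqrt_add_le_add_sqrt[of "(l2norm (lebesgue_on \<Omega>) (tr \<Omega> s Y (dquot dt V k)))\<^sup>2"
      "aY \<Omega> A c s Y (mid V (k - 1)) (mid V (k - 1))"] nonneg by simp
  \<comment> \<open>Each of the two norms is at most E. This is the only place where the factor 2 is
    lost, since the converse comparison \<open>E_le\<close> has constant 1.\<close>
  have le_E: "l2norm (lebesgue_on \<Omega>) (tr \<Omega> s Y (dquot dt V k)) + energy_norm \<Omega> A c s Y (mid V (k - 1)) \<le> 2 * E V dt k"
    for V dt k
  proof -
    have "l2norm (lebesgue_on \<Omega>) (tr \<Omega> s Y (dquot dt V k)) \<le> E V dt k"
      unfolding E_def using nonneg by (auto intro!: real_le_rsqrt)
    moreover have "energy_norm \<Omega> A c s Y (mid V (k - 1)) \<le> E V dt k"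
      unfolding E_def energy_norm_def by (intro real_sqrt_le_mono) simp
    ultimately show ?thesis by linarith
  qed
  have main: "l2norm (lebesgue_on \<Omega>) (tr \<Omega> s Y (dquot dt V l)) + energy_norm \<Omega> A c s Y (mid V (l - 1))
      \<le> 2 * (l2norm (lebesgue_on \<Omega>) (tr \<Omega> s Y (dquot dt V 1)) + energy_norm \<Omega> A c s Y (mid V 0)
             + (\<Sum>k | k \<in> {1..l} \<and> k < K. dt * l2norm (lebesgue_on \<Omega>) (cavg F k)))"
    if mesh: "conforming_mesh \<Omega> \<T>" and \<sigma>: "0 < \<sigma>" and M: "1 \<le> M" and K: "1 \<le> K"
      and dt: "dt = T / real K" and F: "F = (\<lambda>k. f (real k * dt))" and f: "continuous_L2 \<Omega> T f"
      and sol: "trapezoidal_solution \<Omega> A c s Y (VV \<Omega> Y \<T> \<sigma> M slope) K dt F g h w V"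
      and l: "l \<in> {1..K}"
    for \<T> :: "(real^'n) set set" and \<sigma> slope dt :: real and M K l :: nat
      and f :: "real \<Rightarrow> real^'n \<Rightarrow> real" and F :: "nat \<Rightarrow> real^'n \<Rightarrow> real" and g h w V
  proof -
    have dt0: "0 < dt"
      using K dt assms(8) by simp
    \<comment> \<open>The values at 0 and 1 are Galerkin projections; the value at k \<ge> 2 is
      produced by the scheme at index k - 1.\<close>
    have VK: "V k \<in> VV \<Omega> Y \<T> \<sigma> M slope" if k: "k \<le> K" for k
    proof (cases "k \<le> 1")
      case True
      then have "k = 0 \<or> k = 1" by auto
      then show ?thesis
        using sol unfolding trapezoidal_solution_def galerkin_proj_def by blast
    next
      case False
      then have "k - 1 \<in> {1..K - 1}" "k - 1 + 1 = k" using k by auto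
      then show ?thesis
        using sol unfolding trapezoidal_solution_def by metis
    qed
    have reg: "regular_fun (cyl \<Omega> Y) (V k)" if "k \<le> K" for k
      by (rule VV_regular_fun[OF assms(1) mesh \<sigma> M assms(7) VK[OF that]])
    have F2: "F k \<in> L2 (lebesgue_on \<Omega>)" if "k \<le> K" for k
    proof -
      have "real k * dt \<in> {0..T}"
        using that K assms(8) by (auto simp: dt field_simps)
      then show ?thesis
        using f by (simp add: F continuous_L2_def)
    qed
    have step: "E V dt (k + 1) \<le> E V dt k + dt * l2norm (lebesgue_on \<Omega>) (cavg F k)" if k: "k \<in> {1..K - 1}" for k
    proof -
      have kK: "k + 1 \<le> K" "k \<le> K" "k - 1 \<le> K" "k - 1 + 1 = k"
        using k K by auto
      have "(\<lambda>x. 1 / 2 * F k x + 1 / 4 * (F (k + 1) x + F (k - 1) x)) \<in> L2 (lebesgue_on \<Omega>)"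
        by (intro L2_add L2_mult F2 kK)
      moreover have "(\<lambda>x. 1 / 2 * F k x + 1 / 4 * (F (k + 1) x + F (k - 1) x)) = cavg F k"
        by (auto simp: cavg_def fun_eq_iff field_simps)
      ultimately have cF: "cavg F k \<in> L2 (lebesgue_on \<Omega>)"
        by (simp only:)
      have "(\<lambda>p. 1 * V (k + 1) p + (- 1) * V (k - 1) p) \<in> VV \<Omega> Y \<T> \<sigma> M slope"
        by (intro VV_lincomb VK kK)
      then have W: "(\<lambda>p. V (k + 1) p - V (k - 1) p) \<in> VV \<Omega> Y \<T> \<sigma> M slope"
        by simp
      have eq: "1 / dt\<^sup>2 * l2inner (lebesgue_on \<Omega>) (tr \<Omega> s Y (\<lambda>p. V (k + 1) p - 2 * V k p + V (k - 1) p))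
                 (tr \<Omega> s Y (\<lambda>p. V (k + 1) p - V (k - 1) p))
             + aY \<Omega> A c s Y (\<lambda>p. (V (k + 1) p + 2 * V k p + V (k - 1) p) / 4) (\<lambda>p. V (k + 1) p - V (k - 1) p)
             = l2inner (lebesgue_on \<Omega>) (cavg F k) (tr \<Omega> s Y (\<lambda>p. V (k + 1) p - V (k - 1) p))"
        using sol k W unfolding trapezoidal_solution_def cavg_def[of V] by blast
      \<comment> \<open>Reading \<open>mid V (k - 1)\<close> as the mean of V k and V (k - 1) uses k
        - 1 + 1 = k, valid because k \<ge> 1.\<close>
      show ?thesis
        unfolding E_def
        by (rule trapezoidal_energy_step[OF \<Omega> assms(5-7) assms(2,3) reg[OF kK(1)] reg[OF kK(2)] reg[OF kK(3)]
              dt0 cF _ _ _ _ eq])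
           (simp_all add: mid_def dquot_def kK(4)[simplified])
    qed
    \<comment> \<open>Indexing by j = l - 1 makes the base case the first time level with an empty
      sum.\<close>
    have "E V dt (Suc j) \<le> E V dt 1 + (\<Sum>k\<in>{1..j}. dt * l2norm (lebesgue_on \<Omega>) (cavg F k))" if "j < K" for j
      using that
    proof (induction j)
      case (Suc j)
      then have "Suc j \<in> {1..K - 1}" by auto
      from step[OF this] Suc show ?case
        by simp
    qed simp
    moreover have "l - 1 < K" "Suc (l - 1) = l"
      using l by auto
    ultimately have "E V dt l \<le> E V dt 1 + (\<Sum>k\<in>{1..l - 1}. dt * l2norm (lebesgue_on \<Omega>) (cavg F k))"
      by metis
    \<comment> \<open>The steps use indices up to l - 1 only, all of them below K. The claimed sum
      may also contain k = l, whose term is nonnegative.\<close>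
    also have "(\<Sum>k\<in>{1..l - 1}. dt * l2norm (lebesgue_on \<Omega>) (cavg F k))
        \<le> (\<Sum>k | k \<in> {1..l} \<and> k < K. dt * l2norm (lebesgue_on \<Omega>) (cavg F k))"
      using l dt0 by (intro sum_mono2) auto
    finally have "E V dt l \<le> E V dt 1 + (\<Sum>k | k \<in> {1..l} \<and> k < K. dt * l2norm (lebesgue_on \<Omega>) (cavg F k))"
      by simp
    then show ?thesis
      using le_E[of dt V l] E_le[of V dt 1] by simp
  qed
  show ?thesis
    by (intro exI[of _ "2::real"] conjI allI impI ballI) (simp, elim conjE, rule main)
qed

end
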